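(* Let $K$ be a simplicial complex on $[m]$ such that every $j\in[m]$ belongs to at least one simplex of $K$. Then $$\mathbf{\Sigma}\big((D^1,S^0)^K\big)\simeq\mathbf{\Sigma}\big((D^1,S^0)^{(Y^K,\mathcal{P})}\big)\simeq\bigvee_{J\notin K,\,J\subseteq[m]}\mathbf{\Sigma}^2(K_J).$$
   Context: $[m]=\{1,\dots,m\}$; a simplicial complex $K$ on $[m]$ is a collection of subsets of $[m]$ closed under taking subsets and containing $\varnothing$; $K$ is not distinguished from its geometric realization. $D^1=[-1,1]$, $S^0=\{\pm1\}$. The real moment-angle complex over $K$ is $(D^1,S^0)^K=\bigcup_{\sigma\in K}\prod_{j\in\sigma}D^1\times\prod_{j\in[m]\setminus\sigma}S^0\subseteq (D^1)^m$. For $J\subseteq[m]$, $K_J=\{\sigma\cap J\mid\sigma\in K\}$ is the full subcomplex on $J$. $J\in K$ (resp. $J\notin K$) means that $J$ is (resp. is not) the vertex set of a simplex of $K$. The space with faces $(Y^K,\mathcal{P})$: let $K'$ be the barycentric subdivision of $K$ (its simplices are the chains of nonempty simplices of $K$ ordered by inclusion). For a nonempty $\sigma\in K$, $F_\sigma\subseteq K'$ is the subcomplex consisting of all simplices of the form $\sigma=\sigma_0\subsetneq\sigma_1\subsetneq\cdots\subsetneq\sigma_l$ and their faces, i.e. the geometric realization of the poset $K_{\geq\sigma}=\{\tau\in K\mid\sigma\subseteq\tau\}$. $Y^K=u_0K'$ is the cone on $K'$ with apex $u_0$, and $\mathcal{P}=\{P_j=F_{\{j\}}\}_{j\in[m]}$,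 the $P_j$ being viewed as subcomplexes of the base $K'$ of the cone. For a CW-complex $Y$ with a family $\mathcal{P}=\{P_j\}_{j\in[m]}$ of subcomplexes, a face is a path-connected component of some $P_{\cap J}=\bigcap_{j\in J}P_j$, $J\subseteq[m]$ (with $P_{\cap\varnothing}=Y$), $I_f=\{j\mid f\subseteq P_j\}$ for a face $f$, and $(D^1,S^0)^{(Y,\mathcal{P})}=\bigcup_{f}\big(f\times\prod_{j\in I_f}D^1\times\prod_{j\in[m]\setminus I_f}S^0\big)\subseteq Y\times(D^1)^m$, the union being over all faces $f$. $\mathbf{\Sigma}$ denotes suspension, $\mathbf{\Sigma}^2$ its iterate, and $\bigvee$ the wedge sum (the empty wedge is a point). *)

theory Defs
  imports "HOL-Analysis.Analysis"
begin

section \<open>Quotients, suspensions and wedges of abstract topologies\<close>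

definition quotient_topology :: "'a topology \<Rightarrow> ('a \<times> 'a) set \<Rightarrow> 'a set topology" where
  "quotient_topology X r =
     topology (\<lambda>U. U \<subseteq> topspace X // r \<and> openin X {x \<in> topspace X. r `` {x} \<in> U})"

lemma istopology_quotient:
  "istopology (\<lambda>U. U \<subseteq> topspace X // r \<and> openin X {x \<in> topspace X. r `` {x} \<in> U})"
  unfolding istopology_def
proof (intro conjI allI impI)
  fix S T
  assume S: "S \<subseteq> topspace X // r \<and> openin X {x \<in> topspace X. r `` {x} \<in> S}"
    and T: "T \<subseteq> topspace X // r \<and> openin X {x \<in> topspace X. r `` {x} \<in> T}"
  then show "S \<inter> T \<subseteq> topspace X // r" by blast
  have "{x \<in> topspace X. r `` {x} \<in> S \<inter> T} =
      {x \<in> topspace X. r `` {x} \<in> S} \<inter> {x \<in> topspace X. r `` {x} \<in> T}" by blast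
  with S T show "openin X {x \<in> topspace X. r `` {x} \<in> S \<inter> T}" by (simp add: openin_Int)
next
  fix \<U>
  assume U: "\<forall>S\<in>\<U>. S \<subseteq> topspace X // r \<and> openin X {x \<in> topspace X. r `` {x} \<in> S}"
  then show "\<Union>\<U> \<subseteq> topspace X // r" by blast
  have "{x \<in> topspace X. r `` {x} \<in> \<Union>\<U>} = (\<Union>S\<in>\<U>. {x \<in> topspace X. r `` {x} \<in> S})" by blast
  moreover have "openin X (\<Union>S\<in>\<U>. {x \<in> topspace X. r `` {x} \<in> S})"
    using U by (intro openin_Union) blast
  ultimately show "openin X {x \<in> topspace X. r `` {x} \<in> \<Union>\<U>}" by simp
qed

lemma openin_quotient_topology:
  "openin (quotient_topology X r) U \<longleftrightarrow>
     U \<subseteq> topspace X // r \<and> openin X {x \<in> topspace X. r `` {x} \<in> U}"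
  unfolding quotient_topology_def by (simp add: topology_inverse' istopology_quotient)

lemma topspace_quotient_topology [simp]: "topspace (quotient_topology X r) = topspace X // r"
proof -
  have "{x \<in> topspace X. r `` {x} \<in> topspace X // r} = topspace X"
    by (auto intro: quotientI)
  then have "openin (quotient_topology X r) (topspace X // r)"
    by (simp add: openin_quotient_topology)
  then show ?thesis
    using openin_quotient_topology[of X r "topspace (quotient_topology X r)"]
    by (intro subset_antisym openin_subset) simp_all
qed

lemma quotient_map_quotient_topology:
  "quotient_map X (quotient_topology X r) (\<lambda>x. r `` {x})"
  unfolding quotient_map_def openin_quotient_topology topspace_quotient_topology
  by (simp add: quotient_def UNION_singleton_eq_range)

text \<open>Unreduced suspension: \<open>X \<times> [0,1]\<close> with each end collapsed to a point.  For empty \<open>X\<close> this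
  gives the empty space rather than two points; all spaces suspended below are nonempty.\<close>

definition suspension_rel :: "'a topology \<Rightarrow> (('a \<times> real) \<times> ('a \<times> real)) set" where
  "suspension_rel X =
     {((x, s), (y, t)). x \<in> topspace X \<and> y \<in> topspace X \<and> s \<in> {0..1} \<and> t \<in> {0..1} \<and>
        s = t \<and> (x = y \<or> s = 0 \<or> s = 1)}"

definition suspension :: "'a topology \<Rightarrow> ('a \<times> real) set topology" where
  "suspension X =
     quotient_topology (prod_topology X (top_of_set {0..1})) (suspension_rel X)"

definition suspension_pole :: "'a topology \<Rightarrow> ('a \<times> real) set" where
  "suspension_pole X = topspace X \<times> {1}"

lemma equiv_suspension_rel: "equiv (topspace X \<times> {0..1}) (suspension_rel X)"
  by (auto simp: equiv_def refl_on_def sym_def trans_def suspension_rel_def)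

lemma suspension_pole_in_topspace:
  assumes "topspace X \<noteq> {}"
  shows "suspension_pole X \<in> topspace (suspension X)"
proof -
  obtain x where x: "x \<in> topspace X" using assms by blast
  have "suspension_pole X = suspension_rel X `` {(x, 1)}"
    using x by (auto simp: suspension_pole_def suspension_rel_def)
  then show ?thesis
    using x by (simp add: suspension_def quotientI)
qed

text \<open>The wedge of the spaces \<open>X i\<close> with base points \<open>b i\<close>; the empty wedge is a point.\<close>

definition wedge_rel :: "('i \<Rightarrow> 'a topology) \<Rightarrow> ('i \<Rightarrow> 'a) \<Rightarrow> 'i set \<Rightarrow> (('i \<times> 'a) \<times> ('i \<times> 'a)) set" where
  "wedge_rel X b I =
     {(p, q). p \<in> topspace (sum_topology X I) \<and> q \<in> topspace (sum_topology X I) \<and>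
        (p = q \<or> snd p = b (fst p) \<and> snd q = b (fst q))}"

definition wedge :: "('i \<Rightarrow> 'a topology) \<Rightarrow> ('i \<Rightarrow> 'a) \<Rightarrow> 'i set \<Rightarrow> ('i \<times> 'a) set topology" where
  "wedge X b I =
     (if I = {} then discrete_topology {{}}
      else quotient_topology (sum_topology X I) (wedge_rel X b I))"

lemma equiv_wedge_rel: "equiv (topspace (sum_topology X I)) (wedge_rel X b I)"
  by (auto simp: equiv_def refl_on_def sym_def trans_def wedge_rel_def)


section \<open>Abstract simplicial complexes and their realizations\<close>

definition simplicial_complex_on :: "'v set \<Rightarrow> 'v set set \<Rightarrow> bool" where
  "simplicial_complex_on V K \<longleftrightarrow>
     K \<subseteq> Pow V \<and> {} \<in> K \<and> (\<forall>\<sigma>\<in>K. \<forall>\<tau>. \<tau> \<subseteq> \<sigma> \<longrightarrow> \<tau> \<in> K)"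

definition full_subcomplex :: "'v set set \<Rightarrow> 'v set \<Rightarrow> 'v set set" where
  "full_subcomplex K J = (\<lambda>\<sigma>. \<sigma> \<inter> J) ` K"

text \<open>Points are barycentric coordinates, extended by zero to the whole type; the empty simplex
  contributes no point.  For the finite complexes considered here the product topology on
  coordinates induces the usual topology.\<close>

definition realization_set :: "'v set set \<Rightarrow> ('v \<Rightarrow> real) set" where
  "realization_set K =
     {x. (\<forall>v. 0 \<le> x v) \<and> {v. x v \<noteq> 0} \<in> K \<and> (\<Sum>v | x v \<noteq> 0. x v) = 1}"

definition realization :: "'v set set \<Rightarrow> ('v \<Rightarrow> real) topology" where
  "realization K = subtopology (powertop_real UNIV) (realization_set K)"

definition barycentric_subdivision :: "'v set set \<Rightarrow> 'v set set set" where
  "barycentric_subdivision K = {c. c \<subseteq> K - {{}} \<and> finite c \<and> chain\<^sub>\<subseteq> c}"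

definition dual_face :: "'v set set \<Rightarrow> 'v set \<Rightarrow> 'v set set set" where
  "dual_face K \<sigma> =
     {d. \<exists>c \<in> barycentric_subdivision K. \<sigma> \<in> c \<and> (\<forall>\<tau>\<in>c. \<sigma> \<subseteq> \<tau>) \<and> d \<subseteq> c}"

text \<open>Simplicial cone: the apex is \<open>None\<close>, a vertex \<open>v\<close> of the base becomes \<open>Some v\<close>.\<close>

definition cone_base :: "'v set set \<Rightarrow> 'v option set set" where
  "cone_base L = (\<lambda>\<tau>. Some ` \<tau>) ` L"

definition cone_complex :: "'v set set \<Rightarrow> 'v option set set" where
  "cone_complex L = cone_base L \<union> insert None ` cone_base L"


section \<open>Real moment-angle complexes\<close>

text \<open>\<open>(D\<^sup>1)\<^sup>m\<close> is the cube of extensional functions on \<open>{1..m}\<close>;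
  \<open>disc_sphere_prod m A\<close> has a factor \<open>D\<^sup>1\<close> for \<open>j \<in> A\<close> and \<open>S\<^sup>0\<close> for the other \<open>j\<close>.\<close>

definition disc_sphere_prod :: "nat \<Rightarrow> nat set \<Rightarrow> (nat \<Rightarrow> real) set" where
  "disc_sphere_prod m A = (\<Pi>\<^sub>E j\<in>{1..m}. if j \<in> A then {-1..1} else {-1, 1})"

definition real_moment_angle :: "nat \<Rightarrow> nat set set \<Rightarrow> (nat \<Rightarrow> real) topology" where
  "real_moment_angle m K =
     subtopology (powertop_real {1..m}) (\<Union>\<sigma>\<in>K. disc_sphere_prod m \<sigma>)"

definition faces :: "nat \<Rightarrow> 'a topology \<Rightarrow> (nat \<Rightarrow> 'a set) \<Rightarrow> 'a set set" where
  "faces m Y P = (\<Union>J\<in>Pow {1..m}. path_components_of (subtopology Y (\<Inter>j\<in>J. P j)))"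

definition face_index :: "nat \<Rightarrow> (nat \<Rightarrow> 'a set) \<Rightarrow> 'a set \<Rightarrow> nat set" where
  "face_index m P f = {j \<in> {1..m}. f \<subseteq> P j}"

definition real_moment_angle_faces ::
    "nat \<Rightarrow> 'a topology \<Rightarrow> (nat \<Rightarrow> 'a set) \<Rightarrow> ('a \<times> (nat \<Rightarrow> real)) topology" where
  "real_moment_angle_faces m Y P =
     subtopology (prod_topology Y (powertop_real {1..m}))
       (\<Union>f\<in>faces m Y P. f \<times> disc_sphere_prod m (face_index m P f))"

definition cone_space :: "nat set set \<Rightarrow> (nat set option \<Rightarrow> real) topology" where
  "cone_space K = realization (cone_complex (barycentric_subdivision K))"

definition cone_facet :: "nat set set \<Rightarrow> nat \<Rightarrow> (nat set option \<Rightarrow> real) set" where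
  "cone_facet K j = realization_set (cone_base (dual_face K {j}))"

end

(*
  First equivalence.  A point of the space with faces is a pair (y, x) where y lies in the face indexed
  by the coordinates j with |x j| < 1.  The projection to x has star-shaped fibres.  In general it has no section,
  but x |-> (y(x), clamp (2 x)) is a homotopy inverse: y(x) is a point on the chain of the sets
  {j. |x j| < c} with 1/2 < c < 1, and all of these are contained in the simplices that carry y.

  Second equivalence.  Folding x j to |x j| retracts the complex Z onto the part A with x j >= 0.
  For such a retract, Susp Z is the wedge of Susp A and Susp (Z/A), and reflection identifies Z/A with
  A/{x j = 0}.  Doing this for all coordinates splits Susp Z into the suspensions of C/B_J, where
  C = Z with all x j >= 0, and B_J is the set of points of C with some x j = 0, j in J.
  If J is a simplex, the pair (C, B_J) can be moved into a point; otherwise it deforms to the cone over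
  |K_J| with its base, so that C/B_J becomes the suspension of |K_J|.
*)
theory Submission
  imports Defs
begin

text \<open>The splitting adds a retraction and a quotient map, and maps out of a suspension are
  added by concatenation along its interval. The delicate summand is "point minus mirror image",
  which must be constant on the walls at every level. Scaling its descent by \<open>depth\<close>
  achieves this, but then the turn from the point to its mirror image happens at height 1 - depth,
  away from the pole, where the two differ. Hence the collar: \<open>pull\<close> first moves every
  point with some coordinate in J below 1/2 onto a wall of J, so that wherever depth < 1 the turn
  joins two points that are already identified. This explicit collar does the work of the homotopy
  extension property of (C, B_J). Suspensions are unreduced, and the segment over a wall is kept as
  an arc. Homotopies therefore fix only the common pole at height 1; the opposite poles may travel.
  That every j is a vertex of K is used twice: it yields a point of C with x j = 0, over which the
  new cylinder can be entered, and it makes |K_J| nonempty for nonempty J, so that its unreduced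
  suspension is the quotient of a cone by its base.\<close>

section \<open>Quotients and suspensions\<close>

definition fibrewise_constant :: "'a topology \<Rightarrow> ('a \<Rightarrow> 'b) \<Rightarrow> ('a \<Rightarrow> 'c) \<Rightarrow> bool" where
  "fibrewise_constant T \<pi> f \<longleftrightarrow> (\<forall>z\<in>topspace T. \<forall>z'\<in>topspace T. \<pi> z = \<pi> z' \<longrightarrow> f z = f z')"

text \<open>A neighbourhood in one summand is open in the whole sum, so a box around a point of the
  product can be chosen inside a single summand. This lets a homotopy on a wedge be given cylinder
  by cylinder.\<close>

lemma continuous_map_prod_sum_topology:
  assumes "\<And>i. i \<in> I \<Longrightarrow> continuous_map (prod_topology Z (X i)) Y (\<lambda>(z, x). h (z, (i, x)))"
  shows "continuous_map (prod_topology Z (sum_topology X I)) Y h"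
  unfolding continuous_map_def
proof (intro conjI allI impI)
  show "h \<in> topspace (prod_topology Z (sum_topology X I)) \<rightarrow> topspace Y"
  proof clarsimp
    fix z i x assume *: "z \<in> topspace Z" "i \<in> I" "x \<in> topspace (X i)"
    show "h (z, i, x) \<in> topspace Y"
      using continuous_map_image_subset_topspace[OF assms[OF *(2)]] * by force
  qed
  fix U assume U: "openin Y U"
  show "openin (prod_topology Z (sum_topology X I))
          {p \<in> topspace (prod_topology Z (sum_topology X I)). h p \<in> U}"
    unfolding openin_prod_topology_alt
  proof clarsimp
    fix z i x assume *: "z \<in> topspace Z" "i \<in> I" "x \<in> topspace (X i)" "h (z, i, x) \<in> U"
    define S where "S = {p \<in> topspace (prod_topology Z (X i)). (\<lambda>(z, x). h (z, (i, x))) p \<in> U}"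
    have "openin (prod_topology Z (X i)) S"
      unfolding S_def using assms[OF *(2)] U by (rule openin_continuous_map_preimage)
    moreover have "(z, x) \<in> S"
      using * by (simp add: S_def)
    ultimately obtain A B where AB: "openin Z A" "openin (X i) B" "z \<in> A" "x \<in> B" "A \<times> B \<subseteq> S"
      using openin_prod_topology_alt[of Z "X i" S] by blast
    have "openin (sum_topology X I) (Pair i ` B)"
      using open_map_component_injection[OF *(2)] AB(2) by (auto simp: open_map_def)
    moreover have "A \<times> Pair i ` B \<subseteq> {p \<in> topspace Z \<times> Sigma I (topspace \<circ> X). h p \<in> U}"
    proof -
      have "(a, i, b) \<in> {p \<in> topspace Z \<times> Sigma I (topspace \<circ> X). h p \<in> U}" if "a \<in> A" "b \<in> B" for a b
      proof -
        have "(a, b) \<in> S" using AB(5) that by blast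
        then show ?thesis using *(2) by (simp add: S_def)
      qed
      then show ?thesis by blast
    qed
    ultimately show "\<exists>V. openin Z V \<and> (\<exists>W. openin (sum_topology X I) W \<and> z \<in> V \<and> (i, x) \<in> W \<and>
        V \<times> W \<subseteq> {p \<in> topspace Z \<times> Sigma I (topspace \<circ> X). h p \<in> U})"
      using AB(1,3,4) by blast
  qed
qed

lemma continuous_map_sum_topology:
  assumes "\<And>i. i \<in> I \<Longrightarrow> continuous_map (X i) Y (\<lambda>x. h (i, x))"
  shows "continuous_map (sum_topology X I) Y h"
  unfolding continuous_map_def
proof (intro conjI allI impI)
  show "h \<in> topspace (sum_topology X I) \<rightarrow> topspace Y"
  proof clarsimp
    fix i x assume "i \<in> I" "x \<in> topspace (X i)"
    then show "h (i, x) \<in> topspace Y"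
      using continuous_map_image_subset_topspace[OF assms[of i]] by force
  qed
  fix U assume U: "openin Y U"
  have "{x. (i, x) \<in> {p \<in> topspace (sum_topology X I). h p \<in> U}} = {x \<in> topspace (X i). h (i, x) \<in> U}"
    if "i \<in> I" for i
    using that by auto
  then show "openin (sum_topology X I) {p \<in> topspace (sum_topology X I). h p \<in> U}"
    using openin_continuous_map_preimage[OF assms U] by (auto simp: openin_sum_topology)
qed

text \<open>The product of the unit interval with a quotient map is again a quotient map, because
  the interval is locally compact Hausdorff. A homotopy on \<open>T\<close> that is constant on
  fibres at every time therefore descends, and homotopies of quotients can be written down upstairs
  in coordinates.\<close>

lemma homotopic_with_quotient_lift:
  assumes q: "quotient_map T W \<pi>"
    and h: "homotopic_with (fibrewise_constant T \<pi>) T Y (f \<circ> \<pi>) (g \<circ> \<pi>)"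
  shows "homotopic_with (\<lambda>_. True) W Y f g"
proof -
  have inv: "fibrewise_constant T \<pi> h \<longleftrightarrow> fibrewise_constant T \<pi> k" if "\<And>x. x \<in> topspace T \<Longrightarrow> h x = k x" for h k :: "'a \<Rightarrow> 'c"
    using that by (auto simp: fibrewise_constant_def)
  obtain H where H: "continuous_map (prod_topology (top_of_set {0..1}) T) Y H"
    and H0: "\<And>x. x \<in> topspace T \<Longrightarrow> H (0::real, x) = f (\<pi> x)"
    and H1: "\<And>x. x \<in> topspace T \<Longrightarrow> H (1, x) = g (\<pi> x)"
    and HP: "\<And>t. t \<in> {0..1} \<Longrightarrow> fibrewise_constant T \<pi> (\<lambda>x. H (t, x))"
    using h by (subst (asm) homotopic_with[OF inv]) auto
  have q2: "quotient_map (prod_topology (top_of_set {0..1}) T) (prod_topology (top_of_set {0..1::real}) W) (\<lambda>(x,y). (x, \<pi> y))"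
  proof (rule quotient_map_prod_right[OF _ disjI1 q])
    have "compact_space (top_of_set {0..1::real})"
      by (rule compact_space_subtopology) simp
    then show "locally_compact_space (top_of_set {0..1::real})"
      by (rule compact_imp_locally_compact_space)
    show "Hausdorff_space (top_of_set {0..1::real})"
      by (rule Hausdorff_space_subtopology) simp
  qed
  have fib: "H x = H y" if "x \<in> topspace (prod_topology (top_of_set {0..1}) T)"
      "y \<in> topspace (prod_topology (top_of_set {0..1}) T)"
      "(\<lambda>(x, y). (x, \<pi> y)) x = (\<lambda>(x, y). (x, \<pi> y)) y" for x y
  proof -
    obtain t a t' b where xy: "x = (t, a)" "y = (t', b)"
      by (cases x; cases y) blast
    then have *: "t' = t" "t \<in> {0..1}" "a \<in> topspace T" "b \<in> topspace T" "\<pi> a = \<pi> b"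
      using that by simp_all
    show ?thesis
      using HP[OF *(2)] *(3-5) unfolding xy *(1) fibrewise_constant_def by blast
  qed
  obtain k where k: "continuous_map (prod_topology (top_of_set {0..1::real}) W) Y k"
    and k_eq: "\<And>z. z \<in> topspace (prod_topology (top_of_set {0..1}) T) \<Longrightarrow> k ((\<lambda>(x,y). (x, \<pi> y)) z) = H z"
    by (rule quotient_map_lift_exists[OF q2 H fib]) (assumption+, rule that)
  have surj: "topspace W = \<pi> ` topspace T"
    using q by (simp add: quotient_map_def)
  show ?thesis
    unfolding homotopic_with[of W "\<lambda>_. True" Y f g, simplified]
  proof (intro exI[of _ k] conjI ballI)
    show "continuous_map (prod_topology (top_of_set {0..1}) W) Y k" by (rule k)
  next
    fix w assume "w \<in> topspace W"
    then obtain x where x: "x \<in> topspace T" "w = \<pi> x" using surj by auto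
    show "k (0, w) = f w" using k_eq[of "(0, x)"] x H0 by simp
    show "k (1, w) = g w" using k_eq[of "(1, x)"] x H1 by simp
  qed
qed

lemma homotopy_equivalent_quotients:
  assumes "quotient_map T W \<pi>" "quotient_map T' W' \<pi>'"
    and "continuous_map W W' f" "continuous_map W' W g"
    and "homotopic_with (fibrewise_constant T \<pi>) T W (g \<circ> f \<circ> \<pi>) \<pi>"
    and "homotopic_with (fibrewise_constant T' \<pi>') T' W' (f \<circ> g \<circ> \<pi>') \<pi>'"
  shows "W homotopy_equivalent_space W'"
proof -
  have "homotopic_with (\<lambda>_. True) W W (g \<circ> f) id"
    by (rule homotopic_with_quotient_lift[OF assms(1)]) (simp only: id_comp assms(5))
  moreover have "homotopic_with (\<lambda>_. True) W' W' (f \<circ> g) id"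
    by (rule homotopic_with_quotient_lift[OF assms(2)]) (simp only: id_comp assms(6))
  ultimately show ?thesis
    unfolding homotopy_equivalent_space_def using assms(3,4) by blast
qed

lemma quotient_class_eq_iff:
  assumes "equiv A r" "x \<in> A" "y \<in> A"
  shows "r `` {x} = r `` {y} \<longleftrightarrow> (x, y) \<in> r"
  by (rule eq_equiv_class_iff[OF assms])

lemma suspension_class_eq_iff:
  assumes "(x, s) \<in> topspace X \<times> {0..1}" "(y, t) \<in> topspace X \<times> {0..1}"
  shows "suspension_rel X `` {(x, s)} = suspension_rel X `` {(y, t)} \<longleftrightarrow> s = t \<and> (x = y \<or> s = 0 \<or> s = 1)"
  unfolding quotient_class_eq_iff[OF equiv_suspension_rel assms]
  using assms by (auto simp: suspension_rel_def)

section \<open>Suspension preserves homotopy equivalence\<close>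

lemma quotient_map_suspension:
  "quotient_map (prod_topology X (top_of_set {0..1})) (suspension X) (\<lambda>z. suspension_rel X `` {z})"
  unfolding suspension_def by (rule quotient_map_quotient_topology)

lemma suspension_lift:
  assumes c: "continuous_map (prod_topology X (top_of_set {0..1})) Y f"
    and 0: "\<And>x y. x \<in> topspace X \<Longrightarrow> y \<in> topspace X \<Longrightarrow> f (x, 0) = f (y, 0)"
    and 1: "\<And>x y. x \<in> topspace X \<Longrightarrow> y \<in> topspace X \<Longrightarrow> f (x, 1) = f (y, 1)"
  obtains g where "continuous_map (suspension X) Y g"
    "\<And>x s. x \<in> topspace X \<Longrightarrow> s \<in> {0..1} \<Longrightarrow> g (suspension_rel X `` {(x, s)}) = f (x, s)"
proof -
  have fib: "f z = f z'" if "z \<in> topspace (prod_topology X (top_of_set {0..1}))"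
    "z' \<in> topspace (prod_topology X (top_of_set {0..1}))"
    "suspension_rel X `` {z} = suspension_rel X `` {z'}" for z z'
  proof -
    obtain x s y t where zz: "z = (x, s)" "z' = (y, t)"
      by (cases z; cases z') blast
    have A: "(x, s) \<in> topspace X \<times> {0..1}" "(y, t) \<in> topspace X \<times> {0..1}"
      using that(1,2) zz by simp_all
    have "s = t \<and> (x = y \<or> s = 0 \<or> s = 1)"
      using that(3) unfolding zz suspension_class_eq_iff[OF A] .
    then show ?thesis using 0[of x y] 1[of x y] A unfolding zz by blast
  qed
  obtain g where "continuous_map (suspension X) Y g"
    and "\<And>z. z \<in> topspace (prod_topology X (top_of_set {0..1})) \<Longrightarrow> g (suspension_rel X `` {z}) = f z"
    by (rule quotient_map_lift_exists[OF quotient_map_suspension c fib]) (assumption+, rule that)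
  then show ?thesis
    by (intro that[of g]) simp_all
qed

lemma continuous_map_suspension_class:
  assumes "continuous_map Z X a" "continuous_map Z (top_of_set {0..1}) b"
  shows "continuous_map Z (suspension X) (\<lambda>z. suspension_rel X `` {(a z, b z)})"
  using continuous_map_compose[OF continuous_map_pairedI[OF assms]
      quotient_imp_continuous_map[OF quotient_map_suspension]]
  by (simp add: o_def)

lemma suspension_map:
  assumes h: "continuous_map X Y h"
  obtains k where "continuous_map (suspension X) (suspension Y) k"
    "\<And>x s. x \<in> topspace X \<Longrightarrow> s \<in> {0..1} \<Longrightarrow>
       k (suspension_rel X `` {(x, s)}) = suspension_rel Y `` {(h x, s)}"
proof -
  have hY: "h x \<in> topspace Y" if "x \<in> topspace X" for x
    using h that by (auto simp: continuous_map_def)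
  have "continuous_map (prod_topology X (top_of_set {0..1})) (suspension Y)
      (\<lambda>z. suspension_rel Y `` {(h (fst z), snd z)})"
    by (intro continuous_map_suspension_class continuous_map_snd
        continuous_map_compose[OF continuous_map_fst h, unfolded o_def])
  then obtain k where "continuous_map (suspension X) (suspension Y) k"
    "\<And>x s. x \<in> topspace X \<Longrightarrow> s \<in> {0..1} \<Longrightarrow>
       k (suspension_rel X `` {(x, s)}) = suspension_rel Y `` {(h (fst (x, s)), snd (x, s))}"
    by (rule suspension_lift) (use hY in \<open>auto simp: suspension_class_eq_iff\<close>)
  then show ?thesis by (intro that[of k]) simp_all
qed

lemma homotopic_with_fibrewise_constant:
  "homotopic_with (fibrewise_constant T \<pi>) X Y p q \<longleftrightarrow>
     (\<exists>h. continuous_map (prod_topology (top_of_set {0..1::real}) X) Y h \<and>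
        (\<forall>x \<in> topspace X. h (0, x) = p x) \<and> (\<forall>x \<in> topspace X. h (1, x) = q x) \<and>
        (\<forall>t \<in> {0..1}. fibrewise_constant T \<pi> (\<lambda>x. h (t, x))))"
  if "topspace T = topspace X"
  by (rule homotopic_with) (simp add: fibrewise_constant_def that)

lemma homotopic_suspension_map:
  assumes k: "homotopic_with (\<lambda>_. True) X X k id"
  shows "homotopic_with
     (fibrewise_constant (prod_topology X (top_of_set {0..1})) (\<lambda>z. suspension_rel X `` {z}))
     (prod_topology X (top_of_set {0..1})) (suspension X)
     (\<lambda>z. suspension_rel X `` {(k (fst z), snd z)}) (\<lambda>z. suspension_rel X `` {z})"
proof -
  obtain H where H: "continuous_map (prod_topology (top_of_set {0..1}) X) X H"
    and H0: "\<And>x. H (0::real, x) = k x" and H1: "\<And>x. H (1, x) = x"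
    using k unfolding homotopic_with_def by auto
  have HX: "H (t, x) \<in> topspace X" if "t \<in> {0..1}" "x \<in> topspace X" for t x
    using H that by (auto simp: continuous_map_def)
  have "continuous_map (prod_topology (top_of_set {0..1}) (prod_topology X (top_of_set {0..1}))) X
      (H \<circ> (\<lambda>z. (fst z, fst (snd z))))"
    by (intro continuous_map_compose[OF _ H] continuous_map_pairedI continuous_map_fst
        continuous_map_compose[OF continuous_map_snd continuous_map_fst, unfolded o_def])
  then have c: "continuous_map (prod_topology (top_of_set {0..1}) (prod_topology X (top_of_set {0..1})))
      (suspension X) (\<lambda>z. suspension_rel X `` {(H (fst z, fst (snd z)), snd (snd z))})"
    by (intro continuous_map_suspension_class
        continuous_map_compose[OF continuous_map_snd continuous_map_snd, unfolded o_def])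
      (simp add: o_def)
  have "fibrewise_constant (prod_topology X (top_of_set {0..1})) (\<lambda>z. suspension_rel X `` {z})
      (\<lambda>z. suspension_rel X `` {(H (t, fst z), snd z)})" if t: "t \<in> {0..1}" for t
    unfolding fibrewise_constant_def
    using HX[OF t] by (auto simp: suspension_class_eq_iff)
  then show ?thesis
    unfolding homotopic_with_fibrewise_constant[OF refl]
    by (intro exI[of _ "\<lambda>z. suspension_rel X `` {(H (fst z, fst (snd z)), snd (snd z))}"] conjI c)
      (simp_all add: H0 H1)
qed

lemma homotopy_equivalent_suspension:
  assumes "X homotopy_equivalent_space Y"
  shows "suspension X homotopy_equivalent_space suspension Y"
proof -
  obtain f g where f: "continuous_map X Y f" and g: "continuous_map Y X g"
    and gf: "homotopic_with (\<lambda>_. True) X X (g \<circ> f) id"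
    and fg: "homotopic_with (\<lambda>_. True) Y Y (f \<circ> g) id"
    using assms by (auto simp: homotopy_equivalent_space_def)
  have fX: "\<And>x. x \<in> topspace X \<Longrightarrow> f x \<in> topspace Y" and gY: "\<And>x. x \<in> topspace Y \<Longrightarrow> g x \<in> topspace X"
    using f g by (auto simp: continuous_map_def)
  obtain F where F: "continuous_map (suspension X) (suspension Y) F"
    "\<And>x s. x \<in> topspace X \<Longrightarrow> s \<in> {0..1} \<Longrightarrow>
       F (suspension_rel X `` {(x, s)}) = suspension_rel Y `` {(f x, s)}"
    using suspension_map[OF f] by blast
  obtain G where G: "continuous_map (suspension Y) (suspension X) G"
    "\<And>x s. x \<in> topspace Y \<Longrightarrow> s \<in> {0..1} \<Longrightarrow>
       G (suspension_rel Y `` {(x, s)}) = suspension_rel X `` {(g x, s)}"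
    using suspension_map[OF g] by blast
  show ?thesis
    by (rule homotopy_equivalent_quotients[OF quotient_map_suspension quotient_map_suspension F(1) G(1)];
        rule homotopic_with_eq[OF homotopic_suspension_map[OF gf]]
          homotopic_with_eq[OF homotopic_suspension_map[OF fg]])
      (auto simp: F G fX gY fibrewise_constant_def)
qed

text \<open>On an extensional set each coordinate outside \<open>I\<close> is the constant
  \<open>undefined\<close>, hence continuous, so the product over \<open>I\<close> induces the same
  topology as the product over the whole index type. Continuity questions thereby become statements
  about \<open>continuous_on\<close>.\<close>

lemma subtopology_product_topology_extensional:
  fixes S :: "('i \<Rightarrow> 'b::topological_space) set"
  assumes "S \<subseteq> extensional I"
  shows "subtopology (product_topology (\<lambda>_. euclidean) I) S = top_of_set S"
proof -
  have "continuous_map (subtopology (product_topology (\<lambda>_. euclidean :: 'b topology) I) S) euclidean (\<lambda>x. x i)" for i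
  proof (cases "i \<in> I")
    case True
    then show ?thesis
      by (intro continuous_map_from_subtopology continuous_map_product_projection)
  next
    case False
    then have "\<And>x. x \<in> topspace (subtopology (product_topology (\<lambda>_. euclidean :: 'b topology) I) S) \<Longrightarrow> undefined = x i"
      using assms by (auto simp: extensional_def)
    then show ?thesis
      by (intro continuous_map_eq[OF continuous_map_const[THEN iffD2]]) auto
  qed
  then have 1: "continuous_map (subtopology (product_topology (\<lambda>_. euclidean) I) S) (top_of_set S) (\<lambda>x. x)"
    by (auto simp: continuous_map_in_subtopology continuous_map_componentwise_UNIV simp flip: euclidean_product_topology)
  have "continuous_on S (\<lambda>x. x i)" for i
    by (rule continuous_on_product_then_coordinatewise) (rule continuous_on_id)
  then have "continuous_map (top_of_set S) (product_topology (\<lambda>_. euclidean) I) (\<lambda>x. x)"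
    unfolding continuous_map_componentwise using assms by simp
  then have 2: "continuous_map (top_of_set S) (subtopology (product_topology (\<lambda>_. euclidean) I) S) (\<lambda>x. x)"
    by (simp add: continuous_map_in_subtopology)
  have "homeomorphic_maps (top_of_set S) (subtopology (product_topology (\<lambda>_. euclidean) I) S) id id"
    unfolding homeomorphic_maps_def id_def using 1 2 by simp
  then show ?thesis
    unfolding homeomorphic_maps_id .
qed

section \<open>The projection to the real moment-angle complex\<close>

definition moment_angle_set :: "nat \<Rightarrow> nat set set \<Rightarrow> (nat \<Rightarrow> real) set" where
  "moment_angle_set m K =
     {x \<in> extensional {1..m}. (\<forall>j\<in>{1..m}. \<bar>x j\<bar> \<le> 1) \<and> {j\<in>{1..m}. \<bar>x j\<bar> \<noteq> 1} \<in> K}"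

lemma mem_disc_sphere_prod:
  "x \<in> disc_sphere_prod m A \<longleftrightarrow>
     x \<in> extensional {1..m} \<and> (\<forall>j\<in>{1..m}. \<bar>x j\<bar> \<le> 1 \<and> (\<bar>x j\<bar> \<noteq> 1 \<longrightarrow> j \<in> A))"
proof -
  have "x j \<in> (if j \<in> A then {-1..1} else {-1, 1}) \<longleftrightarrow> \<bar>x j\<bar> \<le> 1 \<and> (\<bar>x j\<bar> \<noteq> 1 \<longrightarrow> j \<in> A)" for j
    by (auto simp: abs_if split: if_splits)
  then show ?thesis
    unfolding disc_sphere_prod_def PiE_iff by auto
qed

lemma real_moment_angle_eq:
  assumes "simplicial_complex_on {1..m} K"
  shows "real_moment_angle m K = top_of_set (moment_angle_set m K)"
proof -
  have down: "\<tau> \<in> K" if "\<sigma> \<in> K" "\<tau> \<subseteq> \<sigma>" for \<sigma> \<tau>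
    using assms that by (auto simp: simplicial_complex_on_def)
  have "(\<Union>\<sigma>\<in>K. disc_sphere_prod m \<sigma>) = moment_angle_set m K"
  proof (intro equalityI subsetI)
    fix x assume "x \<in> (\<Union>\<sigma>\<in>K. disc_sphere_prod m \<sigma>)"
    then obtain \<sigma> where \<sigma>: "\<sigma> \<in> K" "x \<in> disc_sphere_prod m \<sigma>" by blast
    then have "{j\<in>{1..m}. \<bar>x j\<bar> \<noteq> 1} \<subseteq> \<sigma>" by (auto simp: mem_disc_sphere_prod)
    from down[OF \<sigma>(1) this] \<sigma>(2) show "x \<in> moment_angle_set m K"
      by (auto simp: mem_disc_sphere_prod moment_angle_set_def)
  next
    fix x assume "x \<in> moment_angle_set m K"
    then show "x \<in> (\<Union>\<sigma>\<in>K. disc_sphere_prod m \<sigma>)"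
      by (intro UN_I[of "{j\<in>{1..m}. \<bar>x j\<bar> \<noteq> 1}"]) (auto simp: mem_disc_sphere_prod moment_angle_set_def)
  qed
  moreover have "moment_angle_set m K \<subseteq> extensional {1..m}"
    by (auto simp: moment_angle_set_def)
  ultimately show ?thesis
    by (simp add: real_moment_angle_def subtopology_product_topology_extensional)
qed

text \<open>If no coordinate becomes free, the free coordinates still form a face. Every motion
  inside the complex below is justified in this way.\<close>

lemma moment_angle_set_mono:
  assumes "simplicial_complex_on {1..m} K" "x \<in> moment_angle_set m K" "y \<in> extensional {1..m}"
    and "\<And>j. j \<in> {1..m} \<Longrightarrow> \<bar>y j\<bar> \<le> 1" "\<And>j. j \<in> {1..m} \<Longrightarrow> \<bar>x j\<bar> = 1 \<Longrightarrow> \<bar>y j\<bar> = 1"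
  shows "y \<in> moment_angle_set m K"
proof -
  have "{j\<in>{1..m}. \<bar>y j\<bar> \<noteq> 1} \<subseteq> {j\<in>{1..m}. \<bar>x j\<bar> \<noteq> 1}"
    using assms(5) by blast
  moreover have "{j\<in>{1..m}. \<bar>x j\<bar> \<noteq> 1} \<in> K"
    using assms(2) by (simp add: moment_angle_set_def)
  ultimately have "{j\<in>{1..m}. \<bar>y j\<bar> \<noteq> 1} \<in> K"
    using assms(1) unfolding simplicial_complex_on_def by blast
  then show ?thesis
    using assms(3,4) by (simp add: moment_angle_set_def)
qed

text \<open>Fix y and let f be its component in the intersection of all \<open>P j\<close> that
  contain y. No face through y has a larger index set than f, so over y the union equals the
  contribution of f.\<close>

lemma union_faces_eq:
  "(\<Union>f\<in>faces m Y P. f \<times> disc_sphere_prod m (face_index m P f)) =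
     {(y, x). y \<in> topspace Y \<and> x \<in> disc_sphere_prod m {j\<in>{1..m}. y \<in> P j}}"
proof (intro equalityI subsetI)
  fix z assume "z \<in> (\<Union>f\<in>faces m Y P. f \<times> disc_sphere_prod m (face_index m P f))"
  then obtain f J where f: "f \<in> path_components_of (subtopology Y (\<Inter>j\<in>J. P j))"
    and z: "fst z \<in> f" "snd z \<in> disc_sphere_prod m (face_index m P f)"
    by (auto simp: faces_def)
  have "f \<subseteq> topspace Y"
    using path_components_of_subset[OF f] by auto
  moreover have "face_index m P f \<subseteq> {j\<in>{1..m}. fst z \<in> P j}"
    using z(1) by (auto simp: face_index_def)
  ultimately show "z \<in> {(y, x). y \<in> topspace Y \<and> x \<in> disc_sphere_prod m {j\<in>{1..m}. y \<in> P j}}"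
    using z by (auto simp: mem_disc_sphere_prod case_prod_unfold)
next
  fix z assume "z \<in> {(y, x). y \<in> topspace Y \<and> x \<in> disc_sphere_prod m {j\<in>{1..m}. y \<in> P j}}"
  then obtain y x where z: "z = (y, x)" "y \<in> topspace Y" "x \<in> disc_sphere_prod m {j\<in>{1..m}. y \<in> P j}"
    by blast
  define J where "J = {j\<in>{1..m}. y \<in> P j}"
  have "y \<in> topspace (subtopology Y (\<Inter>j\<in>J. P j))"
    using z by (auto simp: J_def)
  then obtain f where f: "f \<in> path_components_of (subtopology Y (\<Inter>j\<in>J. P j))" "y \<in> f"
    unfolding Union_path_components_of[symmetric] by (rule UnionE)
  have "f \<subseteq> (\<Inter>j\<in>J. P j)"
    using path_components_of_subset[OF f(1)] by auto
  then have "J \<subseteq> face_index m P f"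
    by (auto simp: face_index_def J_def)
  then have "x \<in> disc_sphere_prod m (face_index m P f)"
    using z(3) by (auto simp: mem_disc_sphere_prod J_def)
  moreover have "f \<in> faces m Y P"
    using f(1) by (auto simp: faces_def J_def)
  ultimately show "z \<in> (\<Union>f\<in>faces m Y P. f \<times> disc_sphere_prod m (face_index m P f))"
    using z(1) f(2) by blast
qed

section \<open>The cone on the barycentric subdivision in coordinates\<close>

text \<open>The cone apex is treated as the barycentre of the empty simplex, so that the cone on the
  barycentric subdivision is the order complex of all of \<open>K\<close>.\<close>

definition barycentre :: "'v set \<Rightarrow> 'v set option" where
  "barycentre \<tau> = (if \<tau> = {} then None else Some \<tau>)"

lemma barycentre_simps [simp]:
  "barycentre {} = None" "\<tau> \<noteq> {} \<Longrightarrow> barycentre \<tau> = Some \<tau>"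
  "barycentre \<tau> = barycentre \<sigma> \<longleftrightarrow> \<tau> = \<sigma>" "barycentre \<tau> \<noteq> Some {}"
  by (auto simp: barycentre_def)

lemma barycentre_cases: "v = Some {} \<or> (\<exists>\<tau>. v = barycentre \<tau>)"
  by (cases v) (auto simp: barycentre_def)

lemma sum_support:
  assumes "finite A" "{v. x v \<noteq> 0} \<subseteq> A"
  shows "(\<Sum>v | x v \<noteq> (0::real). x v) = sum x A"
  using assms by (intro sum.mono_neutral_left) auto

lemma sum_support_barycentre:
  assumes "finite K" "y (Some {}) = 0" "\<And>\<tau>. y (barycentre \<tau>) \<noteq> 0 \<Longrightarrow> \<tau> \<in> K"
  shows "(\<Sum>v | y v \<noteq> (0::real). y v) = (\<Sum>\<tau>\<in>K. y (barycentre \<tau>))"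
proof -
  have "{v. y v \<noteq> 0} \<subseteq> barycentre ` K"
  proof
    fix v assume "v \<in> {v. y v \<noteq> 0}"
    then show "v \<in> barycentre ` K"
      using barycentre_cases[of v] assms(2,3) by auto
  qed
  then have "(\<Sum>v | y v \<noteq> 0. y v) = sum y (barycentre ` K)"
    using assms(1) by (intro sum_support) auto
  also have "\<dots> = (\<Sum>\<tau>\<in>K. y (barycentre \<tau>))"
    by (subst sum.reindex) (auto simp: inj_on_def)
  finally show ?thesis .
qed

text \<open>The empty simplex is comparable with every simplex, so adding the apex to a chain
  imposes no condition. \<open>Some {}\<close> is the one vertex outside the range of
  \<open>barycentre\<close> and has to be excluded separately.\<close>

lemma topspace_cone_space:
  assumes "finite K" "{} \<in> K"
  shows "y \<in> topspace (cone_space K) \<longleftrightarrow>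
     (\<forall>v. 0 \<le> y v) \<and> y (Some {}) = 0 \<and> (\<forall>\<tau>. y (barycentre \<tau>) \<noteq> 0 \<longrightarrow> \<tau> \<in> K) \<and>
     (\<forall>\<tau> \<sigma>. y (barycentre \<tau>) \<noteq> 0 \<longrightarrow> y (barycentre \<sigma>) \<noteq> 0 \<longrightarrow> \<tau> \<subseteq> \<sigma> \<or> \<sigma> \<subseteq> \<tau>) \<and>
     (\<Sum>\<tau>\<in>K. y (barycentre \<tau>)) = 1" (is "_ \<longleftrightarrow> ?R")
proof -
  let ?S = "{v. y v \<noteq> 0}"
  have "?S \<in> cone_complex (barycentric_subdivision K) \<longleftrightarrow>
     y (Some {}) = 0 \<and> (\<forall>\<tau>. y (barycentre \<tau>) \<noteq> 0 \<longrightarrow> \<tau> \<in> K) \<and>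
     (\<forall>\<tau> \<sigma>. y (barycentre \<tau>) \<noteq> 0 \<longrightarrow> y (barycentre \<sigma>) \<noteq> 0 \<longrightarrow> \<tau> \<subseteq> \<sigma> \<or> \<sigma> \<subseteq> \<tau>)" (is "?A \<longleftrightarrow> ?B")
  proof
    assume ?A
    then obtain c where c: "c \<in> barycentric_subdivision K" "?S \<subseteq> insert None (Some ` c)"
      by (auto simp: cone_complex_def cone_base_def)
    have 1: "\<tau> = {} \<or> \<tau> \<in> c" if "y (barycentre \<tau>) \<noteq> 0" for \<tau>
      using c(2) that by (cases "\<tau> = {}") auto
    have 2: "\<And>\<tau>. \<tau> \<in> c \<Longrightarrow> \<tau> \<in> K \<and> \<tau> \<noteq> {}" "\<And>\<tau> \<sigma>. \<tau> \<in> c \<Longrightarrow> \<sigma> \<in> c \<Longrightarrow> \<tau> \<subseteq> \<sigma> \<or> \<sigma> \<subseteq> \<tau>"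
      using c(1) by (auto simp: barycentric_subdivision_def chain_subset_def)
    have "y (Some {}) = 0"
      using c(2) 2(1) by auto
    then show ?B
      using 1 2 assms(2) by (metis empty_subsetI)
  next
    assume B: ?B
    define c where "c = {\<tau>. \<tau> \<noteq> {} \<and> y (Some \<tau>) \<noteq> 0}"
    have cK: "c \<subseteq> K - {{}}"
    proof
      fix \<tau> assume "\<tau> \<in> c"
      then show "\<tau> \<in> K - {{}}" using B by (auto simp: c_def barycentre_def split: if_splits)
    qed
    have "chain\<^sub>\<subseteq> c"
      unfolding chain_subset_def
    proof (intro ballI)
      fix \<tau> \<sigma> assume "\<tau> \<in> c" "\<sigma> \<in> c"
      then have "y (barycentre \<tau>) \<noteq> 0" "y (barycentre \<sigma>) \<noteq> 0" by (auto simp: c_def)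
      then show "\<tau> \<subseteq> \<sigma> \<or> \<sigma> \<subseteq> \<tau>" using B by blast
    qed
    then have c: "c \<in> barycentric_subdivision K"
      using cK assms(1) by (auto simp: barycentric_subdivision_def intro: finite_subset)
    have S: "?S - {None} = Some ` c"
    proof (intro equalityI subsetI)
      fix v assume v: "v \<in> ?S - {None}"
      then obtain \<tau> where "v = Some \<tau>" by (cases v) auto
      then show "v \<in> Some ` c" using v B by (auto simp: c_def)
    qed (auto simp: c_def)
    show ?A
    proof (cases "y None = 0")
      case True
      then have "?S = Some ` c" using S by auto
      then show ?thesis using c by (auto simp: cone_complex_def cone_base_def)
    next
      case False
      then have "?S = insert None (Some ` c)" using S by auto
      then show ?thesis using c by (auto simp: cone_complex_def cone_base_def)
    qed
  qed
  moreover have "(\<Sum>v | y v \<noteq> 0. y v) = (\<Sum>\<tau>\<in>K. y (barycentre \<tau>))"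
    if "y (Some {}) = 0" "\<forall>\<tau>. y (barycentre \<tau>) \<noteq> 0 \<longrightarrow> \<tau> \<in> K"
    using that assms(1) by (intro sum_support_barycentre) auto
  ultimately show ?thesis
    by (auto simp: cone_space_def realization_def realization_set_def)
qed

text \<open>If all simplices carrying y contain j, then \<open>{j}\<close> can be put below them as
  the least element of a chain, which is exactly what the dual face asks for. The apex is excluded
  automatically, since its simplex is empty.\<close>

lemma mem_cone_facet:
  assumes "finite K" "simplicial_complex_on V K"
  shows "y \<in> cone_facet K j \<longleftrightarrow>
     y \<in> topspace (cone_space K) \<and> (\<forall>\<tau>. y (barycentre \<tau>) \<noteq> 0 \<longrightarrow> j \<in> \<tau>)"
proof -
  have K0: "{} \<in> K" and down: "\<And>\<sigma> \<tau>. \<sigma> \<in> K \<Longrightarrow> \<tau> \<subseteq> \<sigma> \<Longrightarrow> \<tau> \<in> K"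
    using assms(2) by (auto simp: simplicial_complex_on_def)
  note top = topspace_cone_space[OF assms(1) K0]
  show ?thesis
  proof
    assume y: "y \<in> cone_facet K j"
    then obtain d c where d: "{v. y v \<noteq> 0} = Some ` d" "d \<subseteq> c" "c \<in> barycentric_subdivision K"
      "\<forall>\<tau>\<in>c. j \<in> \<tau>"
      by (auto simp: cone_facet_def realization_set_def cone_base_def dual_face_def)
    have "d \<in> barycentric_subdivision K"
    proof -
      have c: "c \<subseteq> K - {{}}" "finite c" "\<forall>a\<in>c. \<forall>b\<in>c. a \<subseteq> b \<or> b \<subseteq> a"
        using d(3) by (simp_all add: barycentric_subdivision_def chain_subset_def)
      have "\<forall>a\<in>d. \<forall>b\<in>d. a \<subseteq> b \<or> b \<subseteq> a" using c(3) d(2) by blast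
      then show ?thesis
        using finite_subset[OF d(2) c(2)] c(1) d(2)
        by (auto simp: barycentric_subdivision_def chain_subset_def)
    qed
    then have "y \<in> topspace (cone_space K)"
      using y d(1) by (auto simp: cone_space_def realization_def realization_set_def cone_facet_def
          cone_complex_def cone_base_def)
    moreover have "j \<in> \<tau>" if "y (barycentre \<tau>) \<noteq> 0" for \<tau>
    proof -
      have "barycentre \<tau> \<in> Some ` d" using that d(1) by blast
      then show ?thesis using d(2,4) by (cases "\<tau> = {}") auto
    qed
    ultimately show "y \<in> topspace (cone_space K) \<and> (\<forall>\<tau>. y (barycentre \<tau>) \<noteq> 0 \<longrightarrow> j \<in> \<tau>)" by blast
  next
    assume R: "y \<in> topspace (cone_space K) \<and> (\<forall>\<tau>. y (barycentre \<tau>) \<noteq> 0 \<longrightarrow> j \<in> \<tau>)"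
    define d where "d = {\<tau>. y (barycentre \<tau>) \<noteq> 0}"
    have dK: "d \<subseteq> K" "\<forall>\<tau>\<in>d. j \<in> \<tau>" "\<forall>\<tau>\<in>d. \<forall>\<sigma>\<in>d. \<tau> \<subseteq> \<sigma> \<or> \<sigma> \<subseteq> \<tau>"
      using R unfolding top d_def by auto
    have "d \<noteq> {}"
    proof
      assume "d = {}"
      then have "(\<Sum>\<tau>\<in>K. y (barycentre \<tau>)) = 0" by (intro sum.neutral) (auto simp: d_def)
      then show False using R unfolding top by simp
    qed
    then have jK: "{j} \<in> K" using dK(1,2) down by blast
    have "\<forall>\<tau>\<in>d. {j} \<subseteq> \<tau>" "{} \<notin> d" "finite d"
      using dK(1,2) finite_subset[OF dK(1) assms(1)] by auto
    then have "insert {j} d \<in> barycentric_subdivision K"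
      using dK(1,3) jK by (simp add: barycentric_subdivision_def chain_subset_def) blast
    then have "d \<in> dual_face K {j}"
      using dK(2) by (auto simp: dual_face_def)
    moreover have "{v. y v \<noteq> 0} = Some ` d"
    proof (intro equalityI subsetI)
      fix v assume v: "v \<in> {v. y v \<noteq> 0}"
      moreover have "y (Some {}) = 0" using R unfolding top by blast
      ultimately obtain \<tau> where \<tau>: "v = barycentre \<tau>" using barycentre_cases[of v] by auto
      then have "\<tau> \<in> d" using v by (simp add: d_def)
      moreover from this have "\<tau> \<noteq> {}" using dK(2) by blast
      ultimately show "v \<in> Some ` d" using \<tau> by auto
    next
      fix v assume "v \<in> Some ` d"
      then obtain \<tau> where \<tau>: "\<tau> \<in> d" "v = Some \<tau>" by blast
      moreover from this have "\<tau> \<noteq> {}" using dK(2) by blast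
      ultimately show "v \<in> {v. y v \<noteq> 0}" by (auto simp: d_def)
    qed
    ultimately show "y \<in> cone_facet K j"
      using R by (auto simp: cone_facet_def realization_set_def cone_base_def cone_space_def realization_def)
  qed
qed

section \<open>A homotopy inverse of the projection\<close>

lemma homotopic_with_canonI:
  assumes "continuous_on ({0..1::real} \<times> S) h" "h ` ({0..1} \<times> S) \<subseteq> T"
    and "\<And>x. x \<in> S \<Longrightarrow> h (0, x) = f x" "\<And>x. x \<in> S \<Longrightarrow> h (1, x) = g x"
  shows "homotopic_with_canon (\<lambda>_. True) S T f g"
  using assms unfolding homotopic_with[of "top_of_set S" "\<lambda>_. True" "top_of_set T" f g, simplified]
  by (intro exI[of _ h]) auto


text \<open>The weight is nonzero exactly if \<open>\<tau>\<close> is a sublevel set of \<open>j \<mapsto> \<bar>x j\<bar>\<close> for some level strictly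
  between \<open>1/2\<close> and 1, with no coordinate on that level; such sets form a chain.\<close>

definition chain_weight :: "nat \<Rightarrow> (nat \<Rightarrow> real) \<Rightarrow> nat set \<Rightarrow> real" where
  "chain_weight m x \<tau> =
     (\<Prod>j\<in>\<tau>. \<Prod>k\<in>{1..m} - \<tau>. max 0 (\<bar>x k\<bar> - \<bar>x j\<bar>)) * (\<Prod>j\<in>\<tau>. max 0 (1 - \<bar>x j\<bar>)) *
     (\<Prod>k\<in>{1..m} - \<tau>. max 0 (\<bar>x k\<bar> - 1/2))"

definition chain_point :: "nat \<Rightarrow> nat set set \<Rightarrow> (nat \<Rightarrow> real) \<Rightarrow> nat set option \<Rightarrow> real" where
  "chain_point m K x v =
     (case v of None \<Rightarrow> chain_weight m x {} | Some \<tau> \<Rightarrow> if \<tau> \<in> K - {{}} then chain_weight m x \<tau> else 0) /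
     (\<Sum>\<sigma>\<in>K. chain_weight m x \<sigma>)"

text \<open>After doubling, exactly the coordinates with |x j| < 1/2 are free. They belong to every
  set of nonzero weight, because the last factor of \<open>chain_weight\<close> demands 1/2 < |x k|
  outside the set.\<close>

definition double_clamp :: "nat \<Rightarrow> (nat \<Rightarrow> real) \<Rightarrow> nat \<Rightarrow> real" where
  "double_clamp m x = (\<lambda>j\<in>{1..m}. max (-1) (min 1 (2 * x j)))"

lemma chain_weight_nonneg: "0 \<le> chain_weight m x \<tau>"
  unfolding chain_weight_def by (intro mult_nonneg_nonneg prod_nonneg) auto

lemma chain_weight_neq_0:
  assumes "finite \<tau>"
  shows "chain_weight m x \<tau> \<noteq> 0 \<longleftrightarrow>
     (\<forall>j\<in>\<tau>. \<bar>x j\<bar> < 1 \<and> (\<forall>k\<in>{1..m} - \<tau>. \<bar>x j\<bar> < \<bar>x k\<bar>)) \<and> (\<forall>k\<in>{1..m} - \<tau>. 1/2 < \<bar>x k\<bar>)"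
proof -
  have "max 0 a \<noteq> 0 \<longleftrightarrow> 0 < a" for a :: real by (auto simp: max_def)
  then show ?thesis
    using assms by (auto simp: chain_weight_def)
qed

lemma continuous_on_coordinate:
  fixes f :: "'a::topological_space \<Rightarrow> 'b \<Rightarrow> real"
  shows "continuous_on S f \<Longrightarrow> continuous_on S (\<lambda>z. f z i)"
  by (rule continuous_on_product_then_coordinatewise)

lemma continuous_on_chain_weight:
  assumes "continuous_on S f"
  shows "continuous_on S (\<lambda>z. chain_weight m (f z) \<tau>)"
  unfolding chain_weight_def
  by (intro continuous_intros continuous_on_coordinate[OF assms])

locale vertex_complex =
  fixes m :: nat and K :: "nat set set"
  assumes complex: "simplicial_complex_on {1..m} K"
begin

lemma empty_in: "{} \<in> K"
  and face_subset: "\<sigma> \<in> K \<Longrightarrow> \<sigma> \<subseteq> {1..m}"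
  and face_down: "\<sigma> \<in> K \<Longrightarrow> \<tau> \<subseteq> \<sigma> \<Longrightarrow> \<tau> \<in> K"
  using complex by (auto simp: simplicial_complex_on_def)

lemma finite_complex: "finite K"
  by (rule finite_subset[of _ "Pow {1..m}"]) (use face_subset in auto)

lemma finite_face: "\<sigma> \<in> K \<Longrightarrow> finite \<sigma>"
  by (rule finite_subset[OF face_subset]) auto

abbreviation "Z \<equiv> moment_angle_set m K"

text \<open>The set of coordinates with |x j| \<le> 1/2 always has positive weight: its members lie
  strictly below the remaining coordinates, which exceed 1/2. It is a face because all its members
  are free in x.\<close>

lemma sum_chain_weight_pos:
  assumes "x \<in> Z"
  shows "0 < (\<Sum>\<sigma>\<in>K. chain_weight m x \<sigma>)"
proof -
  let ?\<tau> = "{j\<in>{1..m}. \<bar>x j\<bar> \<le> 1/2}"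
  have "?\<tau> \<subseteq> {j\<in>{1..m}. \<bar>x j\<bar> \<noteq> 1}" by auto
  then have \<tau>: "?\<tau> \<in> K"
    using assms face_down by (auto simp: moment_angle_set_def)
  have "chain_weight m x ?\<tau> \<noteq> 0"
    by (subst chain_weight_neq_0) auto
  then have "0 < chain_weight m x ?\<tau>"
    using chain_weight_nonneg[of m x ?\<tau>] by linarith
  also have "\<dots> \<le> (\<Sum>\<sigma>\<in>K. chain_weight m x \<sigma>)"
    using \<tau> finite_complex chain_weight_nonneg by (intro member_le_sum) auto
  finally show ?thesis .
qed

lemma chain_point_barycentre:
  "chain_point m K x (barycentre \<tau>) =
     (if \<tau> \<in> K then chain_weight m x \<tau> else 0) / (\<Sum>\<sigma>\<in>K. chain_weight m x \<sigma>)"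
  using empty_in by (auto simp: chain_point_def barycentre_def)

lemma chain_point_neq_0:
  assumes "chain_point m K x (barycentre \<tau>) \<noteq> 0"
  shows "\<tau> \<in> K" "\<And>j. j \<in> \<tau> \<Longrightarrow> \<bar>x j\<bar> < 1"
    "\<And>j k. j \<in> \<tau> \<Longrightarrow> k \<in> {1..m} - \<tau> \<Longrightarrow> \<bar>x j\<bar> < \<bar>x k\<bar>"
    "\<And>k. k \<in> {1..m} - \<tau> \<Longrightarrow> 1/2 < \<bar>x k\<bar>"
proof -
  have "\<tau> \<in> K" and w: "chain_weight m x \<tau> \<noteq> 0"
    using assms by (auto simp: chain_point_barycentre split: if_splits)
  then show "\<tau> \<in> K" by blast
  note w' = w[unfolded chain_weight_neq_0[OF finite_face[OF \<open>\<tau> \<in> K\<close>]]]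
  show "\<And>j. j \<in> \<tau> \<Longrightarrow> \<bar>x j\<bar> < 1"
    "\<And>j k. j \<in> \<tau> \<Longrightarrow> k \<in> {1..m} - \<tau> \<Longrightarrow> \<bar>x j\<bar> < \<bar>x k\<bar>"
    "\<And>k. k \<in> {1..m} - \<tau> \<Longrightarrow> 1/2 < \<bar>x k\<bar>"
    using w' by blast+
qed

lemmas mem_cone = topspace_cone_space[OF finite_complex empty_in]

lemma chain_point_in_cone:
  assumes "x \<in> Z"
  shows "chain_point m K x \<in> topspace (cone_space K)"
  unfolding mem_cone
proof (intro conjI allI impI)
  note S = sum_chain_weight_pos[OF assms]
  show "0 \<le> chain_point m K x v" for v
    using S by (auto simp: chain_point_def chain_weight_nonneg split: option.split)
  show "chain_point m K x (Some {}) = 0"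
    by (simp add: chain_point_def)
  show "\<tau> \<in> K" if "chain_point m K x (barycentre \<tau>) \<noteq> 0" for \<tau>
    using chain_point_neq_0(1)[OF that] .
  show "\<tau> \<subseteq> \<sigma> \<or> \<sigma> \<subseteq> \<tau>"
    if \<tau>: "chain_point m K x (barycentre \<tau>) \<noteq> 0" and \<sigma>: "chain_point m K x (barycentre \<sigma>) \<noteq> 0" for \<tau> \<sigma>
  proof (rule ccontr)
    assume "\<not> ?thesis"
    \<comment> \<open>Two incomparable sets would yield coordinates with both |x j| < |x k| and |x
      k| < |x j|.\<close>
    then obtain j k where "j \<in> \<tau>" "j \<notin> \<sigma>" "k \<in> \<sigma>" "k \<notin> \<tau>" by blast
    moreover from this have "j \<in> {1..m}" "k \<in> {1..m}"
      using face_subset chain_point_neq_0(1)[OF \<tau>] chain_point_neq_0(1)[OF \<sigma>] by blast+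
    ultimately show False
      using chain_point_neq_0(3)[OF \<tau>, of j k] chain_point_neq_0(3)[OF \<sigma>, of k j] by simp
  qed
  show "(\<Sum>\<tau>\<in>K. chain_point m K x (barycentre \<tau>)) = 1"
    using S by (simp add: chain_point_barycentre sum_divide_distrib[symmetric])
qed

definition face_space_set :: "((nat set option \<Rightarrow> real) \<times> (nat \<Rightarrow> real)) set" where
  "face_space_set = {(y, x). y \<in> topspace (cone_space K) \<and> x \<in> extensional {1..m} \<and>
     (\<forall>j\<in>{1..m}. \<bar>x j\<bar> \<le> 1 \<and> (\<bar>x j\<bar> \<noteq> 1 \<longrightarrow> (\<forall>\<tau>. y (barycentre \<tau>) \<noteq> 0 \<longrightarrow> j \<in> \<tau>)))}"

lemma real_moment_angle_faces_eq:
  "real_moment_angle_faces m (cone_space K) (cone_facet K) = top_of_set face_space_set"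
proof -
  have eq: "(\<Union>f\<in>faces m (cone_space K) (cone_facet K). f \<times> disc_sphere_prod m (face_index m (cone_facet K) f))
      = face_space_set"
    unfolding union_faces_eq face_space_set_def mem_disc_sphere_prod
      mem_cone_facet[OF finite_complex complex] by auto
  define Y where "Y = topspace (cone_space K)"
  have Y: "cone_space K = top_of_set Y"
    by (simp add: Y_def cone_space_def realization_def euclidean_product_topology)
  have sub: "face_space_set \<subseteq> UNIV \<times> extensional {1..m}"
    by (auto simp: face_space_set_def)
  have "subtopology (prod_topology (cone_space K) (powertop_real {1..m})) face_space_set
      = subtopology (prod_topology (subtopology (cone_space K) UNIV)
          (subtopology (powertop_real {1..m}) (extensional {1..m}))) face_space_set"
    unfolding subtopology_Times[symmetric] subtopology_subtopology using sub by (simp add: Int_absorb1)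
  also have "\<dots> = subtopology (top_of_set (Y \<times> extensional {1..m})) face_space_set"
    by (simp add: subtopology_product_topology_extensional Y)
  also have "\<dots> = top_of_set face_space_set"
  proof -
    have "face_space_set \<subseteq> Y \<times> extensional {1..m}" by (auto simp: face_space_set_def Y_def)
    then show ?thesis by (simp add: subtopology_subtopology Int_absorb1)
  qed
  finally show ?thesis
    unfolding real_moment_angle_faces_def eq .
qed

lemma double_clamp_bounds:
  assumes "j \<in> {1..m}"
  shows "\<bar>double_clamp m x j\<bar> \<le> 1" "\<bar>double_clamp m x j\<bar> \<noteq> 1 \<longleftrightarrow> \<bar>x j\<bar> < 1/2"
    "\<bar>x j\<bar> = 1 \<Longrightarrow> double_clamp m x j = x j"
  using assms by (auto simp: double_clamp_def)

lemma convex_abs_le_1: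
  assumes "\<bar>a\<bar> \<le> 1" "\<bar>b\<bar> \<le> 1" "t \<in> {0..1::real}"
  shows "\<bar>(1 - t) * a + t * b\<bar> \<le> 1"
proof -
  have "\<bar>(1 - t) * a + t * b\<bar> \<le> (1 - t) * \<bar>a\<bar> + t * \<bar>b\<bar>"
    using assms(3) by (intro order_trans[OF abs_triangle_ineq]) (simp add: abs_mult)
  also have "\<dots> \<le> 1"
    using assms by (intro convex_bound_le) auto
  finally show ?thesis .
qed

lemma continuous_on_double_clamp:
  assumes "continuous_on S f"
  shows "continuous_on S (\<lambda>z. double_clamp m (f z) j)"
  using continuous_on_coordinate[OF assms, of j]
  by (cases "j \<in> {1..m}") (auto simp: double_clamp_def intro!: continuous_intros)

lemma continuous_on_chain_point:
  assumes "continuous_on S f" "f ` S \<subseteq> Z"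
  shows "continuous_on S (\<lambda>z. chain_point m K (f z) v)"
proof -
  have "(\<Sum>\<sigma>\<in>K. chain_weight m (f z) \<sigma>) \<noteq> 0" if "z \<in> S" for z
    using sum_chain_weight_pos[of "f z"] assms(2) that by fastforce
  moreover have "continuous_on S (\<lambda>z. case v of None \<Rightarrow> chain_weight m (f z) {} |
      Some \<tau> \<Rightarrow> if \<tau> \<in> K - {{}} then chain_weight m (f z) \<tau> else 0)"
  proof (cases v)
    case (Some \<tau>)
    then show ?thesis
      by (cases "\<tau> \<in> K - {{}}") (simp_all add: continuous_on_chain_weight[OF assms(1)] del: Diff_iff)
  qed (simp add: continuous_on_chain_weight[OF assms(1)])
  ultimately show ?thesis
    unfolding chain_point_def
    by (intro continuous_on_divide continuous_on_sum continuous_on_chain_weight[OF assms(1)]) auto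
qed

definition blend :: "real \<Rightarrow> (nat \<Rightarrow> real) \<Rightarrow> nat \<Rightarrow> real" where
  "blend t x = (\<lambda>j\<in>{1..m}. (1 - t) * double_clamp m x j + t * x j)"

lemma blend_props:
  assumes "t \<in> {0..1}" "j \<in> {1..m}" "\<bar>x j\<bar> \<le> 1"
  shows "\<bar>blend t x j\<bar> \<le> 1" "\<bar>x j\<bar> = 1 \<Longrightarrow> blend t x j = x j"
  using assms convex_abs_le_1[OF double_clamp_bounds(1)[OF assms(2)] assms(3,1)]
  by (auto simp: blend_def double_clamp_bounds algebra_simps)

text \<open>Clamped doubling fixes every coordinate of absolute value 1, so no coordinate becomes
  free along the segment.\<close>

lemma blend_in:
  assumes "t \<in> {0..1}" "x \<in> Z"
  shows "blend t x \<in> Z"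
proof (rule moment_angle_set_mono[OF complex assms(2)])
  show "blend t x \<in> extensional {1..m}" by (simp add: blend_def)
  show "\<bar>blend t x j\<bar> \<le> 1" if "j \<in> {1..m}" for j
    using assms that by (intro blend_props) (auto simp: moment_angle_set_def)
  show "\<bar>blend t x j\<bar> = 1" if "j \<in> {1..m}" "\<bar>x j\<bar> = 1" for j
    using blend_props(2)[OF assms(1) that(1)] that by simp
qed

lemma blend_ends:
  assumes "x \<in> extensional {1..m}"
  shows "blend 0 x = double_clamp m x" "blend 1 x = x"
  using assms by (auto simp: blend_def double_clamp_def fun_eq_iff extensional_def)

lemma continuous_on_blend:
  assumes "continuous_on S f" "continuous_on S t"
  shows "continuous_on S (\<lambda>z. blend (t z) (f z))"
proof (rule continuous_on_coordinatewise_then_product)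
  fix j
  show "continuous_on S (\<lambda>z. blend (t z) (f z) j)"
    using continuous_on_coordinate[OF assms(1), of j] continuous_on_double_clamp[OF assms(1), of j] assms(2)
    by (cases "j \<in> {1..m}") (auto simp: blend_def intro!: continuous_intros)
qed

text \<open>Since the weights of y sum to 1, some simplex of K carries y; it contains all free
  coordinates of x.\<close>

lemma face_space_proj:
  assumes "(y, x) \<in> face_space_set"
  shows "x \<in> Z"
proof -
  have y: "y \<in> topspace (cone_space K)" using assms by (simp add: face_space_set_def)
  have "\<exists>\<tau>. y (barycentre \<tau>) \<noteq> 0"
  proof (rule ccontr)
    assume "\<not> ?thesis"
    then have "(\<Sum>\<tau>\<in>K. y (barycentre \<tau>)) = 0" by simp
    then show False using y unfolding mem_cone by simp
  qed
  then obtain \<tau> where \<tau>: "y (barycentre \<tau>) \<noteq> 0" by blast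
  then have "\<tau> \<in> K" using y unfolding mem_cone by blast
  moreover have "{j\<in>{1..m}. \<bar>x j\<bar> \<noteq> 1} \<subseteq> \<tau>"
    using assms \<tau> by (auto simp: face_space_set_def)
  ultimately show ?thesis
    using face_down assms by (auto simp: face_space_set_def moment_angle_set_def)
qed

lemma moment_angle_section:
  assumes "x \<in> Z"
  shows "(chain_point m K x, double_clamp m x) \<in> face_space_set"
proof -
  have "j \<in> \<tau>" if "j \<in> {1..m}" "\<bar>double_clamp m x j\<bar> \<noteq> 1" "chain_point m K x (barycentre \<tau>) \<noteq> 0" for j \<tau>
  proof (rule ccontr)
    assume "j \<notin> \<tau>"
    then show False
      using chain_point_neq_0(4)[OF that(3), of j] that(1,2) double_clamp_bounds(2)[OF that(1), of x] by auto
  qed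
  moreover have "double_clamp m x \<in> extensional {1..m}" by (simp add: double_clamp_def)
  ultimately show ?thesis
    using chain_point_in_cone[OF assms] double_clamp_bounds(1) by (auto simp: face_space_set_def)
qed

definition slide :: "real \<Rightarrow> (nat set option \<Rightarrow> real) \<Rightarrow> (nat \<Rightarrow> real) \<Rightarrow> nat set option \<Rightarrow> real" where
  "slide t y x v = (1 - t) * chain_point m K x v + t * y v"

text \<open>The simplices carrying \<open>y\<close> contain all free coordinates of \<open>x\<close>, those carrying
  the chain point of \<open>x\<close> consist of free coordinates; hence together they form a chain.\<close>

lemma slide_in:
  assumes yx: "(y, x) \<in> face_space_set" and t: "t \<in> {0..1}"
  shows "(slide t y x, double_clamp m x) \<in> face_space_set"
proof -
  have x: "x \<in> Z" using face_space_proj[OF yx] .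
  let ?c = "chain_point m K x"
  have y: "y \<in> topspace (cone_space K)" using yx by (simp add: face_space_set_def)
  note C = chain_point_in_cone[OF x, unfolded mem_cone] and Y = y[unfolded mem_cone]
  have CK: "\<tau> \<in> K" if "?c (barycentre \<tau>) \<noteq> 0" for \<tau> using C that by blast
  have YK: "\<tau> \<in> K" if "y (barycentre \<tau>) \<noteq> 0" for \<tau> using Y that by blast
  have Cc: "\<tau> \<subseteq> \<sigma> \<or> \<sigma> \<subseteq> \<tau>" if "?c (barycentre \<tau>) \<noteq> 0" "?c (barycentre \<sigma>) \<noteq> 0" for \<tau> \<sigma>
    using C that by blast
  have Yc: "\<tau> \<subseteq> \<sigma> \<or> \<sigma> \<subseteq> \<tau>" if "y (barycentre \<tau>) \<noteq> 0" "y (barycentre \<sigma>) \<noteq> 0" for \<tau> \<sigma>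
    using Y that by blast
  have C1: "(\<Sum>\<tau>\<in>K. ?c (barycentre \<tau>)) = 1" and Y1: "(\<Sum>\<tau>\<in>K. y (barycentre \<tau>)) = 1"
    using C Y by blast+
  have supp: "?c (barycentre \<tau>) \<noteq> 0 \<or> y (barycentre \<tau>) \<noteq> 0" if "slide t y x (barycentre \<tau>) \<noteq> 0" for \<tau>
    using that by (auto simp: slide_def)
  have mix: "\<tau> \<subseteq> \<sigma>" if "?c (barycentre \<tau>) \<noteq> 0" "y (barycentre \<sigma>) \<noteq> 0" for \<tau> \<sigma>
  proof
    fix j assume j: "j \<in> \<tau>"
    then have "j \<in> {1..m}" using face_subset chain_point_neq_0(1)[OF that(1)] by blast
    moreover have "\<bar>x j\<bar> \<noteq> 1" using chain_point_neq_0(2)[OF that(1) j] by simp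
    ultimately show "j \<in> \<sigma>" using yx that(2) by (auto simp: face_space_set_def)
  qed
  have "slide t y x \<in> topspace (cone_space K)"
    unfolding mem_cone
  proof (intro conjI allI impI)
    show "0 \<le> slide t y x v" for v
      using C Y t by (auto simp: slide_def intro!: add_nonneg_nonneg mult_nonneg_nonneg)
    show "slide t y x (Some {}) = 0" using C Y by (simp add: slide_def)
    show "\<tau> \<in> K" if "slide t y x (barycentre \<tau>) \<noteq> 0" for \<tau>
      using supp[OF that] CK YK by blast
    show "\<tau> \<subseteq> \<sigma> \<or> \<sigma> \<subseteq> \<tau>"
      if "slide t y x (barycentre \<tau>) \<noteq> 0" "slide t y x (barycentre \<sigma>) \<noteq> 0" for \<tau> \<sigma>
      using supp[OF that(1)] supp[OF that(2)] mix[of \<tau> \<sigma>] mix[of \<sigma> \<tau>] Cc[of \<tau> \<sigma>] Yc[of \<tau> \<sigma>] by argo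
    show "(\<Sum>\<tau>\<in>K. slide t y x (barycentre \<tau>)) = 1"
      by (simp add: slide_def sum.distrib sum_distrib_left[symmetric] C1 Y1)
  qed
  moreover have "j \<in> \<tau>"
    if j: "j \<in> {1..m}" "\<bar>double_clamp m x j\<bar> \<noteq> 1" and "slide t y x (barycentre \<tau>) \<noteq> 0" for j \<tau>
    using supp[OF that(3)]
  proof
    assume "?c (barycentre \<tau>) \<noteq> 0"
    then show ?thesis using moment_angle_section[OF x] j by (auto simp: face_space_set_def)
  next
    assume "y (barycentre \<tau>) \<noteq> 0"
    moreover have "\<bar>x j\<bar> \<noteq> 1" using double_clamp_bounds(2)[OF j(1), of x] j(2) by auto
    ultimately show ?thesis using yx j(1) by (auto simp: face_space_set_def)
  qed
  moreover have "double_clamp m x \<in> extensional {1..m}" by (simp add: double_clamp_def)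
  ultimately show ?thesis
    using double_clamp_bounds(1) by (auto simp: face_space_set_def)
qed

lemma blend_in_face_space:
  assumes yx: "(y, x) \<in> face_space_set" and t: "t \<in> {0..1}"
  shows "(y, blend t x) \<in> face_space_set"
proof -
  have "\<bar>blend t x j\<bar> \<le> 1 \<and> (\<bar>blend t x j\<bar> \<noteq> 1 \<longrightarrow> \<bar>x j\<bar> \<noteq> 1)" if "j \<in> {1..m}" for j
    using blend_props[OF t that, of x] yx that by (auto simp: face_space_set_def)
  moreover have "blend t x \<in> extensional {1..m}" by (simp add: blend_def)
  ultimately show ?thesis using yx by (auto simp: face_space_set_def)
qed

lemma moment_angle_homotopy_equivalent_faces:
  "real_moment_angle m K homotopy_equivalent_space
     real_moment_angle_faces m (cone_space K) (cone_facet K)"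
  unfolding real_moment_angle_eq[OF complex] real_moment_angle_faces_eq homotopy_equivalent_space_def
proof (intro exI conjI)
  define s where "s = (\<lambda>x. (chain_point m K x, double_clamp m x))"
  have cs: "continuous_on Z s"
    unfolding s_def
    by (intro continuous_on_Pair continuous_on_coordinatewise_then_product
        continuous_on_chain_point continuous_on_double_clamp continuous_on_id) auto
  show "continuous_map (top_of_set Z) (top_of_set face_space_set) s"
    using cs moment_angle_section by (auto simp: s_def)
  show "continuous_map (top_of_set face_space_set) (top_of_set Z) snd"
    using face_space_proj by (auto intro: continuous_on_snd continuous_on_id)
  show "homotopic_with_canon (\<lambda>_. True) Z Z (snd \<circ> s) id"
  proof (rule homotopic_with_canonI[where h = "\<lambda>z. blend (fst z) (snd z)"])
    show "continuous_on ({0..1} \<times> Z) (\<lambda>z. blend (fst z) (snd z))"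
      by (intro continuous_on_blend continuous_intros)
    show "(\<lambda>z. blend (fst z) (snd z)) ` ({0..1} \<times> Z) \<subseteq> Z"
      using blend_in by auto
  qed (auto simp: s_def blend_ends moment_angle_set_def)
  have fst_Z: "snd ` face_space_set \<subseteq> Z" using face_space_proj by auto
  \<comment> \<open>The order of the two legs matters. The chain point of x is carried by simplices
    that contain the free coordinates of \<open>double_clamp m x\<close> but possibly not those of
    x. So y is moved while the second component is the doubled point, and that component is released
    only after y is back.\<close>
  have 1: "homotopic_with_canon (\<lambda>_. True) face_space_set face_space_set (s \<circ> snd) (\<lambda>(y, x). (y, double_clamp m x))"
  proof (rule homotopic_with_canonI[where h = "\<lambda>z. (slide (fst z) (fst (snd z)) (snd (snd z)), double_clamp m (snd (snd z)))"])
    show "continuous_on ({0..1} \<times> face_space_set)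
        (\<lambda>z. (slide (fst z) (fst (snd z)) (snd (snd z)), double_clamp m (snd (snd z))))"
      unfolding slide_def
    proof (intro continuous_on_Pair continuous_on_coordinatewise_then_product
        continuous_on_double_clamp continuous_on_add continuous_on_mult continuous_on_chain_point)
      show "(\<lambda>z. snd (snd z)) ` ({0..1} \<times> face_space_set) \<subseteq> Z" using face_space_proj by auto
    qed (intro continuous_intros continuous_on_coordinate)+
    show "(\<lambda>z. (slide (fst z) (fst (snd z)) (snd (snd z)), double_clamp m (snd (snd z)))) ` ({0..1} \<times> face_space_set)
        \<subseteq> face_space_set"
      using slide_in by auto
  qed (auto simp: s_def slide_def)
  have 2: "homotopic_with_canon (\<lambda>_. True) face_space_set face_space_set (\<lambda>(y, x). (y, double_clamp m x)) id"
  proof (rule homotopic_with_canonI[where h = "\<lambda>z. (fst (snd z), blend (fst z) (snd (snd z)))"])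
    show "continuous_on ({0..1} \<times> face_space_set) (\<lambda>z. (fst (snd z), blend (fst z) (snd (snd z))))"
      by (intro continuous_on_Pair continuous_on_blend continuous_intros)
    show "(\<lambda>z. (fst (snd z), blend (fst z) (snd (snd z)))) ` ({0..1} \<times> face_space_set) \<subseteq> face_space_set"
      using blend_in_face_space by auto
  qed (auto simp: blend_ends face_space_set_def)
  show "homotopic_with_canon (\<lambda>_. True) face_space_set face_space_set (s \<circ> snd) id"
    by (rule homotopic_with_trans[OF 1 2])
qed

end

section \<open>Wedges of suspensions of quotients\<close>

text \<open>Both pieces keep the form \<open>top_of_set\<close>, so that nested case distinctions
  are handled by applying the lemma repeatedly.\<close>

lemma continuous_map_cases_le_top_of_set:
  fixes p q :: "'a::topological_space \<Rightarrow> real"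
  assumes "continuous_on T p" "continuous_on T q"
    and "continuous_map (top_of_set {z\<in>T. p z \<le> q z}) Y f"
    and "continuous_map (top_of_set {z\<in>T. q z \<le> p z}) Y g"
    and "\<And>z. z \<in> T \<Longrightarrow> p z = q z \<Longrightarrow> f z = g z"
  shows "continuous_map (top_of_set T) Y (\<lambda>z. if p z \<le> q z then f z else g z)"
proof (rule continuous_map_cases_le)
  have "T \<inter> {z. z \<in> topspace (top_of_set T) \<and> p z \<le> q z} = {z\<in>T. p z \<le> q z}"
    "T \<inter> {z. z \<in> topspace (top_of_set T) \<and> q z \<le> p z} = {z\<in>T. q z \<le> p z}" by auto
  then show "continuous_map (subtopology (top_of_set T) {z. z \<in> topspace (top_of_set T) \<and> p z \<le> q z}) Y f"
    "continuous_map (subtopology (top_of_set T) {z. z \<in> topspace (top_of_set T) \<and> q z \<le> p z}) Y g"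
    using assms(3,4) by (simp_all only: subtopology_subtopology)
qed (use assms in auto)

text \<open>\<open>suspension_wedge D S B\<close> is the wedge, along the poles at height 1, of the
  suspensions of \<open>S\<close> modulo \<open>B J\<close> for \<open>J \<in> D\<close>; here each level of \<open>B J\<close> is collapsed
  separately, so this is the unreduced suspension of the quotient space.\<close>

definition gluing_form :: "('i \<Rightarrow> 'a set) \<Rightarrow> 'i \<times> 'a \<times> real \<Rightarrow> 'i option \<times> 'a option \<times> real" where
  "gluing_form B = (\<lambda>(J, x, s). if s = 1 then (None, None, 1)
     else if s = 0 \<or> x \<in> B J then (Some J, None, s) else (Some J, Some x, s))"

definition cylinders :: "'i set \<Rightarrow> 'a::topological_space set \<Rightarrow> ('i \<times> 'a \<times> real) topology" where
  "cylinders D S = sum_topology (\<lambda>_. top_of_set (S \<times> {0..1})) D"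

text \<open>The relation is the kernel of a normal form in which \<open>None\<close> replaces
  whatever is collapsed; this makes it an equivalence relation at once.\<close>

definition gluing_rel ::
    "'i set \<Rightarrow> 'a::topological_space set \<Rightarrow> ('i \<Rightarrow> 'a set) \<Rightarrow> (('i \<times> 'a \<times> real) \<times> ('i \<times> 'a \<times> real)) set" where
  "gluing_rel D S B = {(z, z'). z \<in> topspace (cylinders D S) \<and> z' \<in> topspace (cylinders D S) \<and>
     gluing_form B z = gluing_form B z'}"

definition suspension_wedge ::
    "'i set \<Rightarrow> 'a::topological_space set \<Rightarrow> ('i \<Rightarrow> 'a set) \<Rightarrow> ('i \<times> 'a \<times> real) set topology" where
  "suspension_wedge D S B = quotient_topology (cylinders D S) (gluing_rel D S B)"

definition wedge_class ::
    "'i set \<Rightarrow> 'a::topological_space set \<Rightarrow> ('i \<Rightarrow> 'a set) \<Rightarrow> 'i \<Rightarrow> 'a \<Rightarrow> real \<Rightarrow> ('i \<times> 'a \<times> real) set" where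
  "wedge_class D S B J x s = gluing_rel D S B `` {(J, x, s)}"

lemma topspace_cylinders [simp]: "topspace (cylinders D S) = D \<times> S \<times> {0..1}"
  by (auto simp: cylinders_def)

lemma quotient_map_suspension_wedge:
  "quotient_map (cylinders D S) (suspension_wedge D S B) (\<lambda>(J, x, s). wedge_class D S B J x s)"
  using quotient_map_quotient_topology[of "cylinders D S" "gluing_rel D S B"]
  by (simp add: suspension_wedge_def wedge_class_def case_prod_unfold)

lemma wedge_class_eq_iff:
  assumes "J \<in> D" "x \<in> S" "s \<in> {0..1}" "J' \<in> D" "x' \<in> S" "s' \<in> {0..1}"
  shows "wedge_class D S B J x s = wedge_class D S B J' x' s' \<longleftrightarrow>
     s = 1 \<and> s' = 1 \<or> J = J' \<and> s = s' \<and> (s = 0 \<or> x = x' \<or> x \<in> B J \<and> x' \<in> B J)"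
proof -
  have e: "equiv (topspace (cylinders D S)) (gluing_rel D S B)"
    by (auto simp: equiv_def refl_on_def sym_def trans_def gluing_rel_def)
  have "wedge_class D S B J x s = wedge_class D S B J' x' s' \<longleftrightarrow> ((J, x, s), (J', x', s')) \<in> gluing_rel D S B"
    unfolding wedge_class_def using assms by (intro quotient_class_eq_iff[OF e]) auto
  also have "\<dots> \<longleftrightarrow> s = 1 \<and> s' = 1 \<or> J = J' \<and> s = s' \<and> (s = 0 \<or> x = x' \<or> x \<in> B J \<and> x' \<in> B J)"
    using assms by (auto simp: gluing_rel_def gluing_form_def)
  finally show ?thesis .
qed

section \<open>Maps and homotopies given on the cylinders\<close>

lemma continuous_map_wedge_class:
  assumes "J \<in> D" "continuous_on T a" "a ` T \<subseteq> S" "continuous_on T b" "b ` T \<subseteq> {0..1}"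
  shows "continuous_map (top_of_set T) (suspension_wedge D S B) (\<lambda>z. wedge_class D S B J (a z) (b z))"
proof -
  have 1: "continuous_map (top_of_set T) (top_of_set (S \<times> {0..1})) (\<lambda>z. (a z, b z))"
    using assms by (auto intro!: continuous_on_Pair)
  have 2: "continuous_map (top_of_set (S \<times> {0..1})) (cylinders D S) (\<lambda>z. (J, z))"
    unfolding cylinders_def
    using continuous_map_component_injection[OF assms(1), of "\<lambda>_. top_of_set (S \<times> {0..1})"] by simp
  show ?thesis
    using continuous_map_compose[OF continuous_map_compose[OF 1 2]
        quotient_imp_continuous_map[OF quotient_map_suspension_wedge[of D S B]]]
    by (simp add: o_def)
qed

text \<open>The condition under which a map on one cylinder descends to the wedge. At height 1 the
  value b is prescribed, since all cylinders share that pole. At height 0 only constancy is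
  required, so a homotopy may drag the lower pole along; \<open>contract_homotopic\<close> and
  \<open>spread_gather_homotopic_new\<close> depend on this freedom.\<close>

definition slice_compatible :: "'a set \<Rightarrow> 'a set \<Rightarrow> 'c \<Rightarrow> ('a \<times> real \<Rightarrow> 'c) \<Rightarrow> bool" where
  "slice_compatible S C b h \<longleftrightarrow> (\<forall>x\<in>S. h (x, 1) = b) \<and> (\<forall>x\<in>S. \<forall>x'\<in>S. h (x, 0) = h (x', 0)) \<and>
     (\<forall>x\<in>S \<inter> C. \<forall>x'\<in>S \<inter> C. \<forall>s\<in>{0..1}. h (x, s) = h (x', s))"

lemma slice_compatibleI:
  assumes "\<And>x. x \<in> S \<Longrightarrow> h (x, 1) = b" "\<And>x x'. x \<in> S \<Longrightarrow> x' \<in> S \<Longrightarrow> h (x, 0) = h (x', 0)"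
    and "\<And>x x' s. x \<in> S \<Longrightarrow> x \<in> C \<Longrightarrow> x' \<in> S \<Longrightarrow> x' \<in> C \<Longrightarrow> s \<in> {0..1} \<Longrightarrow> h (x, s) = h (x', s)"
  shows "slice_compatible S C b h"
  using assms unfolding slice_compatible_def by blast

lemma wedge_class_fibre:
  assumes h: "\<And>J. J \<in> D \<Longrightarrow> slice_compatible S (B J) b (\<lambda>z. h (J, z))"
    and z: "z \<in> D \<times> S \<times> {0..1}" "z' \<in> D \<times> S \<times> {0..1}"
    and eq: "(\<lambda>(J, x, s). wedge_class D S B J x s) z = (\<lambda>(J, x, s). wedge_class D S B J x s) z'"
  shows "h z = h z'"
proof -
  obtain J x s J' x' s' where zz: "z = (J, x, s)" "z' = (J', x', s')"
    by (cases z; cases z') blast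
  then have in_T: "J \<in> D" "x \<in> S" "s \<in> {0..1}" "J' \<in> D" "x' \<in> S" "s' \<in> {0..1}"
    using z by auto
  have "s = 1 \<and> s' = 1 \<or> J = J' \<and> s = s' \<and> (s = 0 \<or> x = x' \<or> x \<in> B J \<and> x' \<in> B J)"
    using eq unfolding zz prod.case wedge_class_eq_iff[OF in_T] .
  then consider "s = 1" "s' = 1" | "J = J'" "s = s'" "s = 0" | "J = J'" "s = s'" "x = x'"
    | "J = J'" "s = s'" "x \<in> B J" "x' \<in> B J" by blast
  then show ?thesis
  proof cases
    case 1
    then show ?thesis
      using h[OF in_T(1)] h[OF in_T(4)] in_T(2,5) by (simp add: zz slice_compatible_def)
  next
    case 2
    then show ?thesis
      using h[OF in_T(1)] in_T(2,5) unfolding zz slice_compatible_def by blast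
  next
    case 4
    then show ?thesis
      using h[OF in_T(1)] in_T(2,3,5) unfolding zz slice_compatible_def by blast
  qed (simp add: zz)
qed

lemma suspension_wedge_lift:
  assumes c: "\<And>J. J \<in> D \<Longrightarrow> continuous_map (top_of_set (S \<times> {0..1})) Y (\<lambda>z. h (J, z))"
    and h: "\<And>J. J \<in> D \<Longrightarrow> slice_compatible S (B J) b (\<lambda>z. h (J, z))"
  obtains k where "continuous_map (suspension_wedge D S B) Y k"
    "\<And>J x s. J \<in> D \<Longrightarrow> x \<in> S \<Longrightarrow> s \<in> {0..1} \<Longrightarrow> k (wedge_class D S B J x s) = h (J, x, s)"
proof -
  have "continuous_map (cylinders D S) Y h"
    unfolding cylinders_def by (rule continuous_map_sum_topology) (rule c)
  moreover have fib: "h z = h z'" if "z \<in> topspace (cylinders D S)" "z' \<in> topspace (cylinders D S)"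
    "(\<lambda>(J, x, s). wedge_class D S B J x s) z = (\<lambda>(J, x, s). wedge_class D S B J x s) z'" for z z'
  proof (rule wedge_class_fibre[of D S B b h])
    show "slice_compatible S (B J) b (\<lambda>z. h (J, z))" if "J \<in> D" for J by (rule h[OF that])
  qed (use that in simp_all)
  ultimately obtain k where kc: "continuous_map (suspension_wedge D S B) Y k"
    and k: "\<And>z. z \<in> topspace (cylinders D S) \<Longrightarrow> k ((\<lambda>(J, x, s). wedge_class D S B J x s) z) = h z"
    by (rule quotient_map_lift_exists[OF quotient_map_suspension_wedge]) (assumption+, rule that)
  have "k (wedge_class D S B J x s) = h (J, x, s)" if "J \<in> D" "x \<in> S" "s \<in> {0..1}" for J x s
    using k[of "(J, x, s)"] that by simp
  then show ?thesis
    by (rule that[OF kc])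
qed

lemma homotopic_with_slices:
  assumes "\<And>J. J \<in> D \<Longrightarrow> homotopic_with (slice_compatible S (B J) b) (top_of_set (S \<times> {0..1})) Y
     (\<lambda>z. f (J, z)) (\<lambda>z. g (J, z))"
  shows "homotopic_with (fibrewise_constant (cylinders D S) (\<lambda>(J, x, s). wedge_class D S B J x s))
     (cylinders D S) Y f g"
proof -
  have inv: "slice_compatible S (B J) b h \<longleftrightarrow> slice_compatible S (B J) b k"
    if "\<And>z. z \<in> topspace (top_of_set (S \<times> {0..1})) \<Longrightarrow> h z = k z" for J h k
    using that unfolding slice_compatible_def by simp
  have "\<forall>J\<in>D. \<exists>h. continuous_map (prod_topology (top_of_set {0..1::real}) (top_of_set (S \<times> {0..1}))) Y h \<and>
       (\<forall>z\<in>S \<times> {0..1}. h (0, z) = f (J, z)) \<and> (\<forall>z\<in>S \<times> {0..1}. h (1, z) = g (J, z)) \<and>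
       (\<forall>t\<in>{0..1}. slice_compatible S (B J) b (\<lambda>z. h (t, z)))"
  proof
    fix J assume "J \<in> D"
    show "\<exists>h. continuous_map (prod_topology (top_of_set {0..1::real}) (top_of_set (S \<times> {0..1}))) Y h \<and>
       (\<forall>z\<in>S \<times> {0..1}. h (0, z) = f (J, z)) \<and> (\<forall>z\<in>S \<times> {0..1}. h (1, z) = g (J, z)) \<and>
       (\<forall>t\<in>{0..1}. slice_compatible S (B J) b (\<lambda>z. h (t, z)))"
      using assms[OF \<open>J \<in> D\<close>] by (subst (asm) homotopic_with[OF inv]) simp_all
  qed
  from bchoice[OF this] obtain H where H: "\<And>J. J \<in> D \<Longrightarrow> continuous_map (prod_topology (top_of_set {0..1::real}) (top_of_set (S \<times> {0..1}))) Y (H J)"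
    "\<And>J z. J \<in> D \<Longrightarrow> z \<in> S \<times> {0..1} \<Longrightarrow> H J (0, z) = f (J, z)"
    "\<And>J z. J \<in> D \<Longrightarrow> z \<in> S \<times> {0..1} \<Longrightarrow> H J (1, z) = g (J, z)"
    "\<And>J t. J \<in> D \<Longrightarrow> t \<in> {0..1} \<Longrightarrow> slice_compatible S (B J) b (\<lambda>z. H J (t, z))"
    by blast
  show ?thesis
    unfolding homotopic_with_fibrewise_constant[OF refl]
  proof (intro exI[of _ "\<lambda>(t, J, z). H J (t, z)"] conjI ballI)
    have "continuous_map (prod_topology (top_of_set {0..1::real}) (top_of_set (S \<times> {0..1}))) Y
        (\<lambda>(t, z). case (t, J, z) of (t, J, z) \<Rightarrow> H J (t, z))" if "J \<in> D" for J
      using H(1)[OF that] by (simp add: case_prod_unfold)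
    then show "continuous_map (prod_topology (top_of_set {0..1}) (cylinders D S)) Y (\<lambda>(t, J, z). H J (t, z))"
      unfolding cylinders_def by (intro continuous_map_prod_sum_topology)
    show "fibrewise_constant (cylinders D S) (\<lambda>(J, x, s). wedge_class D S B J x s)
        (\<lambda>x. case (t, x) of (t, J, z) \<Rightarrow> H J (t, z))" if t: "t \<in> {0..1}" for t
      unfolding fibrewise_constant_def topspace_cylinders
    proof (intro ballI impI)
      fix z z' assume *: "z \<in> D \<times> S \<times> {0..1}" "z' \<in> D \<times> S \<times> {0..1}"
        "(case z of (J, x, s) \<Rightarrow> wedge_class D S B J x s) = (case z' of (J, x, s) \<Rightarrow> wedge_class D S B J x s)"
      show "(case (t, z) of (t, J, z) \<Rightarrow> H J (t, z)) = (case (t, z') of (t, J, z) \<Rightarrow> H J (t, z))"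
        by (rule wedge_class_fibre[of D S B b "\<lambda>z. case (t, z) of (t, J, z) \<Rightarrow> H J (t, z)", OF _ *])
          (use H(4)[OF _ t] in simp)
    qed
  qed (auto simp: H(2,3))
qed

lemma homotopic_with_sliceI:
  assumes c: "continuous_map (top_of_set ({0..1::real} \<times> S \<times> {0..1})) Y (\<lambda>(t, x, s). h t x s)"
    and "\<And>x s. x \<in> S \<Longrightarrow> s \<in> {0..1} \<Longrightarrow> h 0 x s = f (x, s)"
    and "\<And>x s. x \<in> S \<Longrightarrow> s \<in> {0..1} \<Longrightarrow> h 1 x s = g (x, s)"
    and "\<And>t. t \<in> {0..1} \<Longrightarrow> slice_compatible S C b (\<lambda>(x, s). h t x s)"
  shows "homotopic_with (slice_compatible S C b) (top_of_set (S \<times> {0..1})) Y f g"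
proof -
  have inv: "slice_compatible S C b h \<longleftrightarrow> slice_compatible S C b k"
    if "\<And>z. z \<in> topspace (top_of_set (S \<times> {0..1})) \<Longrightarrow> h z = k z" for h k
    using that unfolding slice_compatible_def by simp
  have "slice_compatible S C b (\<lambda>z. (\<lambda>(t, x, s). h t x s) (t, z))" if "t \<in> {0..1}" for t
    using assms(4)[OF that] by (simp add: case_prod_unfold)
  moreover have "continuous_map (prod_topology (top_of_set {0..1}) (top_of_set (S \<times> {0..1}))) Y (\<lambda>(t, x, s). h t x s)"
    using c by simp
  ultimately have "\<exists>k. continuous_map (prod_topology (top_of_set {0..1::real}) (top_of_set (S \<times> {0..1}))) Y k \<and>
      (\<forall>z\<in>topspace (top_of_set (S \<times> {0..1})). k (0, z) = f z) \<and>
      (\<forall>z\<in>topspace (top_of_set (S \<times> {0..1})). k (1, z) = g z) \<and>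
      (\<forall>t\<in>{0..1}. slice_compatible S C b (\<lambda>z. k (t, z)))"
    using assms(2,3) by (intro exI[of _ "\<lambda>(t, x, s). h t x s"] conjI) auto
  then show ?thesis
    by (rule iffD2[OF homotopic_with, rotated]) (rule inv)
qed

lemma suspension_wedge_homotopy_equivalent:
  assumes f: "continuous_map (suspension_wedge D S B) (suspension_wedge D' S' B') f"
    and g: "continuous_map (suspension_wedge D' S' B') (suspension_wedge D S B) g"
    and gf: "\<And>J. J \<in> D \<Longrightarrow> homotopic_with (slice_compatible S (B J) b) (top_of_set (S \<times> {0..1}))
       (suspension_wedge D S B) (\<lambda>(x, s). g (f (wedge_class D S B J x s))) (\<lambda>(x, s). wedge_class D S B J x s)"
    and fg: "\<And>J. J \<in> D' \<Longrightarrow> homotopic_with (slice_compatible S' (B' J) b') (top_of_set (S' \<times> {0..1}))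
       (suspension_wedge D' S' B') (\<lambda>(x, s). f (g (wedge_class D' S' B' J x s))) (\<lambda>(x, s). wedge_class D' S' B' J x s)"
  shows "suspension_wedge D S B homotopy_equivalent_space suspension_wedge D' S' B'"
proof (rule homotopy_equivalent_quotients[OF quotient_map_suspension_wedge quotient_map_suspension_wedge f g])
  show "homotopic_with (fibrewise_constant (cylinders D S) (\<lambda>(J, x, s). wedge_class D S B J x s))
     (cylinders D S) (suspension_wedge D S B) (g \<circ> f \<circ> (\<lambda>(J, x, s). wedge_class D S B J x s))
     (\<lambda>(J, x, s). wedge_class D S B J x s)"
    by (rule homotopic_with_slices[where b = b]) (use gf in \<open>simp add: case_prod_unfold\<close>)
  show "homotopic_with (fibrewise_constant (cylinders D' S') (\<lambda>(J, x, s). wedge_class D' S' B' J x s))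
     (cylinders D' S') (suspension_wedge D' S' B') (f \<circ> g \<circ> (\<lambda>(J, x, s). wedge_class D' S' B' J x s))
     (\<lambda>(J, x, s). wedge_class D' S' B' J x s)"
    by (rule homotopic_with_slices[where b = b']) (use fg in \<open>simp add: case_prod_unfold\<close>)
qed

lemma suspension_homeomorphic_suspension_wedge:
  assumes B: "B J = {}"
  shows "suspension (top_of_set S) homeomorphic_space suspension_wedge {J} S B"
proof -
  have q: "continuous_map (top_of_set (S \<times> {0..1})) (suspension (top_of_set S)) (\<lambda>z. suspension_rel (top_of_set S) `` {z})"
    using quotient_imp_continuous_map[OF quotient_map_suspension[of "top_of_set S"]] by simp
  have "continuous_map (top_of_set (S \<times> {0..1})) (suspension_wedge {J} S B)
      (\<lambda>z. wedge_class {J} S B J (fst z) (snd z))"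
    by (intro continuous_map_wedge_class continuous_on_fst continuous_on_snd continuous_on_id) auto
  then have c: "continuous_map (prod_topology (top_of_set S) (top_of_set {0..1})) (suspension_wedge {J} S B)
      (\<lambda>z. wedge_class {J} S B J (fst z) (snd z))"
    by simp
  obtain f where f: "continuous_map (suspension (top_of_set S)) (suspension_wedge {J} S B) f"
    "\<And>x s. x \<in> topspace (top_of_set S) \<Longrightarrow> s \<in> {0..1} \<Longrightarrow> f (suspension_rel (top_of_set S) `` {(x, s)}) =
       wedge_class {J} S B J (fst (x, s)) (snd (x, s))"
    by (rule suspension_lift[OF c]) (simp_all add: wedge_class_eq_iff B)
  \<comment> \<open>\<open>N\<close> serves only to name the upper pole. For empty \<open>S\<close>
    it is arbitrary, and every condition on it is then void.\<close>
  define N where "N = (SOME x. x \<in> S)"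
  have N: "N \<in> S" if "x \<in> S" for x unfolding N_def using that by (rule someI)
  have "slice_compatible S (B j) (suspension_rel (top_of_set S) `` {(N, 1)})
      (\<lambda>z. (\<lambda>(J, z). suspension_rel (top_of_set S) `` {z}) (j, z))" if "j \<in> {J}" for j
    by (rule slice_compatibleI) (use N B that in \<open>auto simp: suspension_class_eq_iff\<close>)
  note sc = this
  have cg: "continuous_map (top_of_set (S \<times> {0..1})) (suspension (top_of_set S))
      (\<lambda>z. (\<lambda>(J, z). suspension_rel (top_of_set S) `` {z}) (j, z))" for j :: 'b
    using q by simp
  obtain g where g: "continuous_map (suspension_wedge {J} S B) (suspension (top_of_set S)) g"
    "\<And>j x s. j \<in> {J} \<Longrightarrow> x \<in> S \<Longrightarrow> s \<in> {0..1} \<Longrightarrow> g (wedge_class {J} S B j x s) =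
       (\<lambda>(J, z). suspension_rel (top_of_set S) `` {z}) (j, x, s)"
    by (rule suspension_wedge_lift[where D = "{J}", OF cg sc]) (assumption, rule that)
  have surj1: "topspace (suspension (top_of_set S)) = (\<lambda>z. suspension_rel (top_of_set S) `` {z}) ` (S \<times> {0..1})"
    using quotient_imp_surjective_map[OF quotient_map_suspension[of "top_of_set S"]] by simp
  have surj2: "topspace (suspension_wedge {J} S B) =
      (\<lambda>(j, x, s). wedge_class {J} S B j x s) ` ({J} \<times> S \<times> {0..1})"
    using quotient_imp_surjective_map[OF quotient_map_suspension_wedge[of "{J}" S B]]
    unfolding topspace_cylinders by (rule sym)
  have "homeomorphic_maps (suspension (top_of_set S)) (suspension_wedge {J} S B) f g"
    unfolding homeomorphic_maps_def surj1 surj2 using f g by auto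
  then show ?thesis
    by (auto simp: homeomorphic_space_def)
qed

section \<open>Splitting off one coordinate\<close>

text \<open>Every point of the real moment-angle complex with \<open>\<bar>x j\<bar> < 1\<close> may be moved freely in coordinate
  \<open>j\<close>; stretching that coordinate turns the wall \<open>x j = 0\<close> into the collar \<open>\<bar>x j\<bar> \<le> 1/2\<close>.\<close>

definition stretch :: "real \<Rightarrow> real" where
  "stretch a = max 0 (2 * a - 1) + min 0 (2 * a + 1)"

definition pull :: "nat set \<Rightarrow> real \<Rightarrow> (nat \<Rightarrow> real) \<Rightarrow> nat \<Rightarrow> real" where
  "pull J t x = (\<lambda>j. if j \<in> J then (1 - t) * x j + t * stretch (x j) else x j)"

definition walls :: "nat set \<Rightarrow> (nat \<Rightarrow> real) set" where
  "walls J = {x. \<exists>j\<in>J. x j = 0}"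

text \<open>The factor 2 matches the collar of \<open>stretch\<close>: for nonnegative coordinates,
  a value below 1 means that some coordinate in J is below 1/2, and then \<open>pull J 1\<close>
  puts the point on a wall.\<close>

definition depth :: "nat set \<Rightarrow> (nat \<Rightarrow> real) \<Rightarrow> real" where
  "depth J x = (\<Prod>j\<in>J. min 1 (2 * x j))"

definition reflect :: "nat \<Rightarrow> (nat \<Rightarrow> real) \<Rightarrow> nat \<Rightarrow> real" where
  "reflect n x = x(n := - x n)"

definition fold_coord :: "nat \<Rightarrow> (nat \<Rightarrow> real) \<Rightarrow> nat \<Rightarrow> real" where
  "fold_coord n x = x(n := \<bar>x n\<bar>)"

lemma stretch_simps [simp]: "stretch 0 = 0" "stretch (- a) = - stretch a"
  by (auto simp: stretch_def max_def min_def)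

lemma stretch_bounds:
  "\<bar>a\<bar> \<le> 1 \<Longrightarrow> \<bar>stretch a\<bar> \<le> 1" "\<bar>a\<bar> = 1 \<Longrightarrow> stretch a = a" "0 \<le> a \<Longrightarrow> 0 \<le> stretch a"
  "\<bar>a\<bar> \<le> 1/2 \<Longrightarrow> stretch a = 0"
  by (auto simp: stretch_def max_def min_def abs_if split: if_splits)

lemma pull_0 [simp]: "pull J 0 x = x"
  by (auto simp: pull_def)

lemma pull_walls:
  assumes "x \<in> walls A"
  shows "pull J t x \<in> walls A"
proof -
  obtain j where "j \<in> A" "x j = 0" using assms by (auto simp: walls_def)
  moreover from this have "pull J t x j = 0" by (simp add: pull_def)
  ultimately show ?thesis unfolding walls_def by blast
qed

lemma walls_mono: "x \<in> walls A \<Longrightarrow> A \<subseteq> B \<Longrightarrow> x \<in> walls B"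
  by (auto simp: walls_def)

lemma fold_coord_walls: "x \<in> walls A \<Longrightarrow> fold_coord n x \<in> walls A"
  by (auto simp: walls_def fold_coord_def)

lemma reflect_walls: "reflect n x \<in> walls A \<longleftrightarrow> x \<in> walls A"
  by (auto simp: walls_def reflect_def)

lemma depth_bounds:
  assumes "\<And>j. j \<in> J \<Longrightarrow> 0 \<le> x j"
  shows "0 \<le> depth J x" "depth J x \<le> 1"
  unfolding depth_def using assms by (auto intro!: prod_nonneg prod_le_1)

lemma depth_walls:
  assumes "finite J" "x \<in> walls J"
  shows "depth J x = 0"
proof -
  obtain j where "j \<in> J" "x j = 0" using assms by (auto simp: walls_def)
  then have "\<exists>j\<in>J. min 1 (2 * x j) = 0" by (intro bexI[of _ j]) auto
  then show ?thesis unfolding depth_def by (rule prod_zero[OF assms(1)])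
qed

lemma pull_in_walls:
  assumes "\<And>j. j \<in> J \<Longrightarrow> 0 \<le> x j" "depth J x < 1"
  shows "pull J 1 x \<in> walls J"
proof -
  have "\<exists>j\<in>J. x j < 1/2"
  proof (rule ccontr)
    assume "\<not> ?thesis"
    then have "depth J x = 1" unfolding depth_def by (intro prod.neutral) force
    then show False using assms(2) by simp
  qed
  then obtain j where "j \<in> J" "x j < 1/2" by blast
  then have "pull J 1 x j = 0" using assms(1)[of j] by (simp add: pull_def stretch_bounds)
  then show ?thesis using \<open>j \<in> J\<close> by (auto simp: walls_def)
qed

lemma continuous_on_stretch: "continuous_on T f \<Longrightarrow> continuous_on T (\<lambda>z. stretch (f z))"
  unfolding stretch_def by (intro continuous_intros)

lemma continuous_on_pull:
  assumes "continuous_on T t" "continuous_on T f"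
  shows "continuous_on T (\<lambda>z. pull J (t z) (f z))"
proof (rule continuous_on_coordinatewise_then_product)
  fix j
  show "continuous_on T (\<lambda>z. pull J (t z) (f z) j)"
    using continuous_on_coordinate[OF assms(2), of j] assms(1)
    by (cases "j \<in> J") (simp_all add: pull_def continuous_intros continuous_on_stretch)
qed

lemma continuous_on_reflect:
  assumes "continuous_on T f"
  shows "continuous_on T (\<lambda>z. reflect n (f z))"
proof (rule continuous_on_coordinatewise_then_product)
  fix j
  show "continuous_on T (\<lambda>z. reflect n (f z) j)"
    using continuous_on_coordinate[OF assms, of j]
    by (cases "j = n") (simp_all add: reflect_def continuous_intros)
qed

lemma continuous_on_fold_coord:
  assumes "continuous_on T f"
  shows "continuous_on T (\<lambda>z. fold_coord n (f z))"
proof (rule continuous_on_coordinatewise_then_product)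
  fix j
  show "continuous_on T (\<lambda>z. fold_coord n (f z) j)"
    using continuous_on_coordinate[OF assms, of j]
    by (cases "j = n") (simp_all add: fold_coord_def continuous_intros)
qed

lemma continuous_on_depth:
  assumes "continuous_on T f"
  shows "continuous_on T (\<lambda>z. depth J (f z))"
  unfolding depth_def by (intro continuous_intros continuous_on_coordinate[OF assms])

lemma unit_interval_mult: "a \<in> {0..1} \<Longrightarrow> b \<in> {0..1} \<Longrightarrow> a * b \<in> {0..1::real}"
  by (auto intro: mult_le_one)

lemma unit_interval_compl: "a \<in> {0..1} \<Longrightarrow> 1 - a \<in> {0..1::real}"
  by auto

lemma unit_interval_convex:
  "t \<in> {0..1} \<Longrightarrow> a \<in> {0..1} \<Longrightarrow> b \<in> {0..1} \<Longrightarrow> (1 - t) * a + t * b \<in> {0..1::real}"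
  by (auto intro!: convex_bound_le add_nonneg_nonneg mult_nonneg_nonneg)

section \<open>Chambers, stages, and homotopies within one cylinder\<close>

type_synonym homotopy_arg = "real \<times> (nat \<Rightarrow> real) \<times> real"

locale spanning_complex = vertex_complex +
  assumes vertex: "j \<in> {1..m} \<Longrightarrow> {j} \<in> K"
begin

definition chamber :: "nat \<Rightarrow> (nat \<Rightarrow> real) set" where
  "chamber k = {x \<in> Z. \<forall>j\<in>{1..m}. j \<le> k \<longrightarrow> 0 \<le> x j}"

text \<open>The stages interpolate between the suspension of \<open>Z\<close>, where the empty set
  indexes the only cylinder, and the wedge of all suspensions of C/B_J. Passing from k to
  \<open>Suc k\<close> replaces the cylinder of J by two, for J and for J with \<open>Suc k\<close>
  added.\<close>

definition "stage k = suspension_wedge (Pow {1..k}) (chamber k) walls"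

definition "cls k = wedge_class (Pow {1..k}) (chamber k) walls"

definition "one = (\<lambda>j\<in>{1..m}. 1 :: real)"

abbreviation "base k \<equiv> cls k {} one 1"

abbreviation "slice_homotopic k J \<equiv> homotopic_with (slice_compatible (chamber k) (walls J) (base k))
  (top_of_set (chamber k \<times> {0..1})) (stage k)"

lemma one_in: "one \<in> chamber k"
proof -
  have eq: "{j\<in>{1..m}. \<bar>one j\<bar> \<noteq> 1} = {}" by (auto simp: one_def)
  have "one \<in> Z"
    unfolding moment_angle_set_def mem_Collect_eq eq using empty_in by (auto simp: one_def)
  then show ?thesis by (simp add: chamber_def one_def)
qed

lemma cls_top: "J \<subseteq> {1..k} \<Longrightarrow> x \<in> chamber k \<Longrightarrow> cls k J x 1 = base k"
  using one_in[of k] by (simp add: cls_def wedge_class_eq_iff)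

lemma cls_bot: "J \<subseteq> {1..k} \<Longrightarrow> x \<in> chamber k \<Longrightarrow> x' \<in> chamber k \<Longrightarrow> cls k J x 0 = cls k J x' 0"
  by (simp add: cls_def wedge_class_eq_iff)

lemma cls_wall:
  "J \<subseteq> {1..k} \<Longrightarrow> x \<in> chamber k \<Longrightarrow> x' \<in> chamber k \<Longrightarrow> x \<in> walls J \<Longrightarrow> x' \<in> walls J \<Longrightarrow>
     s \<in> {0..1} \<Longrightarrow> cls k J x s = cls k J x' s"
  by (simp add: cls_def wedge_class_eq_iff)

lemma cls_cont:
  "J \<subseteq> {1..k} \<Longrightarrow> continuous_on T a \<Longrightarrow> (\<And>z. z \<in> T \<Longrightarrow> a z \<in> chamber k) \<Longrightarrow> continuous_on T b \<Longrightarrow>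
     (\<And>z. z \<in> T \<Longrightarrow> b z \<in> {0..1}) \<Longrightarrow> continuous_map (top_of_set T) (stage k) (\<lambda>z. cls k J (a z) (b z))"
  unfolding stage_def cls_def by (intro continuous_map_wedge_class) auto

lemma chamber_bounds:
  "x \<in> chamber k \<Longrightarrow> j \<in> {1..m} \<Longrightarrow> \<bar>x j\<bar> \<le> 1" "x \<in> chamber k \<Longrightarrow> j \<in> {1..m} \<Longrightarrow> j \<le> k \<Longrightarrow> 0 \<le> x j"
  by (auto simp: chamber_def moment_angle_set_def)

lemma chamber_mono:
  assumes "x \<in> Z" "y \<in> extensional {1..m}"
    "\<And>j. j \<in> {1..m} \<Longrightarrow> \<bar>y j\<bar> \<le> 1" "\<And>j. j \<in> {1..m} \<Longrightarrow> \<bar>x j\<bar> = 1 \<Longrightarrow> \<bar>y j\<bar> = 1"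
    "\<And>j. j \<in> {1..m} \<Longrightarrow> j \<le> k \<Longrightarrow> 0 \<le> y j"
  shows "y \<in> chamber k"
proof -
  have "y \<in> Z"
    by (rule moment_angle_set_mono[OF complex assms(1,2)]) (rule assms(3,4), assumption+)+
  then show ?thesis
    unfolding chamber_def using assms(5) by blast
qed

lemma chamber_moment_angle: "x \<in> chamber k \<Longrightarrow> x \<in> Z" "x \<in> chamber k \<Longrightarrow> x \<in> extensional {1..m}"
  by (auto simp: chamber_def moment_angle_set_def)

lemma pull_in:
  assumes x: "x \<in> chamber k" and J: "J \<subseteq> {1..m}" and t: "t \<in> {0..1}"
  shows "pull J t x \<in> chamber k"
proof (rule chamber_mono[OF chamber_moment_angle(1)[OF x]])
  show "pull J t x \<in> extensional {1..m}"
    using chamber_moment_angle(2)[OF x] J by (auto simp: pull_def extensional_def)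
  show "\<bar>pull J t x j\<bar> \<le> 1" if "j \<in> {1..m}" for j
  proof -
    have "\<bar>x j\<bar> \<le> 1" using chamber_bounds(1)[OF x that] .
    then show ?thesis
      using convex_abs_le_1[of "x j" "stretch (x j)" t] stretch_bounds(1) t by (simp add: pull_def)
  qed
  show "\<bar>pull J t x j\<bar> = 1" if "\<bar>x j\<bar> = 1" for j
    using that stretch_bounds(2)[OF that] by (simp add: pull_def algebra_simps)
  show "0 \<le> pull J t x j" if "j \<in> {1..m}" "j \<le> k" for j
    using chamber_bounds(2)[OF x that] stretch_bounds(3) t by (auto simp: pull_def)
qed

lemma fold_coord_in:
  assumes x: "x \<in> chamber i" and i: "Suc i \<le> m"
  shows "fold_coord (Suc i) x \<in> chamber (Suc i)"
proof (rule chamber_mono[OF chamber_moment_angle(1)[OF x]])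
  show "fold_coord (Suc i) x \<in> extensional {1..m}"
    using chamber_moment_angle(2)[OF x] i by (auto simp: fold_coord_def extensional_def)
  show "0 \<le> fold_coord (Suc i) x j" if "j \<in> {1..m}" "j \<le> Suc i" for j
    using chamber_bounds(2)[OF x, of j] that by (auto simp: fold_coord_def)
qed (use chamber_bounds(1)[OF x] in \<open>auto simp: fold_coord_def\<close>)

lemma reflect_in:
  assumes x: "x \<in> chamber (Suc i)" and i: "Suc i \<le> m"
  shows "reflect (Suc i) x \<in> chamber i"
proof (rule chamber_mono[OF chamber_moment_angle(1)[OF x]])
  show "reflect (Suc i) x \<in> extensional {1..m}"
    using chamber_moment_angle(2)[OF x] i by (auto simp: reflect_def extensional_def)
  show "0 \<le> reflect (Suc i) x j" if "j \<in> {1..m}" "j \<le> i" for j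
    using chamber_bounds(2)[OF x, of j] that by (auto simp: reflect_def)
qed (use chamber_bounds(1)[OF x] in \<open>auto simp: reflect_def\<close>)

lemma chamber_Suc: "x \<in> chamber (Suc i) \<Longrightarrow> x \<in> chamber i"
  by (auto simp: chamber_def)

text \<open>A place at which the new cylinders can be entered: only coordinate n is free, so the
  point exists because n is a vertex of K.\<close>

definition wall_point :: "nat \<Rightarrow> nat \<Rightarrow> real" where
  "wall_point n = (\<lambda>j\<in>{1..m}. if j = n then 0 else 1)"

lemma wall_point_in:
  assumes "n \<in> {1..m}"
  shows "wall_point n \<in> chamber k" "n \<in> J \<Longrightarrow> wall_point n \<in> walls J"
proof -
  have eq: "{j\<in>{1..m}. \<bar>wall_point n j\<bar> \<noteq> 1} = {n}"
    using assms by (auto simp: wall_point_def)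
  have Z: "wall_point n \<in> Z"
    unfolding moment_angle_set_def mem_Collect_eq eq using vertex[OF assms] by (auto simp: wall_point_def)
  show "wall_point n \<in> chamber k"
    using Z by (simp add: chamber_def wall_point_def)
  show "n \<in> J \<Longrightarrow> wall_point n \<in> walls J"
    using assms by (auto simp: walls_def wall_point_def intro!: bexI[of _ n])
qed

text \<open>A tent over the interval with peak \<open>depth J x\<close> at s = 1/2. Subtracted from
  1 it describes a descent from the upper pole and the return to it, and this excursion is trivial
  over walls.\<close>

definition dip :: "nat set \<Rightarrow> (nat \<Rightarrow> real) \<Rightarrow> real \<Rightarrow> real" where
  "dip J x s = depth J x * (1 - \<bar>2 * s - 1\<bar>)"

lemma dip_unit:
  assumes "x \<in> chamber k" "J \<subseteq> {1..k}" "k \<le> m" "s \<in> {0..1}"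
  shows "dip J x s \<in> {0..1}"
proof -
  have "0 \<le> x j" if "j \<in> J" for j
    using chamber_bounds(2)[OF assms(1), of j] that assms(2,3) by auto
  then show ?thesis
    unfolding dip_def using assms(4) depth_bounds[of J x] by (intro unit_interval_mult) auto
qed

lemma dip_walls: "finite J \<Longrightarrow> x \<in> walls J \<Longrightarrow> dip J x s = 0"
  by (simp add: dip_def depth_walls)

lemma continuous_on_dip:
  assumes "continuous_on T f" "continuous_on T g"
  shows "continuous_on T (\<lambda>z. dip J (f z) (g z))"
  unfolding dip_def
  by (intro continuous_on_mult continuous_on_depth[OF assms(1)] continuous_intros assms(2))

text \<open>Treats homotopies that stay in one cylinder, with point p and height h. The assumption
  \<open>pole\<close> offers two ways for the image of the lower end to be a single point: either
  its height is 0, or p has already forgotten x.\<close>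

lemma moving_slice_homotopic:
  assumes J: "J \<subseteq> {1..k}"
    and p: "continuous_on ({0..1} \<times> chamber k \<times> {0..1}) (\<lambda>z :: homotopy_arg. p (fst z) (fst (snd z)))"
      "\<And>t x. t \<in> {0..1} \<Longrightarrow> x \<in> chamber k \<Longrightarrow> p t x \<in> chamber k"
      "\<And>t x. t \<in> {0..1} \<Longrightarrow> x \<in> chamber k \<Longrightarrow> x \<in> walls J \<Longrightarrow> p t x \<in> walls J"
    and h: "continuous_on ({0..1} \<times> chamber k \<times> {0..1}) (\<lambda>z :: homotopy_arg. h (fst z) (fst (snd z)) (snd (snd z)))"
      "\<And>t x s. t \<in> {0..1} \<Longrightarrow> x \<in> chamber k \<Longrightarrow> s \<in> {0..1} \<Longrightarrow> h t x s \<in> {0..1}"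
      "\<And>t x. t \<in> {0..1} \<Longrightarrow> h t x 1 = 1"
    and wall: "\<And>t x x' s. x \<in> walls J \<Longrightarrow> x' \<in> walls J \<Longrightarrow> h t x s = h t x' s"
    and pole: "\<And>t x x'. h t x 0 = h t x' 0 \<and> (h t x 0 = 0 \<or> p t x = p t x')"
    and f: "\<And>x s. x \<in> chamber k \<Longrightarrow> f (x, s) = cls k J (p 0 x) (h 0 x s)"
    and g: "\<And>x s. x \<in> chamber k \<Longrightarrow> g (x, s) = cls k J (p 1 x) (h 1 x s)"
  shows "slice_homotopic k J f g"
proof (rule homotopic_with_sliceI[where h = "\<lambda>t x s. cls k J (p t x) (h t x s)"])
  have "continuous_map (top_of_set ({0..1} \<times> chamber k \<times> {0..1})) (stage k)
     (\<lambda>z :: homotopy_arg. cls k J (p (fst z) (fst (snd z))) (h (fst z) (fst (snd z)) (snd (snd z))))"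
  proof (intro cls_cont J p(1) h(1))
    fix z :: homotopy_arg
    assume "z \<in> {0..1} \<times> chamber k \<times> {0..1}"
    then have z: "fst z \<in> {0..1}" "fst (snd z) \<in> chamber k" "snd (snd z) \<in> {0..1}" by auto
    show "p (fst z) (fst (snd z)) \<in> chamber k" by (rule p(2)[OF z(1,2)])
    show "h (fst z) (fst (snd z)) (snd (snd z)) \<in> {0..1}" by (rule h(2)[OF z])
  qed
  then show "continuous_map (top_of_set ({0..1} \<times> chamber k \<times> {0..1})) (stage k)
      (\<lambda>(t, x, s). cls k J (p t x) (h t x s))"
    unfolding case_prod_unfold .
  fix t :: real assume t: "t \<in> {0..1}"
  show "slice_compatible (chamber k) (walls J) (base k) (\<lambda>(x, s). cls k J (p t x) (h t x s))"
  proof (rule slice_compatibleI)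
    show "(\<lambda>(x, s). cls k J (p t x) (h t x s)) (x, 1) = base k" if "x \<in> chamber k" for x
      using cls_top[OF J p(2)[OF t that]] by (simp add: h(3)[OF t])
    show "(\<lambda>(x, s). cls k J (p t x) (h t x s)) (x, 0) = (\<lambda>(x, s). cls k J (p t x) (h t x s)) (x', 0)"
      if "x \<in> chamber k" "x' \<in> chamber k" for x x'
      using pole[of t x x'] cls_bot[OF J p(2)[OF t that(1)] p(2)[OF t that(2)]] by auto
    show "(\<lambda>(x, s). cls k J (p t x) (h t x s)) (x, s) = (\<lambda>(x, s). cls k J (p t x) (h t x s)) (x', s)"
      if x: "x \<in> chamber k" "x \<in> walls J" "x' \<in> chamber k" "x' \<in> walls J" "s \<in> {0..1}" for x x' s
      using cls_wall[OF J p(2)[OF t x(1)] p(2)[OF t x(3)] p(3)[OF t x(1,2)] p(3)[OF t x(3,4)] h(2)[OF t x(1,5)]]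
        wall[OF x(2,4), of t s] by simp
  qed
qed (simp_all add: f g)

end

section \<open>The maps between consecutive stages\<close>

context spanning_complex
begin

lemma fold_coord_reflect: "fold_coord n (reflect n x) = fold_coord n x"
  by (auto simp: fold_coord_def reflect_def)

lemma fold_coord_id: "0 \<le> x n \<Longrightarrow> fold_coord n x = x"
  by (auto simp: fold_coord_def)

context
  fixes i :: nat
  assumes i: "Suc i \<le> m"
begin

lemma n_in: "Suc i \<in> {1..m}"
  using i by simp

lemma chamber_nonneg:
  assumes "x \<in> chamber (Suc i)" "j \<in> {1..Suc i}"
  shows "0 \<le> x j"
  using chamber_bounds(2)[OF assms(1), of j] assms(2) i by auto

text \<open>Read the interval coordinate as time.  The map \<open>spread\<close> goes up the cylinder \<open>J\<close> over the folded
  point, then down the new cylinder over a fixed point of the wall and up again over the folded point;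
  the last two parts cancel unless coordinate \<open>Suc i\<close> is negative.  On the new cylinders, \<open>gather\<close> is
  the difference of a point and its mirror image: it descends from the pole over the former to \<open>1 - depth\<close>
  and returns over the latter, so that it is constant on the walls.\<close>

definition spread :: "nat set \<times> (nat \<Rightarrow> real) \<times> real \<Rightarrow> (nat set \<times> (nat \<Rightarrow> real) \<times> real) set" where
  "spread = (\<lambda>(J, x, s).
     if s \<le> 1/3 then cls (Suc i) J (fold_coord (Suc i) x) (3 * s)
     else if min (s - 2/3) (- x (Suc i)) \<le> 0
       then cls (Suc i) (insert (Suc i) J) (wall_point (Suc i)) \<bar>3 * s - 2\<bar>
     else cls (Suc i) (insert (Suc i) J) (fold_coord (Suc i) x) \<bar>3 * s - 2\<bar>)"

definition gather :: "nat set \<times> (nat \<Rightarrow> real) \<times> real \<Rightarrow> (nat set \<times> (nat \<Rightarrow> real) \<times> real) set" where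
  "gather = (\<lambda>(J, y, s).
     if Suc i \<notin> J then cls i J y s
     else if s \<le> 1/2 then cls i (J - {Suc i}) (pull J 1 y) (1 - dip J y s)
     else cls i (J - {Suc i}) (reflect (Suc i) (pull J 1 y)) (1 - dip J y s))"

lemma insert_Suc: "J \<subseteq> {1..i} \<Longrightarrow> insert (Suc i) J \<subseteq> {1..Suc i}" "J \<subseteq> {1..i} \<Longrightarrow> J \<subseteq> {1..Suc i}"
  by auto

lemmas wall_point_chamber = wall_point_in(1)[OF n_in] and wall_point_wall = wall_point_in(2)[OF n_in]

lemma spread_cont:
  assumes J: "J \<subseteq> {1..i}"
  shows "continuous_map (top_of_set (chamber i \<times> {0..1})) (stage (Suc i)) (\<lambda>z. spread (J, z))"
proof -
  have co: "continuous_on T (\<lambda>z. fst z j)" for T :: "((nat \<Rightarrow> real) \<times> real) set" and j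
    by (intro continuous_on_coordinate continuous_intros)
  have cf: "continuous_on T (\<lambda>z. fold_coord (Suc i) (fst z))" for T :: "((nat \<Rightarrow> real) \<times> real) set"
    by (intro continuous_on_fold_coord continuous_intros)
  have "continuous_map (top_of_set (chamber i \<times> {0..1})) (stage (Suc i))
     (\<lambda>z :: (nat \<Rightarrow> real) \<times> real. if snd z \<le> 1/3 then cls (Suc i) J (fold_coord (Suc i) (fst z)) (3 * snd z)
       else if min (snd z - 2/3) (- fst z (Suc i)) \<le> 0
         then cls (Suc i) (insert (Suc i) J) (wall_point (Suc i)) \<bar>3 * snd z - 2\<bar>
       else cls (Suc i) (insert (Suc i) J) (fold_coord (Suc i) (fst z)) \<bar>3 * snd z - 2\<bar>)"
  proof (intro continuous_map_cases_le_top_of_set cls_cont insert_Suc J cf)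
    fix z :: "(nat \<Rightarrow> real) \<times> real" assume z: "z \<in> chamber i \<times> {0..1}" "snd z = 1/3"
    then have *: "min (snd z - 2/3) (- fst z (Suc i)) \<le> 0" "3 * snd z = 1" "\<bar>3 * snd z - 2\<bar> = 1" by simp_all
    show "cls (Suc i) J (fold_coord (Suc i) (fst z)) (3 * snd z) =
       (if min (snd z - 2/3) (- fst z (Suc i)) \<le> 0
         then cls (Suc i) (insert (Suc i) J) (wall_point (Suc i)) \<bar>3 * snd z - 2\<bar>
       else cls (Suc i) (insert (Suc i) J) (fold_coord (Suc i) (fst z)) \<bar>3 * snd z - 2\<bar>)"
      unfolding if_P[OF *(1)] *(2,3)
      using z(1) fold_coord_in[OF _ i] insert_Suc[OF J] wall_point_chamber
      by (simp add: cls_top mem_Times_iff)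
  next
    fix z :: "(nat \<Rightarrow> real) \<times> real" assume z: "z \<in> {z \<in> chamber i \<times> {0..1}. 1/3 \<le> snd z}" "min (snd z - 2/3) (- fst z (Suc i)) = 0"
    \<comment> \<open>The \<open>min\<close> packs the disjunction of s \<le> 2/3 and x (Suc i)
      \<ge> 0 into a single inequality, as required for pasting. On the seam both formulas agree: at
      s = 2/3 the height is 0, and at x (Suc i) = 0 the folded point lies on a wall, as
      \<open>wall_point\<close> does.\<close>
    then consider "snd z = 2/3" | "fst z (Suc i) = 0" by linarith
    then show "cls (Suc i) (insert (Suc i) J) (wall_point (Suc i)) \<bar>3 * snd z - 2\<bar> =
        cls (Suc i) (insert (Suc i) J) (fold_coord (Suc i) (fst z)) \<bar>3 * snd z - 2\<bar>"
    proof cases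
      case 1
      then have "\<bar>3 * snd z - 2\<bar> = 0" by simp
      then show ?thesis
        using cls_bot[OF insert_Suc(1)[OF J] wall_point_chamber fold_coord_in[OF _ i]] z(1)
        by (simp add: mem_Times_iff)
    next
      case 2
      then have "fold_coord (Suc i) (fst z) \<in> walls (insert (Suc i) J)"
        by (simp add: walls_def fold_coord_def)
      moreover have "\<bar>3 * snd z - 2\<bar> \<in> {0..1}" using z(1) by (auto simp: abs_if)
      ultimately show ?thesis
        using z(1) fold_coord_in[OF _ i] insert_Suc[OF J] wall_point_chamber wall_point_wall
        by (intro cls_wall) (auto simp: mem_Times_iff)
    qed
  qed (use fold_coord_in[OF _ i] wall_point_chamber in
      \<open>auto intro!: continuous_intros co simp: abs_le_iff\<close>)
  then show ?thesis
    unfolding spread_def case_prod_unfold fst_conv snd_conv .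
qed

text \<open>A wall of J is still a wall after \<open>Suc i\<close> is added to J, and
  \<open>wall_point\<close> lies on a wall there too. Over walls the last third of the path is
  therefore the same for either sign of coordinate \<open>Suc i\<close>.\<close>

lemma spread_compatible:
  assumes J: "J \<subseteq> {1..i}"
  shows "slice_compatible (chamber i) (walls J) (base (Suc i)) (\<lambda>z. spread (J, z))"
proof (rule slice_compatibleI)
  note f = fold_coord_in[OF _ i]
  show "spread (J, x, 1) = base (Suc i)" if "x \<in> chamber i" for x
    using f[OF that] insert_Suc[OF J] wall_point_chamber by (simp add: spread_def cls_top)
  show "spread (J, x, 0) = spread (J, x', 0)" if "x \<in> chamber i" "x' \<in> chamber i" for x x'
    using cls_bot[OF insert_Suc(2)[OF J] f[OF that(1)] f[OF that(2)]] by (simp add: spread_def)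
  show "spread (J, x, s) = spread (J, x', s)"
    if x: "x \<in> chamber i" "x \<in> walls J" "x' \<in> chamber i" "x' \<in> walls J" and s: "s \<in> {0..1}" for x x' s
  proof -
    have w: "fold_coord (Suc i) y \<in> walls J \<and> fold_coord (Suc i) y \<in> walls (insert (Suc i) J)"
      if "y \<in> walls J" for y
      using fold_coord_walls[OF that] walls_mono[of _ J "insert (Suc i) J"] by blast
    have 1: "cls (Suc i) J (fold_coord (Suc i) x) (3 * s) = cls (Suc i) J (fold_coord (Suc i) x') (3 * s)" if "s \<le> 1/3"
      using that s x w f insert_Suc[OF J] by (intro cls_wall) auto
    have 2: "cls (Suc i) (insert (Suc i) J) (fold_coord (Suc i) y) \<bar>3 * s - 2\<bar> =
        cls (Suc i) (insert (Suc i) J) (wall_point (Suc i)) \<bar>3 * s - 2\<bar>"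
      if "\<not> s \<le> 1/3" "y \<in> chamber i" "y \<in> walls J" for y
      using that s w f insert_Suc[OF J] wall_point_chamber wall_point_wall by (intro cls_wall) auto
    show ?thesis
    proof (cases "s \<le> 1/3")
      case True
      then show ?thesis using 1 by (simp add: spread_def)
    next
      case False
      have "spread (J, y, s) = cls (Suc i) (insert (Suc i) J) (wall_point (Suc i)) \<bar>3 * s - 2\<bar>"
        if "y \<in> chamber i" "y \<in> walls J" for y
        unfolding spread_def prod.case if_not_P[OF False] 2[OF False that] by simp
      then show ?thesis using x by simp
    qed
  qed
qed

text \<open>This makes the two halves of \<open>gather\<close> fit together. If the depth is below
  1, the pulled point lies on a wall: on the wall of \<open>Suc i\<close> it is its own mirror
  image, on any other wall it is collapsed together with its mirror image. If the depth is 1, the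
  turn takes place at height 0, which is a pole.\<close>

lemma reflect_pull:
  assumes "J \<subseteq> {1..Suc i}" "Suc i \<in> J" "y \<in> chamber (Suc i)" "r \<in> {0..1}" "depth J y < 1 \<or> r = 0"
  shows "cls i (J - {Suc i}) (reflect (Suc i) (pull J 1 y)) r = cls i (J - {Suc i}) (pull J 1 y) r"
proof -
  have Jm: "J \<subseteq> {1..m}" using assms(1) i by auto
  have J': "J - {Suc i} \<subseteq> {1..i}" using assms(1) by auto
  have p: "pull J 1 y \<in> chamber (Suc i)" using pull_in[OF assms(3) Jm] by simp
  note in_i = reflect_in[OF p i] chamber_Suc[OF p]
  show ?thesis
    using assms(5)
  proof
    assume "r = 0"
    then show ?thesis using cls_bot[OF J' in_i] by simp
  next
    assume "depth J y < 1"
    then have "pull J 1 y \<in> walls J"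
      using pull_in_walls[of J y] chamber_nonneg[OF assms(3)] assms(1) by blast
    then consider "pull J 1 y (Suc i) = 0" | "pull J 1 y \<in> walls (J - {Suc i})"
      by (auto simp: walls_def)
    then show ?thesis
    proof cases
      case 1
      then have "reflect (Suc i) (pull J 1 y) = pull J 1 y" by (auto simp: reflect_def)
      then show ?thesis by simp
    next
      case 2
      then show ?thesis using cls_wall[OF J' in_i _ _ assms(4)] by (simp add: reflect_walls)
    qed
  qed
qed

lemma gather_cont:
  assumes J: "J \<subseteq> {1..Suc i}"
  shows "continuous_map (top_of_set (chamber (Suc i) \<times> {0..1})) (stage i) (\<lambda>z. gather (J, z))"
proof (cases "Suc i \<in> J")
  case False
  then have "J \<subseteq> {1..i}" using J by (auto simp: le_Suc_eq)
  then have "continuous_map (top_of_set (chamber (Suc i) \<times> {0..1})) (stage i) (\<lambda>z. cls i J (fst z) (snd z))"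
    by (intro cls_cont continuous_intros) (auto dest: chamber_Suc)
  then show ?thesis using False by (simp add: gather_def case_prod_unfold)
next
  case True
  have Jm: "J \<subseteq> {1..m}" using J i by auto
  have J': "J - {Suc i} \<subseteq> {1..i}" using J by (auto simp: le_Suc_eq)
  have p: "pull J 1 y \<in> chamber (Suc i)" if "y \<in> chamber (Suc i)" for y
    using pull_in[OF that Jm] by simp
  have d: "1 - dip J y s \<in> {0..1}" if "y \<in> chamber (Suc i)" "s \<in> {0..1}" for y s
    using unit_interval_compl[OF dip_unit[OF that(1) J i that(2)]] .
  have cp: "continuous_on T (\<lambda>z. pull J 1 (fst z))" "continuous_on T (\<lambda>z. reflect (Suc i) (pull J 1 (fst z)))"
    "continuous_on T (\<lambda>z. 1 - dip J (fst z) (snd z))" for T :: "((nat \<Rightarrow> real) \<times> real) set"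
    by (intro continuous_on_reflect continuous_on_pull continuous_on_diff continuous_on_dip
        continuous_on_const continuous_on_fst continuous_on_snd continuous_on_id)+
  have "continuous_map (top_of_set (chamber (Suc i) \<times> {0..1})) (stage i)
     (\<lambda>z :: (nat \<Rightarrow> real) \<times> real. if snd z \<le> 1/2 then cls i (J - {Suc i}) (pull J 1 (fst z)) (1 - dip J (fst z) (snd z))
       else cls i (J - {Suc i}) (reflect (Suc i) (pull J 1 (fst z))) (1 - dip J (fst z) (snd z)))"
  proof (intro continuous_map_cases_le_top_of_set cls_cont J' cp)
    fix z :: "(nat \<Rightarrow> real) \<times> real" assume z: "z \<in> chamber (Suc i) \<times> {0..1}" "snd z = 1/2"
    then have *: "1 - dip J (fst z) (snd z) = 1 - depth J (fst z)" by (simp add: dip_def)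
    have "1 - dip J (fst z) (snd z) \<in> {0..1}" using d z(1) by (auto simp: mem_Times_iff)
    then have **: "1 - depth J (fst z) \<in> {0..1}" unfolding * .
    then have "depth J (fst z) < 1 \<or> 1 - depth J (fst z) = 0" by auto
    with ** show "cls i (J - {Suc i}) (pull J 1 (fst z)) (1 - dip J (fst z) (snd z)) =
        cls i (J - {Suc i}) (reflect (Suc i) (pull J 1 (fst z))) (1 - dip J (fst z) (snd z))"
      unfolding * using z(1) by (intro reflect_pull[symmetric] J True) (auto simp: mem_Times_iff)
  qed (use p d reflect_in[OF _ i] chamber_Suc in \<open>auto intro!: continuous_intros simp: mem_Times_iff\<close>)
  then show ?thesis unfolding gather_def case_prod_unfold fst_conv snd_conv using True by simp
qed

text \<open>On the new cylinders \<open>dip\<close> vanishes at both ends of the interval and on the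
  walls, so all three conditions reduce to the value being the base point.\<close>

lemma gather_compatible:
  assumes J: "J \<subseteq> {1..Suc i}"
  shows "slice_compatible (chamber (Suc i)) (walls J) (base i) (\<lambda>z. gather (J, z))"
proof (cases "Suc i \<in> J")
  case False
  then have "J \<subseteq> {1..i}" using J by (auto simp: le_Suc_eq)
  then show ?thesis
    using False
    by (intro slice_compatibleI) (simp_all add: gather_def, (rule cls_top cls_bot cls_wall; simp add: chamber_Suc)+)
next
  case True
  have Jm: "J \<subseteq> {1..m}" using J i by auto
  have fin: "finite J" using finite_subset[OF J] by simp
  have J': "J - {Suc i} \<subseteq> {1..i}" using J by (auto simp: le_Suc_eq)
  have p: "pull J 1 y \<in> chamber i" "reflect (Suc i) (pull J 1 y) \<in> chamber i" if "y \<in> chamber (Suc i)" for y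
    using pull_in[OF that Jm, of 1] reflect_in[OF _ i] chamber_Suc by auto
  have top: "gather (J, y, s) = base i" if "y \<in> chamber (Suc i)" "dip J y s = 0" for y s
    using p[OF that(1)] True J' that(2) by (simp add: gather_def cls_top)
  have "dip J y 0 = 0" "dip J y 1 = 0" for y by (simp_all add: dip_def)
  then show ?thesis
    by (intro slice_compatibleI) (simp_all add: top dip_walls[OF fin])
qed


section \<open>Spreading followed by gathering\<close>

definition tail_depth :: "nat set \<Rightarrow> (nat \<Rightarrow> real) \<Rightarrow> real" where
  "tail_depth J x = depth J x * min 1 (max 0 (- 2 * x (Suc i)))"

lemma tail_depth_unit:
  assumes "J \<subseteq> {1..i}" "x \<in> chamber i"
  shows "tail_depth J x \<in> {0..1}"
proof -
  have "0 \<le> x j" if "j \<in> J" for j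
    using chamber_bounds(2)[OF assms(2), of j] that assms(1) i by auto
  then show ?thesis
    unfolding tail_depth_def using depth_bounds[of J x] by (intro unit_interval_mult) auto
qed

text \<open>For x (Suc i) \<le> 0 the new coordinate contributes the factor min 1 (- 2 x (Suc i)).
  The \<open>max\<close> in \<open>tail_depth\<close> extends this factor by 0 to the other side, so
  that the excursion dies out continuously at the wall.\<close>

lemma depth_fold_coord:
  assumes J: "J \<subseteq> {1..i}" and x: "x (Suc i) \<le> 0"
  shows "depth (insert (Suc i) J) (fold_coord (Suc i) x) = tail_depth J x"
proof -
  have "finite J" "Suc i \<notin> J" using finite_subset[OF J] J by auto
  moreover have "(\<Prod>j\<in>J. min 1 (2 * fold_coord (Suc i) x j)) = (\<Prod>j\<in>J. min 1 (2 * x j))"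
    using \<open>Suc i \<notin> J\<close> by (intro prod.cong) (auto simp: fold_coord_def)
  ultimately show ?thesis
    using x by (simp add: depth_def tail_depth_def fold_coord_def)
qed

text \<open>Since \<open>stretch\<close> is odd, pulling commutes with reflection, and reflecting
  the folded point gives x back.\<close>

lemma reflect_pull_fold:
  assumes "x (Suc i) \<le> 0"
  shows "reflect (Suc i) (pull (insert (Suc i) J) 1 (fold_coord (Suc i) x)) = pull (insert (Suc i) J) 1 x"
proof
  fix j
  have "x (Suc i) = - \<bar>x (Suc i)\<bar>" using assms by simp
  then have "stretch (x (Suc i)) = - stretch \<bar>x (Suc i)\<bar>" by (metis stretch_simps(2))
  then show "reflect (Suc i) (pull (insert (Suc i) J) 1 (fold_coord (Suc i) x)) j = pull (insert (Suc i) J) 1 x j"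
    by (simp add: reflect_def pull_def fold_coord_def)
qed

text \<open>For negative x (Suc i) the two pulled points are mirror images of each other, and
  \<open>reflect_pull\<close> applies at the folded point.\<close>

lemma pull_fold:
  assumes J: "J \<subseteq> {1..i}" and x: "x \<in> chamber i" and r: "r \<in> {0..1}" "tail_depth J x < 1 \<or> r = 0"
  shows "cls i J (pull (insert (Suc i) J) 1 (fold_coord (Suc i) x)) r = cls i J (pull (insert (Suc i) J) 1 x) r"
proof (cases "0 \<le> x (Suc i)")
  case True
  then show ?thesis by (simp add: fold_coord_id)
next
  case False
  then have neg: "x (Suc i) \<le> 0" by simp
  have J': "insert (Suc i) J - {Suc i} = J" using J by auto
  show ?thesis
    using reflect_pull[OF insert_Suc(1)[OF J] insertI1 fold_coord_in[OF x i] r(1)] r(2)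
    by (simp add: J' depth_fold_coord[where x = x, OF J neg] reflect_pull_fold[where x = x, OF neg])
qed

text \<open>Over points with negative coordinate \<open>Suc i\<close> the composite reads "fold,
  minus fold, plus x", up to \<open>pull\<close>; over the others it climbs over x, which is its own
  fold, and then rests at the pole. The last third of the interval is one run of
  \<open>gather\<close>, whose turning point falls at s = 5/6.\<close>

lemma gather_spread:
  assumes J: "J \<subseteq> {1..i}" and x: "x \<in> chamber i" and s: "s \<in> {0..1}"
    and g': "\<forall>J\<subseteq>{1..Suc i}. \<forall>y\<in>chamber (Suc i). \<forall>s\<in>{0..1}. g (cls (Suc i) J y s) = gather (J, y, s)"
  shows "g (spread (J, x, s)) =
     (if s \<le> 1/3 then cls i J (fold_coord (Suc i) x) (3 * s)
      else if min (s - 2/3) (- x (Suc i)) \<le> 0 then base i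
      else if s \<le> 5/6 then cls i J (pull (insert (Suc i) J) 1 (fold_coord (Suc i) x)) (1 - tail_depth J x * (1 - \<bar>6 * s - 5\<bar>))
      else cls i J (pull (insert (Suc i) J) 1 x) (1 - tail_depth J x * (1 - \<bar>6 * s - 5\<bar>)))"
proof -
  note g = g'[rule_format]
  note J' = insert_Suc[OF J] and f = fold_coord_in[OF x i]
  have nJ: "Suc i \<notin> J" using J by auto
  have nJ': "insert (Suc i) J - {Suc i} = J" using nJ by simp
  have fin: "finite (insert (Suc i) J)" using finite_subset[OF J] by simp
  consider "s \<le> 1/3" | "\<not> s \<le> 1/3" "min (s - 2/3) (- x (Suc i)) \<le> 0"
    | "\<not> s \<le> 1/3" "\<not> min (s - 2/3) (- x (Suc i)) \<le> 0" by blast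
  then show ?thesis
  proof cases
    case 1
    then have "spread (J, x, s) = cls (Suc i) J (fold_coord (Suc i) x) (3 * s)" by (simp add: spread_def)
    then show ?thesis
      using g[OF J'(2) f, of "3 * s"] 1 s nJ by (simp add: gather_def)
  next
    case 2
    then have "spread (J, x, s) = cls (Suc i) (insert (Suc i) J) (wall_point (Suc i)) \<bar>3 * s - 2\<bar>"
      by (simp add: spread_def)
    moreover have "\<bar>3 * s - 2\<bar> \<in> {0..1}" using 2 s by auto
    moreover have "gather (insert (Suc i) J, wall_point (Suc i), r) = base i" for r
    proof -
      have "pull (insert (Suc i) J) 1 (wall_point (Suc i)) \<in> chamber (Suc i)"
        using J'(1) i by (intro pull_in[OF wall_point_chamber]) auto
      moreover have "dip (insert (Suc i) J) (wall_point (Suc i)) r = 0"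
        using dip_walls[OF fin wall_point_wall] by simp
      ultimately show ?thesis
        using J reflect_in[OF _ i] chamber_Suc by (simp add: gather_def nJ' cls_top)
    qed
    ultimately show ?thesis
      using g[OF J'(1) wall_point_chamber] 2 by simp
  next
    case 3
    then have s2: "\<not> s \<le> 2/3" and neg: "x (Suc i) \<le> 0" by auto
    have "spread (J, x, s) = cls (Suc i) (insert (Suc i) J) (fold_coord (Suc i) x) \<bar>3 * s - 2\<bar>"
      using 3 by (simp add: spread_def)
    moreover have "\<bar>3 * s - 2\<bar> = 3 * s - 2" "3 * s - 2 \<in> {0..1}" using s2 s by auto
    moreover have "dip (insert (Suc i) J) (fold_coord (Suc i) x) (3 * s - 2) = tail_depth J x * (1 - \<bar>6 * s - 5\<bar>)"
    proof -
      have "2 * (3 * s - 2) - 1 = 6 * s - 5" by simp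
      then show ?thesis unfolding dip_def depth_fold_coord[where x = x, OF J neg] by simp
    qed
    ultimately show ?thesis
      using g[OF J'(1) f, of "3 * s - 2"] 3 by (simp add: gather_def nJ' reflect_pull_fold[where x = x, OF neg])
  qed
qed

lemma continuous_on_tail_depth:
  assumes "continuous_on T f"
  shows "continuous_on T (\<lambda>z. tail_depth J (f z))"
  unfolding tail_depth_def
  by (intro continuous_on_mult continuous_on_depth[OF assms] continuous_on_min continuous_on_max
      continuous_on_const continuous_on_coordinate[OF assms])

lemma gather_spread_homotopic:
  assumes J: "J \<subseteq> {1..i}"
    and f: "\<And>J x s. J \<subseteq> {1..i} \<Longrightarrow> x \<in> chamber i \<Longrightarrow> s \<in> {0..1} \<Longrightarrow> f (cls i J x s) = spread (J, x, s)"
    and g: "\<And>J y s. J \<subseteq> {1..Suc i} \<Longrightarrow> y \<in> chamber (Suc i) \<Longrightarrow> s \<in> {0..1} \<Longrightarrow> g (cls (Suc i) J y s) = gather (J, y, s)"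
  shows "slice_homotopic i J (\<lambda>(x, s). g (f (cls i J x s))) (\<lambda>(x, s). cls i J x s)"
proof -
  define n where "n = Suc i"
  define J' where "J' = insert n J"
  define L where "L = tail_depth J"
  \<comment> \<open>Between s = 1/3 and s = 2/3 the height at t = 0 is 1, so the point can be moved
    there without effect. This interval serves to pass from the folded point to its pulled
    version.\<close>
  define c where "c = (\<lambda>s::real. min 1 (max 0 (3 * s - 1)))"
  \<comment> \<open>At t = 0 this climbs to 1 and, for s between 2/3 and 5/6, comes back to 1 - L x;
    at t = 1 it reaches 1 - L x at s = 5/6 in a straight line, whence the slope 6/5. The
    straightening is the cancellation of "fold" against "minus fold".\<close>
  define a where "a = (\<lambda>t x s. (1 - t) * (min 1 (3 * s) - L x * max 0 (1 - \<bar>6 * s - 5\<bar>)) + t * (6/5 * s * (1 - L x)))"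
  define b where "b = (\<lambda>x s. 1 - L x * (6 - 6 * s))"
  define w where "w = (\<lambda>t x s. (1 - t) * ((1 - L x) * min 1 (6/5 * s) + L x * max 0 (6 * s - 5)) + t * s)"
  have J'm: "J' \<subseteq> {1..m}" using J i by (auto simp: J'_def n_def)
  have fin: "finite J" using finite_subset[OF J] by simp
  have L: "L x \<in> {0..1}" if "x \<in> chamber i" for x
    unfolding L_def by (rule tail_depth_unit[OF J that])
  have L0: "L x = 0" if "x \<in> walls J" for x
    unfolding L_def tail_depth_def using depth_walls[OF fin that] by simp
  have fx: "fold_coord n x \<in> chamber i" if "x \<in> chamber i" for x
    using chamber_Suc[OF fold_coord_in[OF that i]] by (simp add: n_def)
  have pull: "pull J' t x \<in> chamber i" if "x \<in> chamber i" "t \<in> {0..1}" for t x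
    using pull_in[OF that(1) J'm that(2)] .
  have a_unit: "a t x s \<in> {0..1}" if "t \<in> {0..1}" "x \<in> chamber i" "s \<in> {0..1}" "s \<le> 5/6" for t x s
    unfolding a_def
  proof (rule unit_interval_convex[OF that(1)])
    show "min 1 (3 * s) - L x * max 0 (1 - \<bar>6 * s - 5\<bar>) \<in> {0..1}"
    proof (cases "s \<le> 2/3")
      case True
      then have "max 0 (1 - \<bar>6 * s - 5\<bar>) = 0" by auto
      then show ?thesis using that(3) by auto
    next
      case False
      then have "max 0 (1 - \<bar>6 * s - 5\<bar>) \<in> {0..1}" "min 1 (3 * s) = 1" by auto
      then show ?thesis using unit_interval_compl[OF unit_interval_mult[OF L[OF that(2)]]] by simp
    qed
    show "6/5 * s * (1 - L x) \<in> {0..1}"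
    proof (rule unit_interval_mult[OF _ unit_interval_compl[OF L[OF that(2)]]])
      show "6/5 * s \<in> {0..1}" using that(3,4) by auto
    qed
  qed
  have b_unit: "b x s \<in> {0..1}" if "x \<in> chamber i" "s \<in> {0..1}" "5/6 \<le> s" for x s
    unfolding b_def using that by (intro unit_interval_compl unit_interval_mult[OF L[OF that(1)]]) auto
  have w_unit: "w t x s \<in> {0..1}" if "t \<in> {0..1}" "x \<in> chamber i" "s \<in> {0..1}" for t x s
    unfolding w_def using that by (intro unit_interval_convex L) auto
  define H1 where "H1 = (\<lambda>t x s. if s \<le> 5/6 then cls i J (pull J' (max t (c s)) (fold_coord n x)) (a t x s)
      else cls i J (pull J' 1 x) (b x s))"
  define H2 where "H2 = (\<lambda>t x s. cls i J (pull J' (1 - t) x) (w t x s))"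
  have cx: "continuous_on T (\<lambda>z. fst (snd z))" "continuous_on T (\<lambda>z. snd (snd z))" "continuous_on T (\<lambda>z. fst z)"
    for T :: "homotopy_arg set"
    by (intro continuous_intros)+
  have cL: "continuous_on T (\<lambda>z. L (fst (snd z)))" for T :: "homotopy_arg set"
    unfolding L_def by (intro continuous_on_tail_depth cx)
  have cpull: "continuous_on T (\<lambda>z. pull J' (h z) (fst (snd z)))"
      "continuous_on T (\<lambda>z. pull J' (h z) (fold_coord n (fst (snd z))))"
    if "continuous_on T h" for T :: "homotopy_arg set" and h
    by (intro continuous_on_pull that continuous_on_fold_coord cx)+
  have "slice_homotopic i J (\<lambda>(x, s). g (f (cls i J x s))) (\<lambda>(x, s). H2 0 x s)"
  proof (rule homotopic_with_sliceI[where h = H1])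
    have "continuous_map (top_of_set ({0..1} \<times> chamber i \<times> {0..1})) (stage i)
       (\<lambda>z :: homotopy_arg. if snd (snd z) \<le> 5/6
          then cls i J (pull J' (max (fst z) (c (snd (snd z)))) (fold_coord n (fst (snd z)))) (a (fst z) (fst (snd z)) (snd (snd z)))
          else cls i J (pull J' 1 (fst (snd z))) (b (fst (snd z)) (snd (snd z))))"
    proof (intro continuous_map_cases_le_top_of_set cls_cont J cpull)
      fix z :: homotopy_arg
      assume z: "z \<in> {0..1} \<times> chamber i \<times> {0..1}" "snd (snd z) = 5/6"
      obtain t x where zz: "z = (t, x, 5/6)" using z(2) by (cases z) auto
      have x: "x \<in> chamber i" "t \<in> {0..1}" using z(1) zz by auto
      have "a t x (5/6) = (1 - t) * (1 - L x) + t * (1 - L x)" by (simp add: a_def)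
      then have "a t x (5/6) = 1 - L x" by (simp add: algebra_simps)
      moreover have "max t (c (5/6)) = 1" "b x (5/6) = 1 - L x"
        using x(2) by (auto simp: c_def b_def)
      moreover
      have "cls i J (pull J' 1 (fold_coord n x)) (1 - L x) = cls i J (pull J' 1 x) (1 - L x)"
        unfolding J'_def n_def
      proof (rule pull_fold[OF J x(1)])
        show "1 - L x \<in> {0..1}" using L[OF x(1)] by auto
        show "tail_depth J x < 1 \<or> 1 - L x = 0" using L[OF x(1)] by (auto simp: L_def)
      qed
      ultimately show "cls i J (pull J' (max (fst z) (c (snd (snd z)))) (fold_coord n (fst (snd z)))) (a (fst z) (fst (snd z)) (snd (snd z)))
        = cls i J (pull J' 1 (fst (snd z))) (b (fst (snd z)) (snd (snd z)))"
        by (simp add: zz)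
    next
      fix z :: homotopy_arg
      assume "z \<in> {z \<in> {0..1} \<times> chamber i \<times> {0..1}. snd (snd z) \<le> 5/6}"
      then have z: "fst z \<in> {0..1}" "fst (snd z) \<in> chamber i" "snd (snd z) \<in> {0..1}" "snd (snd z) \<le> 5/6"
        by auto
      have "max (fst z) (c (snd (snd z))) \<in> {0..1}" using z(1) by (auto simp: c_def)
      then show "pull J' (max (fst z) (c (snd (snd z)))) (fold_coord n (fst (snd z))) \<in> chamber i"
        by (rule pull[OF fx[OF z(2)]])
      show "a (fst z) (fst (snd z)) (snd (snd z)) \<in> {0..1}" by (rule a_unit[OF z])
    next
      fix z :: homotopy_arg
      assume "z \<in> {z \<in> {0..1} \<times> chamber i \<times> {0..1}. 5/6 \<le> snd (snd z)}"
      then have z: "fst (snd z) \<in> chamber i" "snd (snd z) \<in> {0..1}" "5/6 \<le> snd (snd z)"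
        by auto
      show "pull J' 1 (fst (snd z)) \<in> chamber i" by (rule pull[OF z(1)]) simp
      show "b (fst (snd z)) (snd (snd z)) \<in> {0..1}" by (rule b_unit[OF z])
    qed (unfold c_def a_def b_def, (intro continuous_on_const cx continuous_on_max continuous_on_min continuous_on_mult
        continuous_on_diff continuous_on_add continuous_on_rabs cL)+)
    then show "continuous_map (top_of_set ({0..1} \<times> chamber i \<times> {0..1})) (stage i) (\<lambda>(t, x, s). H1 t x s)"
      unfolding H1_def case_prod_unfold .
  next
    fix x s assume x: "x \<in> chamber i" and s: "s \<in> {0..1::real}"
    have fxn: "pull J' t (fold_coord n x) \<in> chamber i" "pull J' t x \<in> chamber i" if "t \<in> {0..1}" for t
      using pull fx x that by auto
    have "\<forall>J\<subseteq>{1..Suc i}. \<forall>y\<in>chamber (Suc i). \<forall>s\<in>{0..1}. g (cls (Suc i) J y s) = gather (J, y, s)"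
      using g by blast
    note gs = gather_spread[OF J x s this]
    have cu: "max 0 (c s) \<in> {0..1}" by (auto simp: c_def)
    consider "s \<le> 1/3" | "\<not> s \<le> 1/3" "min (s - 2/3) (- x (Suc i)) \<le> 0"
      | "\<not> s \<le> 1/3" "\<not> min (s - 2/3) (- x (Suc i)) \<le> 0" by blast
    then have "H1 0 x s = g (spread (J, x, s))"
    proof cases
      case 1
      then have "max 0 (c s) = 0" "max 0 (1 - \<bar>6 * s - 5\<bar>) = 0" "min 1 (3 * s) = 3 * s" "s \<le> 5/6"
        by (auto simp: c_def)
      then show ?thesis unfolding gs using 1 by (simp add: H1_def a_def n_def)
    next
      case 2
      then have "s \<le> 2/3 \<or> x (Suc i) \<ge> 0" by auto
      then have "(s \<le> 5/6 \<longrightarrow> a 0 x s = 1) \<and> (\<not> s \<le> 5/6 \<longrightarrow> b x s = 1)"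
        using 2(1) by (auto simp: a_def b_def L_def tail_depth_def max_def min_def)
      then have "H1 0 x s = base i"
        unfolding H1_def using cls_top[OF J] fxn cu by auto
      then show ?thesis unfolding gs using 2 by simp
    next
      case 3
      then have "max 0 (c s) = 1" "max 0 (1 - \<bar>6 * s - 5\<bar>) = 1 - \<bar>6 * s - 5\<bar>" "min 1 (3 * s) = 1"
        using s by (auto simp: c_def)
      moreover have "\<not> s \<le> 5/6 \<Longrightarrow> 6 - 6 * s = 1 - \<bar>6 * s - 5\<bar>" by auto
      ultimately show ?thesis unfolding gs using 3
        by (simp add: H1_def a_def b_def n_def J'_def L_def)
    qed
    then show "H1 0 x s = (case (x, s) of (x, s) \<Rightarrow> g (f (cls i J x s)))"
      by (simp add: f[OF J x s])
    \<comment> \<open>Once straightened, the heights up to s = 5/6 are at most 1 - L x. They vanish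
      where L x = 1, and elsewhere \<open>pull_fold\<close> applies; so the folded point can be
      exchanged for x itself.\<close>
    show "H1 1 x s = (case (x, s) of (x, s) \<Rightarrow> H2 0 x s)"
    proof (cases "s \<le> 5/6")
      case True
      then have "min 1 (6/5 * s) = 6/5 * s" "max 0 (6 * s - 5) = 0" by auto
      then have "w 0 x s = 6/5 * s * (1 - L x)" "a 1 x s = 6/5 * s * (1 - L x)" "max 1 (c s) = 1"
        by (auto simp: w_def a_def c_def mult.commute)
      moreover have "cls i J (pull J' 1 (fold_coord n x)) (6/5 * s * (1 - L x)) = cls i J (pull J' 1 x) (6/5 * s * (1 - L x))"
        unfolding J'_def n_def
      proof (rule pull_fold[OF J x])
        show "6/5 * s * (1 - L x) \<in> {0..1}"
          using a_unit[of 1 x s] x s True by (simp add: a_def)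
        show "tail_depth J x < 1 \<or> 6/5 * s * (1 - L x) = 0" using L[OF x] by (auto simp: L_def)
      qed
      moreover have "H1 1 x s = cls i J (pull J' (max 1 (c s)) (fold_coord n x)) (a 1 x s)"
        "H2 0 x s = cls i J (pull J' 1 x) (w 0 x s)" using True by (simp_all add: H1_def H2_def)
      ultimately show ?thesis by (simp only: prod.case)
    next
      case False
      then have "min 1 (6/5 * s) = 1" "max 0 (6 * s - 5) = 6 * s - 5" by auto
      then have "b x s = w 0 x s" by (simp add: w_def b_def algebra_simps)
      then show ?thesis using False by (simp add: H1_def H2_def)
    qed
  next
    fix t :: real assume t: "t \<in> {0..1}"
    have mt: "max t (c s) \<in> {0..1}" for s using t by (auto simp: c_def)
    have pf: "pull J' (max t (c s)) (fold_coord n x) \<in> chamber i" "pull J' 1 x \<in> chamber i" if "x \<in> chamber i" for x s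
      using pull[OF fx[OF that] mt] pull[OF that] by auto
    show "slice_compatible (chamber i) (walls J) (base i) (\<lambda>(x, s). H1 t x s)"
    proof (rule slice_compatibleI)
      show "(\<lambda>(x, s). H1 t x s) (x, 1) = base i" if "x \<in> chamber i" for x
        using cls_top[OF J pf(2)[OF that]] by (simp add: H1_def b_def)
      show "(\<lambda>(x, s). H1 t x s) (x, 0) = (\<lambda>(x, s). H1 t x s) (x', 0)" if "x \<in> chamber i" "x' \<in> chamber i" for x x'
        using cls_bot[OF J pf(1)[OF that(1), of 0] pf(1)[OF that(2), of 0]] by (simp add: H1_def a_def)
      show "(\<lambda>(x, s). H1 t x s) (x, s) = (\<lambda>(x, s). H1 t x s) (x', s)"
        if x: "x \<in> chamber i" "x \<in> walls J" "x' \<in> chamber i" "x' \<in> walls J" "s \<in> {0..1}" for x x' s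
      proof -
        have "a t x s = a t x' s" "b x s = b x' s" by (simp_all add: a_def b_def L0 x)
        moreover have "cls i J (pull J' (max t (c s)) (fold_coord n x)) (a t x' s) = cls i J (pull J' (max t (c s)) (fold_coord n x')) (a t x' s)"
          if "s \<le> 5/6"
          by (intro cls_wall J pf x pull_walls fold_coord_walls a_unit t that)
        moreover have "cls i J (pull J' 1 x) (b x' s) = cls i J (pull J' 1 x') (b x' s)" if "\<not> s \<le> 5/6"
          using that by (intro cls_wall J pf x pull_walls b_unit) auto
        ultimately show ?thesis by (simp add: H1_def)
      qed
    qed
  qed
  moreover have "slice_homotopic i J (\<lambda>(x, s). H2 0 x s) (\<lambda>(x, s). cls i J x s)"
  proof (rule moving_slice_homotopic[where p = "\<lambda>t. pull J' (1 - t)" and h = w])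
    show "continuous_on ({0..1} \<times> chamber i \<times> {0..1}) (\<lambda>z :: homotopy_arg. w (fst z) (fst (snd z)) (snd (snd z)))"
      unfolding w_def
      by (intro continuous_on_const cx continuous_on_max continuous_on_min continuous_on_mult
          continuous_on_diff continuous_on_add cL)
    show "continuous_on ({0..1} \<times> chamber i \<times> {0..1}) (\<lambda>z :: homotopy_arg. pull J' (1 - fst z) (fst (snd z)))"
      by (intro cpull continuous_on_diff continuous_on_const cx)
  qed (use J pull pull_walls w_unit in \<open>auto simp: w_def H2_def L0\<close>)
  ultimately show ?thesis by (rule homotopic_with_trans)
qed


section \<open>Gathering followed by spreading\<close>

lemma spread_gather_homotopic_old:
  assumes J: "J \<subseteq> {1..i}"
    and f: "\<And>J x s. J \<subseteq> {1..i} \<Longrightarrow> x \<in> chamber i \<Longrightarrow> s \<in> {0..1} \<Longrightarrow> f (cls i J x s) = spread (J, x, s)"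
    and g: "\<And>J y s. J \<subseteq> {1..Suc i} \<Longrightarrow> y \<in> chamber (Suc i) \<Longrightarrow> s \<in> {0..1} \<Longrightarrow> g (cls (Suc i) J y s) = gather (J, y, s)"
  shows "slice_homotopic (Suc i) J
     (\<lambda>(x, s). f (g (cls (Suc i) J x s))) (\<lambda>(x, s). cls (Suc i) J x s)"
proof -
  define n where "n = Suc i"
  have nJ: "n \<notin> J" using J by (auto simp: n_def)
  have Jn: "J \<subseteq> {1..n}" "insert n J \<subseteq> {1..n}" using insert_Suc[OF J] by (simp_all add: n_def)
  have wp: "wall_point n \<in> chamber n" "wall_point n \<in> walls (insert n J)"
    using wall_point_chamber wall_point_wall by (simp_all add: n_def)
  \<comment> \<open>On old cylinders \<open>gather\<close> is the inclusion and coordinate n is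
    nonnegative, so the composite climbs the cylinder J and then goes down and up over the fixed
    \<open>wall_point\<close>. Raising the lowest height of this detour to 1 cancels it;
    \<open>w\<close> then restores the parametrization.\<close>
  define H1 where "H1 = (\<lambda>t x s. if s \<le> 1/3 then cls n J x (3 * s) else cls n (insert n J) (wall_point n) (max t \<bar>3 * s - 2\<bar>))"
  define w where "w = (\<lambda>t s :: real. (1 - t) * min 1 (3 * s) + t * s)"
  define H2 where "H2 = (\<lambda>t x s. cls n J x (w t s))"
  have cx: "continuous_on T (\<lambda>z. fst (snd z))" "continuous_on T (\<lambda>z. snd (snd z))" "continuous_on T (\<lambda>z. fst z)"
    for T :: "homotopy_arg set"
    by (intro continuous_intros)+
  have w_unit: "w t s \<in> {0..1}" if "t \<in> {0..1}" "s \<in> {0..1}" for t s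
    unfolding w_def using that by (intro unit_interval_convex) auto
  have "slice_homotopic n J (\<lambda>(x, s). f (g (cls n J x s))) (\<lambda>(x, s). H2 0 x s)"
  proof (rule homotopic_with_sliceI[where h = H1])
    have "continuous_map (top_of_set ({0..1} \<times> chamber n \<times> {0..1})) (stage n)
       (\<lambda>z :: homotopy_arg. if snd (snd z) \<le> 1/3
          then cls n J (fst (snd z)) (3 * snd (snd z))
          else cls n (insert n J) (wall_point n) (max (fst z) \<bar>3 * snd (snd z) - 2\<bar>))"
    proof (intro continuous_map_cases_le_top_of_set cls_cont Jn cx wp)
      fix z :: homotopy_arg
      assume z: "z \<in> {0..1} \<times> chamber n \<times> {0..1}" "snd (snd z) = 1/3"
      then have "3 * snd (snd z) = 1" "max (fst z) \<bar>3 * snd (snd z) - 2\<bar> = 1" by auto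
      then show "cls n J (fst (snd z)) (3 * snd (snd z)) = cls n (insert n J) (wall_point n) (max (fst z) \<bar>3 * snd (snd z) - 2\<bar>)"
        using cls_top[OF Jn(1), of "fst (snd z)"] cls_top[OF Jn(2) wp(1)] z(1) by (simp add: mem_Times_iff)
    next
      fix z :: homotopy_arg
      assume "z \<in> {z \<in> {0..1} \<times> chamber n \<times> {0..1}. snd (snd z) \<le> 1/3}"
      then show "fst (snd z) \<in> chamber n" "3 * snd (snd z) \<in> {0..1}" by auto
    next
      fix z :: homotopy_arg
      assume "z \<in> {z \<in> {0..1} \<times> chamber n \<times> {0..1}. 1/3 \<le> snd (snd z)}"
      then show "max (fst z) \<bar>3 * snd (snd z) - 2\<bar> \<in> {0..1}" by (auto simp: abs_le_iff)
    qed (intro continuous_on_const cx continuous_on_max continuous_on_mult continuous_on_diff continuous_on_rabs)+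
    then show "continuous_map (top_of_set ({0..1} \<times> chamber n \<times> {0..1})) (stage n) (\<lambda>(t, x, s). H1 t x s)"
      unfolding H1_def case_prod_unfold .
  next
    fix x s assume x: "x \<in> chamber n" and s: "s \<in> {0..1::real}"
    have "g (cls n J x s) = cls i J x s"
      using g[OF insert_Suc(2)[OF J], of x s] x s nJ by (simp add: n_def gather_def)
    then have "f (g (cls n J x s)) = spread (J, x, s)"
      using f[OF J chamber_Suc s] x by (simp add: n_def)
    moreover have "0 \<le> x n" using chamber_nonneg x by (simp add: n_def)
    moreover have "min (s - 2/3) (- x n) \<le> 0" using \<open>0 \<le> x n\<close> by auto
    ultimately show "H1 0 x s = (case (x, s) of (x, s) \<Rightarrow> f (g (cls n J x s)))"
      by (simp add: H1_def spread_def n_def fold_coord_id)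
    show "H1 1 x s = (case (x, s) of (x, s) \<Rightarrow> H2 0 x s)"
    proof (cases "s \<le> 1/3")
      case True
      then show ?thesis by (simp add: H1_def H2_def w_def)
    next
      case False
      then have "max 1 \<bar>3 * s - 2\<bar> = 1" "w 0 s = 1" using s by (auto simp: w_def)
      then show ?thesis
        using cls_top[OF Jn(1) x] cls_top[OF Jn(2) wp(1)] False by (simp add: H1_def H2_def)
    qed
  next
    fix t :: real assume t: "t \<in> {0..1}"
    show "slice_compatible (chamber n) (walls J) (base n) (\<lambda>(x, s). H1 t x s)"
    proof (rule slice_compatibleI)
      show "(\<lambda>(x, s). H1 t x s) (x, 1) = base n" if "x \<in> chamber n" for x
        using cls_top[OF Jn(2) wp(1)] t by (simp add: H1_def max_def)
      show "(\<lambda>(x, s). H1 t x s) (x, 0) = (\<lambda>(x, s). H1 t x s) (x', 0)" if "x \<in> chamber n" "x' \<in> chamber n" for x x'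
        using cls_bot[OF Jn(1) that] by (simp add: H1_def)
      show "(\<lambda>(x, s). H1 t x s) (x, s) = (\<lambda>(x, s). H1 t x s) (x', s)"
        if x: "x \<in> chamber n" "x \<in> walls J" "x' \<in> chamber n" "x' \<in> walls J" "s \<in> {0..1}" for x x' s
        using cls_wall[OF Jn(1) x(1,3,2,4), of "3 * s"] x(5) by (simp add: H1_def)
    qed
  qed
  moreover have "slice_homotopic n J (\<lambda>(x, s). H2 0 x s) (\<lambda>(x, s). cls n J x s)"
  proof (rule moving_slice_homotopic[where p = "\<lambda>t x. x" and h = "\<lambda>t x. w t"])
    show "continuous_on ({0..1} \<times> chamber n \<times> {0..1}) (\<lambda>z :: homotopy_arg. w (fst z) (snd (snd z)))"
      unfolding w_def by (intro continuous_intros)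
  qed (use Jn cx w_unit in \<open>auto simp: w_def H2_def\<close>)
  ultimately show ?thesis unfolding n_def by (rule homotopic_with_trans)
qed

text \<open>The point \<open>k x\<close> and its mirror image have the same fold, so the portions in
  the cylinder \<open>J'\<close> cancel, and so do those over \<open>wall_point\<close> except for
  one descent. What remains is this descent over \<open>wall_point\<close> followed by an ascent
  over \<open>k x\<close> in the cylinder J. Up to the choice of the lower pole this is the
  identity.\<close>

lemma spread_gather_homotopic_new:
  assumes J: "J \<subseteq> {1..Suc i}" "Suc i \<in> J"
    and f: "\<And>J x s. J \<subseteq> {1..i} \<Longrightarrow> x \<in> chamber i \<Longrightarrow> s \<in> {0..1} \<Longrightarrow> f (cls i J x s) = spread (J, x, s)"
    and g: "\<And>J y s. J \<subseteq> {1..Suc i} \<Longrightarrow> y \<in> chamber (Suc i) \<Longrightarrow> s \<in> {0..1} \<Longrightarrow> g (cls (Suc i) J y s) = gather (J, y, s)"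
  shows "slice_homotopic (Suc i) J
     (\<lambda>(x, s). f (g (cls (Suc i) J x s))) (\<lambda>(x, s). cls (Suc i) J x s)"
proof -
  define n where "n = Suc i"
  define J' where "J' = J - {n}"
  have Jn: "J \<subseteq> {1..n}" "J' \<subseteq> {1..n}" and Ji: "J' \<subseteq> {1..i}" and ins: "insert n J' = J" and nJ: "n \<in> J"
    using J by (auto simp: J'_def n_def)
  have Jm: "J \<subseteq> {1..m}" using Jn i by (auto simp: n_def)
  have fin: "finite J" using finite_subset[OF J(1)] by simp
  have wp: "wall_point n \<in> chamber n" "wall_point n \<in> walls J"
    using wall_point_chamber wall_point_wall[OF J(2)] by (simp_all add: n_def)
  define k where "k = pull J 1"
  have pull: "pull J t x \<in> chamber n" if "x \<in> chamber n" "t \<in> {0..1}" for t x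
    by (rule pull_in[OF that(1) Jm that(2)])
  have k: "k x \<in> chamber n" if "x \<in> chamber n" for x
    unfolding k_def by (rule pull[OF that]) simp
  have d: "dip J x s \<in> {0..1}" if "x \<in> chamber n" "s \<in> {0..1}" for x s
    using dip_unit[OF that(1) Jn(1) _ that(2)] i by (simp add: n_def)
  have d0: "dip J x s = 0" if "x \<in> walls J" for x s
    by (rule dip_walls[OF fin that])
  have d01: "dip J x 0 = 0" "dip J x 1 = 0" for x by (simp_all add: dip_def)
  have dw: "k x \<in> walls J" if "x \<in> chamber n" "dip J x (1/2) \<noteq> 1" for x
  proof -
    have nn: "0 \<le> x j" if "j \<in> J" for j
      using chamber_nonneg[of x j] \<open>x \<in> chamber n\<close> Jn(1) that by (auto simp: n_def)
    moreover have "depth J x < 1"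
      using depth_bounds(2)[of J x, OF nn] that(2) by (simp add: dip_def)
    ultimately show ?thesis unfolding k_def by (rule pull_in_walls)
  qed
  \<comment> \<open>The height at which \<open>spread\<close> is applied; it is 1 - dip at t = 0. At
    t = 1 the factor has become 1/3, so v \<ge> 2/3 and only the last third of \<open>spread\<close>
    is visited, where 3 v - 2 is again 1 - dip.\<close>
  define v where "v = (\<lambda>t x s. 1 - (1 - 2 * t / 3) * dip J x s)"
  have v_unit: "v t x s \<in> {0..1}" if "t \<in> {0..1}" "x \<in> chamber n" "s \<in> {0..1}" for t x s
    unfolding v_def using that(1) by (intro unit_interval_compl unit_interval_mult d[OF that(2,3)]) auto
  define H1 where "H1 = (\<lambda>t x s. if v t x s \<le> 1/3 then cls n J' (k x) (3 * v t x s)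
     else if min (v t x s - 2/3) (s - 1/2) \<le> 0 then cls n J (wall_point n) \<bar>3 * v t x s - 2\<bar>
     else cls n J (k x) \<bar>3 * v t x s - 2\<bar>)"
  \<comment> \<open>The remaining descent over \<open>wall_point\<close> is pushed down to the lower
    pole, taking the start of the path with it, while the second half becomes the plain ascent 2 s -
    1 over \<open>k x\<close>. At s = 1/2 both heights equal (1 - t) times 1 - dip, so the halves
    stay joined.\<close>
  define w where "w = (\<lambda>t x s. (1 - t) * (1 - dip J x s) + t * (2 * s - 1))"
  define w' where "w' = (\<lambda>t x s. (1 - t) * (1 - dip J x s))"
  define H2 where "H2 = (\<lambda>t x s. if s \<le> 1/2 then cls n J (wall_point n) (w' t x s) else cls n J (k x) (w t x s))"
  define u where "u = (\<lambda>t s :: real. (1 - t) * max 0 (2 * s - 1) + t * s)"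
  define H3 where "H3 = (\<lambda>t x s. cls n J (pull J (1 - t) x) (u t s))"
  have w_unit: "w t x s \<in> {0..1}" if "t \<in> {0..1}" "x \<in> chamber n" "s \<in> {0..1}" "1/2 \<le> s" for t x s
    unfolding w_def using that(1,3,4) by (intro unit_interval_convex unit_interval_compl d[OF that(2,3)]) auto
  have w'_unit: "w' t x s \<in> {0..1}" if "t \<in> {0..1}" "x \<in> chamber n" "s \<in> {0..1}" for t x s
    unfolding w'_def using that(1) by (intro unit_interval_mult unit_interval_compl d[OF that(2,3)]) auto
  have u_unit: "u t s \<in> {0..1}" if "t \<in> {0..1}" "s \<in> {0..1}" for t s
    unfolding u_def using that by (intro unit_interval_convex) auto
  have cx: "continuous_on T (\<lambda>z. fst (snd z))" "continuous_on T (\<lambda>z. snd (snd z))" "continuous_on T (\<lambda>z. fst z)"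
    for T :: "homotopy_arg set"
    by (intro continuous_intros)+
  have ck: "continuous_on T (\<lambda>z. k (fst (snd z)))" for T :: "homotopy_arg set"
    unfolding k_def by (intro continuous_on_pull continuous_on_const cx)
  have cd: "continuous_on T (\<lambda>z. dip J (fst (snd z)) (snd (snd z)))" for T :: "homotopy_arg set"
    by (intro continuous_on_dip cx)
  have cv: "continuous_on T (\<lambda>z. v (fst z) (fst (snd z)) (snd (snd z)))" for T :: "homotopy_arg set"
    unfolding v_def by (intro continuous_on_diff continuous_on_mult continuous_on_divide continuous_on_const cx cd) auto
  have 1: "slice_homotopic n J (\<lambda>(x, s). f (g (cls n J x s))) (\<lambda>(x, s). H2 0 x s)"
  proof (rule homotopic_with_sliceI[where h = H1])
    let ?v = "\<lambda>z :: homotopy_arg. v (fst z) (fst (snd z)) (snd (snd z))"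
    have abs: "\<bar>3 * v t x s - 2\<bar> \<in> {0..1}" if "v t x s \<in> {0..1}" "1/3 \<le> v t x s" for t x s
      using that by (auto simp: abs_le_iff)
    have "continuous_map (top_of_set ({0..1} \<times> chamber n \<times> {0..1})) (stage n)
       (\<lambda>z. if ?v z \<le> 1/3 then cls n J' (k (fst (snd z))) (3 * ?v z)
          else if min (?v z - 2/3) (snd (snd z) - 1/2) \<le> 0 then cls n J (wall_point n) \<bar>3 * ?v z - 2\<bar>
          else cls n J (k (fst (snd z))) \<bar>3 * ?v z - 2\<bar>)"
    proof (intro continuous_map_cases_le_top_of_set cls_cont Jn ck wp cv)
      fix z :: homotopy_arg
      assume z: "z \<in> {0..1} \<times> chamber n \<times> {0..1}" "?v z = 1/3"
      then have *: "min (?v z - 2/3) (snd (snd z) - 1/2) \<le> 0" "3 * ?v z = 1" "\<bar>3 * ?v z - 2\<bar> = 1" by simp_all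
      show "cls n J' (k (fst (snd z))) (3 * ?v z) =
         (if min (?v z - 2/3) (snd (snd z) - 1/2) \<le> 0 then cls n J (wall_point n) \<bar>3 * ?v z - 2\<bar>
          else cls n J (k (fst (snd z))) \<bar>3 * ?v z - 2\<bar>)"
        unfolding if_P[OF *(1)] *(2,3)
        using cls_top[OF Jn(2) k, of "fst (snd z)"] cls_top[OF Jn(1) wp(1)] z(1) by (simp add: mem_Times_iff)
    next
      fix z :: homotopy_arg
      assume z: "z \<in> {z \<in> {0..1} \<times> chamber n \<times> {0..1}. 1/3 \<le> ?v z}" "min (?v z - 2/3) (snd (snd z) - 1/2) = 0"
      obtain t x s where zz: "z = (t, x, s)" by (cases z) auto
      have x: "t \<in> {0..1}" "x \<in> chamber n" "s \<in> {0..1}" "1/3 \<le> v t x s" using z(1) zz by auto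
      have "v t x s = 2/3 \<or> s = 1/2 \<and> v t x s > 2/3" using z(2) unfolding zz by auto
      then have "cls n J (wall_point n) \<bar>3 * v t x s - 2\<bar> = cls n J (k x) \<bar>3 * v t x s - 2\<bar>"
      proof (elim disjE conjE)
        assume "v t x s = 2/3"
        then have "\<bar>3 * v t x s - 2\<bar> = 0" by simp
        then show ?thesis using cls_bot[OF Jn(1) wp(1) k[OF x(2)]] by (simp only:)
      next
        assume h: "s = 1/2" "v t x s > 2/3"
        \<comment> \<open>With dip equal to 1, v would be 2 t/3, contrary to v > 2/3. Hence
          \<open>k x\<close> lies on a wall and may be exchanged for
          \<open>wall_point\<close>.\<close>
        have "dip J x (1/2) \<noteq> 1" using x(1) h(2) unfolding h(1) by (auto simp: v_def)
        then show ?thesis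
          by (intro cls_wall Jn wp k x dw abs v_unit)
      qed
      then show "cls n J (wall_point n) \<bar>3 * ?v z - 2\<bar> = cls n J (k (fst (snd z))) \<bar>3 * ?v z - 2\<bar>"
        by (simp add: zz)
    next
      fix z :: homotopy_arg
      assume "z \<in> {z \<in> {0..1} \<times> chamber n \<times> {0..1}. ?v z \<le> 1/3}"
      then have z: "fst z \<in> {0..1}" "fst (snd z) \<in> chamber n" "snd (snd z) \<in> {0..1}" "?v z \<le> 1/3" by auto
      show "k (fst (snd z)) \<in> chamber n" by (rule k[OF z(2)])
      show "3 * ?v z \<in> {0..1}" using v_unit[OF z(1-3)] z(4) by auto
    next
      fix z :: homotopy_arg
      assume "z \<in> {z \<in> {z \<in> {0..1} \<times> chamber n \<times> {0..1}. 1/3 \<le> ?v z}. min (?v z - 2/3) (snd (snd z) - 1/2) \<le> 0}"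
      then have z: "fst z \<in> {0..1}" "fst (snd z) \<in> chamber n" "snd (snd z) \<in> {0..1}" "1/3 \<le> ?v z" by auto
      show "\<bar>3 * ?v z - 2\<bar> \<in> {0..1}" by (rule abs[OF v_unit[OF z(1-3)] z(4)])
    next
      fix z :: homotopy_arg
      assume "z \<in> {z \<in> {z \<in> {0..1} \<times> chamber n \<times> {0..1}. 1/3 \<le> ?v z}. 0 \<le> min (?v z - 2/3) (snd (snd z) - 1/2)}"
      then have z: "fst z \<in> {0..1}" "fst (snd z) \<in> chamber n" "snd (snd z) \<in> {0..1}" "1/3 \<le> ?v z" by auto
      show "k (fst (snd z)) \<in> chamber n" by (rule k[OF z(2)])
      show "\<bar>3 * ?v z - 2\<bar> \<in> {0..1}" by (rule abs[OF v_unit[OF z(1-3)] z(4)])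
    qed (intro continuous_on_const cx cv continuous_on_min continuous_on_mult continuous_on_diff continuous_on_rabs)+
    then show "continuous_map (top_of_set ({0..1} \<times> chamber n \<times> {0..1})) (stage n) (\<lambda>(t, x, s). H1 t x s)"
      unfolding H1_def case_prod_unfold .
  next
    fix x s assume x: "x \<in> chamber n" and s: "s \<in> {0..1::real}"
    have v0: "v 0 x s = 1 - dip J x s" by (simp add: v_def)
    have v0u: "v 0 x s \<in> {0..1}" using v_unit[OF _ x s, of 0] by simp
    have kn: "0 \<le> k x n" using chamber_nonneg[of "k x" n] k[OF x] by (simp add: n_def)
    have ri: "k x \<in> chamber i" "reflect n (k x) \<in> chamber i"
      using k[OF x] chamber_Suc reflect_in[OF _ i] by (auto simp: n_def)
    have fr: "fold_coord n (k x) = k x" "fold_coord n (reflect n (k x)) = k x"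
      using kn by (simp_all add: fold_coord_reflect fold_coord_id)
    have g': "g (cls n J x s) = gather (J, x, s)" using g[OF J(1) _ s] x by (simp add: n_def)
    have sp: "spread (A, z, r) = (if r \<le> 1/3 then cls n A (fold_coord n z) (3 * r)
        else if min (r - 2/3) (- z n) \<le> 0 then cls n (insert n A) (wall_point n) \<bar>3 * r - 2\<bar>
        else cls n (insert n A) (fold_coord n z) \<bar>3 * r - 2\<bar>)" for A z r
      unfolding spread_def n_def prod.case ..
    show "H1 0 x s = (case (x, s) of (x, s) \<Rightarrow> f (g (cls n J x s)))"
    proof (cases "s \<le> 1/2")
      case True
      have gk: "g (cls n J x s) = cls i J' (k x) (v 0 x s)"
        unfolding g' using True J(2) by (simp add: gather_def v0 k_def J'_def n_def)
      have "f (g (cls n J x s)) = spread (J', k x, v 0 x s)"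
        unfolding gk by (rule f[OF Ji ri(1) v0u])
      moreover have "min (v 0 x s - 2/3) (- k x n) \<le> 0" "min (v 0 x s - 2/3) (s - 1/2) \<le> 0"
        using kn True by auto
      ultimately show ?thesis
        by (simp add: H1_def sp fr ins)
    next
      case False
      have gk: "g (cls n J x s) = cls i J' (reflect n (k x)) (v 0 x s)"
        unfolding g' using False J(2) by (simp add: gather_def v0 k_def J'_def n_def)
      have e: "f (g (cls n J x s)) = spread (J', reflect n (k x), v 0 x s)"
        unfolding gk by (rule f[OF Ji ri(2) v0u])
      have rn: "- reflect n (k x) n = k x n" by (simp add: reflect_def)
      consider "v 0 x s \<le> 1/3" | "\<not> v 0 x s \<le> 1/3" "v 0 x s \<le> 2/3" | "\<not> v 0 x s \<le> 2/3" "k x n = 0"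
        | "\<not> v 0 x s \<le> 2/3" "k x n > 0" using kn by fastforce
      then show ?thesis
      proof cases
        case 1
        then show ?thesis by (simp add: e H1_def sp fr)
      next
        case 2
        then have "min (v 0 x s - 2/3) (- reflect n (k x) n) \<le> 0" "min (v 0 x s - 2/3) (s - 1/2) \<le> 0" by auto
        then show ?thesis using 2 by (simp add: e H1_def sp ins)
      next
        case 3
        then have m: "min (v 0 x s - 2/3) (- reflect n (k x) n) \<le> 0" "\<not> min (v 0 x s - 2/3) (s - 1/2) \<le> 0"
          "\<not> v 0 x s \<le> 1/3" using False by (auto simp: rn)
        have "k x \<in> walls J" using 3(2) nJ by (auto simp: walls_def)
        moreover have "\<bar>3 * v 0 x s - 2\<bar> \<in> {0..1}" using v0u m(3) by (auto simp: abs_le_iff)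
        ultimately have "cls n J (wall_point n) \<bar>3 * v 0 x s - 2\<bar> = cls n J (k x) \<bar>3 * v 0 x s - 2\<bar>"
          by (intro cls_wall Jn wp k x)
        then show ?thesis using m by (simp add: e H1_def sp fr ins)
      next
        case 4
        then have "\<not> min (v 0 x s - 2/3) (- reflect n (k x) n) \<le> 0" "\<not> min (v 0 x s - 2/3) (s - 1/2) \<le> 0"
          "\<not> v 0 x s \<le> 1/3" using False by (auto simp: rn)
        then show ?thesis by (simp add: e H1_def sp fr ins)
      qed
    qed
    have v1: "v 1 x s = 1 - dip J x s / 3" by (simp add: v_def)
    have dd: "0 \<le> dip J x s" "dip J x s \<le> 1" using d[OF x s] by auto
    have e1: "\<bar>3 * v 1 x s - 2\<bar> = 1 - dip J x s" "\<not> v 1 x s \<le> 1/3" using dd by (auto simp: v1)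
    have e3: "H1 1 x s = (if min (v 1 x s - 2/3) (s - 1/2) \<le> 0 then cls n J (wall_point n) (1 - dip J x s)
        else cls n J (k x) (1 - dip J x s))"
      unfolding H1_def if_not_P[OF e1(2)] e1(1) ..
    have e2: "w' 0 x s = 1 - dip J x s" "w 0 x s = 1 - dip J x s" by (simp_all add: w_def w'_def)
    show "H1 1 x s = (case (x, s) of (x, s) \<Rightarrow> H2 0 x s)"
    proof (cases "s \<le> 1/2")
      case True
      then have "min (v 1 x s - 2/3) (s - 1/2) \<le> 0" by auto
      then show ?thesis using True by (simp add: e3 H2_def e2)
    next
      case False
      show ?thesis
      proof (cases "dip J x s = 1")
        \<comment> \<open>Here v is exactly 2/3, so \<open>H1\<close> uses \<open>wall_point\<close>
          where \<open>H2\<close> uses \<open>k x\<close>; the height is 0, and both are the lower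
          pole.\<close>
        case True
        then show ?thesis
          using False cls_bot[OF Jn(1) wp(1) k[OF x]] by (simp add: e3 H2_def e2)
      next
        case d1: False
        then have "\<not> min (v 1 x s - 2/3) (s - 1/2) \<le> 0" using dd False by (auto simp: v1)
        then show ?thesis using False by (simp add: e3 H2_def e2)
      qed
    qed
  next
    fix t :: real assume t: "t \<in> {0..1}"
    have H1_base: "H1 t x s = base n" if "x \<in> chamber n" "dip J x s = 0" for x s
      using cls_top[OF Jn(1) wp(1)] cls_top[OF Jn(1) k[OF that(1)]] that(2) by (simp add: H1_def v_def)
    show "slice_compatible (chamber n) (walls J) (base n) (\<lambda>(x, s). H1 t x s)"
      by (intro slice_compatibleI) (simp_all add: H1_base d0 d01)
  qed
  have 2: "slice_homotopic n J (\<lambda>(x, s). H2 0 x s) (\<lambda>(x, s). H3 0 x s)"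
  proof (rule homotopic_with_sliceI[where h = H2])
    have "continuous_map (top_of_set ({0..1} \<times> chamber n \<times> {0..1})) (stage n)
       (\<lambda>z :: homotopy_arg. if snd (snd z) \<le> 1/2
          then cls n J (wall_point n) (w' (fst z) (fst (snd z)) (snd (snd z)))
          else cls n J (k (fst (snd z))) (w (fst z) (fst (snd z)) (snd (snd z))))"
    proof (intro continuous_map_cases_le_top_of_set cls_cont Jn ck wp cx)
      fix z :: homotopy_arg
      assume z: "z \<in> {0..1} \<times> chamber n \<times> {0..1}" "snd (snd z) = 1/2"
      obtain t x where zz: "z = (t, x, 1/2)" using z(2) by (cases z) auto
      have x: "t \<in> {0..1}" "x \<in> chamber n" "1/2 \<in> {0..1::real}" using z(1) zz by auto
      have ww: "w t x (1/2) = w' t x (1/2)" by (simp add: w_def w'_def)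
      have "cls n J (wall_point n) (w' t x (1/2)) = cls n J (k x) (w' t x (1/2))"
      proof (cases "dip J x (1/2) = 1")
        case True
        then have "w' t x (1/2) = 0" by (simp add: w'_def)
        then show ?thesis using cls_bot[OF Jn(1) wp(1) k[OF x(2)]] by simp
      next
        case False
        then show ?thesis by (intro cls_wall Jn wp k x dw w'_unit)
      qed
      then show "cls n J (wall_point n) (w' (fst z) (fst (snd z)) (snd (snd z))) =
          cls n J (k (fst (snd z))) (w (fst z) (fst (snd z)) (snd (snd z)))"
        by (simp add: zz ww)
    next
      fix z :: homotopy_arg
      assume "z \<in> {z \<in> {0..1} \<times> chamber n \<times> {0..1}. snd (snd z) \<le> 1/2}"
      then have z: "fst z \<in> {0..1}" "fst (snd z) \<in> chamber n" "snd (snd z) \<in> {0..1}" by auto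
      show "w' (fst z) (fst (snd z)) (snd (snd z)) \<in> {0..1}" by (rule w'_unit[OF z])
    next
      fix z :: homotopy_arg
      assume "z \<in> {z \<in> {0..1} \<times> chamber n \<times> {0..1}. 1/2 \<le> snd (snd z)}"
      then have z: "fst z \<in> {0..1}" "fst (snd z) \<in> chamber n" "snd (snd z) \<in> {0..1}" "1/2 \<le> snd (snd z)" by auto
      show "k (fst (snd z)) \<in> chamber n" by (rule k[OF z(2)])
      show "w (fst z) (fst (snd z)) (snd (snd z)) \<in> {0..1}" by (rule w_unit[OF z])
    qed (unfold w_def w'_def, (intro continuous_on_const cx continuous_on_mult continuous_on_add continuous_on_diff cd)+)
    then show "continuous_map (top_of_set ({0..1} \<times> chamber n \<times> {0..1})) (stage n) (\<lambda>(t, x, s). H2 t x s)"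
      unfolding H2_def case_prod_unfold .
  next
    fix x s assume x: "x \<in> chamber n" and s: "s \<in> {0..1::real}"
    show "H2 1 x s = (case (x, s) of (x, s) \<Rightarrow> H3 0 x s)"
    proof (cases "s \<le> 1/2")
      case True
      then have "u 0 s = 0" "w' 1 x s = 0" by (auto simp: u_def w'_def)
      then show ?thesis
        using True cls_bot[OF Jn(1) wp(1) k[OF x]] by (simp add: H2_def H3_def k_def)
    next
      case False
      then have "u 0 s = 2 * s - 1" "w 1 x s = 2 * s - 1" by (auto simp: u_def w_def)
      then show ?thesis using False by (simp add: H2_def H3_def k_def)
    qed
  next
    fix t :: real assume t: "t \<in> {0..1}"
    show "slice_compatible (chamber n) (walls J) (base n) (\<lambda>(x, s). H2 t x s)"
    proof (rule slice_compatibleI)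
      show "(\<lambda>(x, s). H2 t x s) (x, 1) = base n" if "x \<in> chamber n" for x
        using cls_top[OF Jn(1) k[OF that]] by (simp add: H2_def w_def d01)
      show "(\<lambda>(x, s). H2 t x s) (x, 0) = (\<lambda>(x, s). H2 t x s) (x', 0)" if "x \<in> chamber n" "x' \<in> chamber n" for x x'
        by (simp add: H2_def w'_def d01)
      show "(\<lambda>(x, s). H2 t x s) (x, s) = (\<lambda>(x, s). H2 t x s) (x', s)"
        if x: "x \<in> chamber n" "x \<in> walls J" "x' \<in> chamber n" "x' \<in> walls J" "s \<in> {0..1}" for x x' s
      proof (cases "s \<le> 1/2")
        case True
        then show ?thesis by (simp add: H2_def w'_def d0 x)
      next
        case False
        then have "1/2 \<le> s" by simp
        have kw: "k y \<in> walls J" if "y \<in> walls J" for y unfolding k_def by (rule pull_walls[OF that])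
        have "w t x s = w t x' s" by (simp add: w_def d0 x)
        moreover have "cls n J (k x) (w t x' s) = cls n J (k x') (w t x' s)"
          by (intro cls_wall Jn k kw x w_unit t \<open>1/2 \<le> s\<close>)
        ultimately show ?thesis using False by (simp add: H2_def)
      qed
    qed
  qed auto
  have 3: "slice_homotopic n J (\<lambda>(x, s). H3 0 x s) (\<lambda>(x, s). cls n J x s)"
  proof (rule moving_slice_homotopic[where p = "\<lambda>t. pull J (1 - t)" and h = "\<lambda>t x. u t"])
    show "continuous_on ({0..1} \<times> chamber n \<times> {0..1}) (\<lambda>z :: homotopy_arg. u (fst z) (snd (snd z)))"
      unfolding u_def by (intro continuous_intros)
    show "continuous_on ({0..1} \<times> chamber n \<times> {0..1}) (\<lambda>z :: homotopy_arg. pull J (1 - fst z) (fst (snd z)))"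
      by (intro continuous_on_pull continuous_on_diff continuous_on_const cx)
  qed (use Jn pull pull_walls u_unit in \<open>auto simp: u_def H3_def\<close>)
  show ?thesis
    using homotopic_with_trans[OF homotopic_with_trans[OF 1 2] 3] unfolding n_def .
qed

lemma stage_step: "stage i homotopy_equivalent_space stage (Suc i)"
proof -
  have sc: "continuous_map (top_of_set (chamber i \<times> {0..1})) (stage (Suc i)) (\<lambda>z. spread (J, z))"
    "slice_compatible (chamber i) (walls J) (base (Suc i)) (\<lambda>z. spread (J, z))" if "J \<in> Pow {1..i}" for J
    using that spread_cont spread_compatible by auto
  obtain f where f: "continuous_map (stage i) (stage (Suc i)) f"
    "\<And>J x s. J \<in> Pow {1..i} \<Longrightarrow> x \<in> chamber i \<Longrightarrow> s \<in> {0..1} \<Longrightarrow> f (cls i J x s) = spread (J, x, s)"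
    unfolding cls_def stage_def[of i] by (rule suspension_wedge_lift[OF sc]) (assumption+, rule that[unfolded cls_def stage_def[of i]])
  have gc: "continuous_map (top_of_set (chamber (Suc i) \<times> {0..1})) (stage i) (\<lambda>z. gather (J, z))"
    "slice_compatible (chamber (Suc i)) (walls J) (base i) (\<lambda>z. gather (J, z))" if "J \<in> Pow {1..Suc i}" for J
    using that gather_cont gather_compatible by auto
  obtain g where g: "continuous_map (stage (Suc i)) (stage i) g"
    "\<And>J x s. J \<in> Pow {1..Suc i} \<Longrightarrow> x \<in> chamber (Suc i) \<Longrightarrow> s \<in> {0..1} \<Longrightarrow> g (cls (Suc i) J x s) = gather (J, x, s)"
    unfolding cls_def stage_def[of "Suc i"] by (rule suspension_wedge_lift[OF gc]) (assumption+, rule that[unfolded cls_def stage_def[of "Suc i"]])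
  have f2: "f (cls i J x s) = spread (J, x, s)" if "J \<subseteq> {1..i}" "x \<in> chamber i" "s \<in> {0..1}" for J x s
    using f(2) that by blast
  have g2: "g (cls (Suc i) J x s) = gather (J, x, s)" if "J \<subseteq> {1..Suc i}" "x \<in> chamber (Suc i)" "s \<in> {0..1}" for J x s
    using g(2) that by blast
  have gf: "slice_homotopic i J (\<lambda>(x, s). g (f (cls i J x s))) (\<lambda>(x, s). cls i J x s)" if "J \<in> Pow {1..i}" for J
    using that by (intro gather_spread_homotopic f2 g2) auto
  have fg: "slice_homotopic (Suc i) J
     (\<lambda>(x, s). f (g (cls (Suc i) J x s))) (\<lambda>(x, s). cls (Suc i) J x s)" if "J \<in> Pow {1..Suc i}" for J
  proof (cases "Suc i \<in> J")
    case True
    then show ?thesis using that by (intro spread_gather_homotopic_new f2 g2) auto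
  next
    case False
    then have "J \<subseteq> {1..i}" using that by (auto simp: le_Suc_eq)
    then show ?thesis by (intro spread_gather_homotopic_old f2 g2)
  qed
  show ?thesis
    unfolding stage_def
    by (rule suspension_wedge_homotopy_equivalent[OF f(1)[unfolded stage_def] g(1)[unfolded stage_def]
          gf[unfolded stage_def cls_def] fg[unfolded stage_def cls_def]])
qed

end

end

section \<open>Full subcomplexes\<close>

lemma suspension_pole_eq:
  assumes "x \<in> topspace X"
  shows "suspension_pole X = suspension_rel X `` {(x, 1)}"
  using assms by (auto simp: suspension_pole_def suspension_rel_def)

lemma quotient_map_wedge:
  assumes "I \<noteq> {}"
  shows "quotient_map (sum_topology X I) (wedge X b I) (\<lambda>z. wedge_rel X b I `` {z})"
  using assms by (simp add: wedge_def quotient_map_quotient_topology)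

lemma continuous_map_into_wedge:
  assumes "J \<in> I"
  shows "continuous_map (X J) (wedge X b I) (\<lambda>p. wedge_rel X b I `` {(J, p)})"
proof -
  have "I \<noteq> {}" using assms by blast
  from continuous_map_compose[OF continuous_map_component_injection[OF assms]
      quotient_imp_continuous_map[OF quotient_map_wedge[OF this]]]
  show ?thesis by (simp add: o_def)
qed

lemma wedge_base_eq:
  assumes "J \<in> I" "J' \<in> I" "b J \<in> topspace (X J)" "b J' \<in> topspace (X J')"
  shows "wedge_rel X b I `` {(J, b J)} = wedge_rel X b I `` {(J', b J')}"
  by (rule equiv_class_eq[OF equiv_wedge_rel]) (use assms in \<open>simp add: wedge_rel_def\<close>)

lemma wedge_lift:
  assumes I: "I \<noteq> {}"
    and k: "\<And>J. J \<in> I \<Longrightarrow> continuous_map (X J) Y (k J)" "\<And>J. J \<in> I \<Longrightarrow> k J (b J) = c"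
  obtains g where "continuous_map (wedge X b I) Y g"
    "\<And>J p. J \<in> I \<Longrightarrow> p \<in> topspace (X J) \<Longrightarrow> g (wedge_rel X b I `` {(J, p)}) = k J p"
proof -
  have "continuous_map (sum_topology X I) Y (\<lambda>(J, p). k J p)"
    by (rule continuous_map_sum_topology) (simp add: k(1))
  moreover have fib: "(\<lambda>(J, p). k J p) z = (\<lambda>(J, p). k J p) z'"
    if "z \<in> topspace (sum_topology X I)" "z' \<in> topspace (sum_topology X I)"
      "wedge_rel X b I `` {z} = wedge_rel X b I `` {z'}" for z z'
  proof -
    have "(z, z') \<in> wedge_rel X b I"
      using eq_equiv_class_iff[OF equiv_wedge_rel that(1,2)] that(3) by blast
    then have "z = z' \<or> snd z = b (fst z) \<and> snd z' = b (fst z')"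
      by (simp add: wedge_rel_def)
    moreover have "fst z \<in> I" "fst z' \<in> I" using that(1,2) by auto
    ultimately show ?thesis using k(2) by (auto simp: case_prod_unfold)
  qed
  ultimately obtain g where g: "continuous_map (wedge X b I) Y g"
    "\<And>z. z \<in> topspace (sum_topology X I) \<Longrightarrow> g (wedge_rel X b I `` {z}) = (\<lambda>(J, p). k J p) z"
    by (rule quotient_map_lift_exists[OF quotient_map_wedge[OF I]]) (assumption+, rule that)
  have "g (wedge_rel X b I `` {(J, p)}) = k J p" if "J \<in> I" "p \<in> topspace (X J)" for J p
    using g(2)[of "(J, p)"] that by simp
  then show ?thesis by (rule that[OF g(1)])
qed

lemma topspace_suspension:
  "topspace (suspension X) = (\<lambda>z. suspension_rel X `` {z}) ` (topspace X \<times> {0..1})"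
  using quotient_imp_surjective_map[OF quotient_map_suspension[of X]] by simp

lemma locally_compact_unit_interval: "locally_compact_space (top_of_set {0..1::real})"
  by (intro compact_imp_locally_compact_space compact_space_subtopology) simp

text \<open>Crossing the inner quotient map with an interval keeps it a quotient map. A map out of
  the double suspension can thus be defined by one formula in a point and two heights.\<close>

lemma quotient_map_double_suspension:
  "quotient_map (prod_topology (prod_topology X (top_of_set {0..1})) (top_of_set {0..1}))
     (suspension (suspension X))
     (\<lambda>z. suspension_rel (suspension X) `` {(suspension_rel X `` {fst z}, snd z)})"
proof -
  have "quotient_map (prod_topology (prod_topology X (top_of_set {0..1})) (top_of_set {0..1::real}))
      (prod_topology (suspension X) (top_of_set {0..1})) (\<lambda>(z, s). (suspension_rel X `` {z}, s))"
    by (intro quotient_map_prod_left locally_compact_unit_interval disjI1 quotient_map_suspension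
        Hausdorff_space_subtopology) simp
  from quotient_map_compose[OF this quotient_map_suspension[of "suspension X"]]
  show ?thesis by (simp add: o_def case_prod_unfold)
qed

section \<open>Contracting the cylinders of faces, flattening the others\<close>

context spanning_complex
begin

text \<open>At t = 0 this retracts the chamber onto the part that is 1 outside J. Coordinates in J
  are untouched, so walls of J stay walls of J.\<close>

definition flatten :: "nat set \<Rightarrow> real \<Rightarrow> (nat \<Rightarrow> real) \<Rightarrow> nat \<Rightarrow> real" where
  "flatten J t x = (\<lambda>j\<in>{1..m}. if j \<in> J then x j else (1 - t) + t * x j)"

definition to_corner :: "nat set \<Rightarrow> real \<Rightarrow> (nat \<Rightarrow> real) \<Rightarrow> nat \<Rightarrow> real" where
  "to_corner J t x = (\<lambda>j\<in>{1..m}. if j \<in> J then t * x j else 1)"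

lemma chamber_m_bounds:
  assumes "x \<in> chamber m" "j \<in> {1..m}"
  shows "0 \<le> x j" "x j \<le> 1"
  using chamber_bounds[OF assms(1,2)] assms(2) by auto

lemma flatten_in:
  assumes x: "x \<in> chamber m" and t: "t \<in> {0..1}"
  shows "flatten J t x \<in> chamber m"
proof -
  have "0 \<le> flatten J t x j \<and> flatten J t x j \<le> 1 \<and> (x j = 1 \<longrightarrow> flatten J t x j = 1)" if "j \<in> {1..m}" for j
  proof -
    note xj = chamber_m_bounds[OF x that]
    have "(1 - t) * 1 + t * x j \<in> {0..1}" using unit_interval_convex[OF t, of 1 "x j"] xj by simp
    then show ?thesis using xj that by (auto simp: flatten_def)
  qed
  then show ?thesis
    by (intro chamber_mono[OF chamber_moment_angle(1)[OF x]])
      (use chamber_m_bounds[OF x] in \<open>force simp: flatten_def\<close>)+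
qed

text \<open>All coordinates in J may be free simultaneously because J is a face; hence they can be
  scaled to 0 together.\<close>

lemma to_corner_in:
  assumes x: "x \<in> chamber m" and J: "J \<in> K" and t: "t \<in> {0..1}"
  shows "to_corner J t x \<in> chamber m"
proof -
  have b: "0 \<le> to_corner J t x j \<and> to_corner J t x j \<le> 1" if "j \<in> {1..m}" for j
    using unit_interval_mult[OF t, of "x j"] chamber_m_bounds[OF x that] that by (auto simp: to_corner_def)
  have "{j\<in>{1..m}. \<bar>to_corner J t x j\<bar> \<noteq> 1} \<subseteq> J" by (auto simp: to_corner_def)
  from face_down[OF J this] b show ?thesis
    by (auto simp: chamber_def moment_angle_set_def to_corner_def)
qed

lemma flatten_walls: "J \<subseteq> {1..m} \<Longrightarrow> x \<in> walls J \<Longrightarrow> flatten J t x \<in> walls J"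
  by (fastforce simp: walls_def flatten_def)

lemma to_corner_walls: "J \<subseteq> {1..m} \<Longrightarrow> x \<in> walls J \<Longrightarrow> to_corner J t x \<in> walls J"
  by (fastforce simp: walls_def to_corner_def)

lemma continuous_on_flatten:
  assumes "continuous_on T t" "continuous_on T f"
  shows "continuous_on T (\<lambda>z. flatten J (t z) (f z))"
proof (rule continuous_on_coordinatewise_then_product)
  fix j
  show "continuous_on T (\<lambda>z. flatten J (t z) (f z) j)"
    using continuous_on_coordinate[OF assms(2), of j] assms(1)
    by (cases "j \<in> {1..m}"; cases "j \<in> J") (auto simp: flatten_def intro!: continuous_on_add continuous_on_mult continuous_on_diff)
qed

lemma continuous_on_to_corner:
  assumes "continuous_on T t" "continuous_on T f"
  shows "continuous_on T (\<lambda>z. to_corner J (t z) (f z))"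
proof (rule continuous_on_coordinatewise_then_product)
  fix j
  show "continuous_on T (\<lambda>z. to_corner J (t z) (f z) j)"
    using continuous_on_coordinate[OF assms(2), of j] assms(1)
    by (cases "j \<in> {1..m}"; cases "j \<in> J") (auto simp: to_corner_def intro!: continuous_on_mult)
qed

lemma flatten_homotopic:
  assumes J: "J \<subseteq> {1..m}"
  shows "slice_homotopic m J (\<lambda>(x, s). cls m J (flatten J 0 x) s) (\<lambda>(x, s). cls m J x s)"
proof (rule moving_slice_homotopic[where p = "flatten J" and h = "\<lambda>t x s. s"])
  show "continuous_on ({0..1} \<times> chamber m \<times> {0..1}) (\<lambda>z :: homotopy_arg. flatten J (fst z) (fst (snd z)))"
    by (intro continuous_on_flatten continuous_on_fst continuous_on_snd continuous_on_id)
  have "flatten J 1 x = x" if "x \<in> chamber m" for x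
    using chamber_moment_angle(2)[OF that] by (auto simp: flatten_def extensional_def)
  then show "(case (x, s) of (x, s) \<Rightarrow> cls m J x s) = cls m J (flatten J 1 x) s" if "x \<in> chamber m" for x s
    using that by simp
qed (use J flatten_in flatten_walls in \<open>auto intro!: continuous_intros\<close>)

text \<open>Read backwards: x is flattened outside J, then scaled into the corner with zeros on J
  and ones elsewhere, and the arc left over this single corner is drawn up to the pole at height 1.
  The last motion lifts the lower pole, which is possible because the point no longer depends on
  x.\<close>

lemma contract_homotopic:
  assumes J: "J \<in> K"
  shows "slice_homotopic m J (\<lambda>(x, s). base m) (\<lambda>(x, s). cls m J x s)"
proof -
  have Jm: "J \<subseteq> {1..m}" by (rule face_subset[OF J])
  have corner: "to_corner J 0 x = to_corner J 0 x'" for x x' by (auto simp: to_corner_def fun_eq_iff)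
  have 1: "slice_homotopic m J (\<lambda>(x, s). base m) (\<lambda>(x, s). cls m J (to_corner J 0 x) s)"
  proof (rule moving_slice_homotopic[where p = "\<lambda>t. to_corner J 0" and h = "\<lambda>t x s. (1 - t) * 1 + t * s"])
    show "continuous_on ({0..1} \<times> chamber m \<times> {0..1}) (\<lambda>z :: homotopy_arg. to_corner J 0 (fst (snd z)))"
      by (intro continuous_on_to_corner continuous_on_const continuous_on_fst continuous_on_snd continuous_on_id)
    show "(1 - t) * 1 + t * s \<in> {0..1}" if "t \<in> {0..1}" "s \<in> {0..1}" for t s :: real
      using unit_interval_convex[of t 1 s] that by simp
    show "(1 - t) * 1 + t * 0 = (1 - t) * 1 + t * 0 \<and> ((1 - t) * 1 + t * 0 = 0 \<or> to_corner J 0 x = to_corner J 0 x')"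
      for t :: real and x x' using corner by blast
  qed (use Jm J to_corner_in to_corner_walls cls_top in \<open>auto intro!: continuous_intros\<close>)
  have 2: "slice_homotopic m J (\<lambda>(x, s). cls m J (to_corner J 0 x) s) (\<lambda>(x, s). cls m J (to_corner J 1 x) s)"
  proof (rule moving_slice_homotopic[where p = "to_corner J" and h = "\<lambda>t x s. s"])
    show "continuous_on ({0..1} \<times> chamber m \<times> {0..1}) (\<lambda>z :: homotopy_arg. to_corner J (fst z) (fst (snd z)))"
      by (intro continuous_on_to_corner continuous_on_fst continuous_on_snd continuous_on_id)
  qed (use Jm J to_corner_in to_corner_walls in \<open>auto intro!: continuous_intros\<close>)
  have "to_corner J 1 x = flatten J 0 x" for x by (auto simp: to_corner_def flatten_def fun_eq_iff)
  with 2 have 3: "slice_homotopic m J (\<lambda>(x, s). cls m J (to_corner J 0 x) s) (\<lambda>(x, s). cls m J (flatten J 0 x) s)"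
    by simp
  show ?thesis
    by (rule homotopic_with_trans[OF 1 homotopic_with_trans[OF 3 flatten_homotopic[OF Jm]]])
qed

text \<open>Packages the homotopies of this part, so that for concrete f and g only strict equations
  remain: one composite collapses the cylinders of faces and flattens the rest, the other is the
  identity.\<close>

lemma stage_homotopy_equivalent:
  assumes f: "continuous_map (stage m) W f" and g: "continuous_map W (stage m) g"
    and gf: "\<And>J x s. J \<subseteq> {1..m} \<Longrightarrow> x \<in> chamber m \<Longrightarrow> s \<in> {0..1} \<Longrightarrow>
       g (f (cls m J x s)) = (if J \<in> K then base m else cls m J (flatten J 0 x) s)"
    and fg: "\<And>w. w \<in> topspace W \<Longrightarrow> f (g w) = w"
  shows "stage m homotopy_equivalent_space W"
proof -
  have slice: "slice_homotopic m J (\<lambda>(x, s). g (f (cls m J x s))) (\<lambda>(x, s). cls m J x s)" if "J \<in> Pow {1..m}" for J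
  proof (cases "J \<in> K")
    case True
    show ?thesis
      by (rule homotopic_with_eq[OF contract_homotopic[OF True]])
        (use gf[of J] that True in \<open>auto simp: slice_compatible_def\<close>)
  next
    case False
    have J: "J \<subseteq> {1..m}" using that by blast
    show ?thesis
      by (rule homotopic_with_eq[OF flatten_homotopic[OF J]])
        (use gf[OF J] False in \<open>auto simp: slice_compatible_def\<close>)
  qed
  have "homotopic_with (\<lambda>_. True) (stage m) (stage m) (g \<circ> f) id"
    unfolding stage_def
  proof (rule homotopic_with_quotient_lift[OF quotient_map_suspension_wedge])
    show "homotopic_with (fibrewise_constant (cylinders (Pow {1..m}) (chamber m))
        (\<lambda>(J, x, s). wedge_class (Pow {1..m}) (chamber m) walls J x s))
        (cylinders (Pow {1..m}) (chamber m)) (suspension_wedge (Pow {1..m}) (chamber m) walls)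
        (g \<circ> f \<circ> (\<lambda>(J, x, s). wedge_class (Pow {1..m}) (chamber m) walls J x s))
        (id \<circ> (\<lambda>(J, x, s). wedge_class (Pow {1..m}) (chamber m) walls J x s))"
      by (rule homotopic_with_slices[where b = "base m"])
        (use slice in \<open>simp add: case_prod_unfold cls_def stage_def\<close>)
  qed
  moreover have "homotopic_with (\<lambda>_. True) W W (f \<circ> g) id"
    by (rule homotopic_with_equal) (simp_all add: continuous_map_compose[OF g f] fg)
  ultimately show ?thesis
    unfolding homotopy_equivalent_space_def using f g by blast
qed

end

lemma continuous_on_Max:
  fixes f :: "'i \<Rightarrow> 'a::topological_space \<Rightarrow> real"
  assumes "finite J" "J \<noteq> {}" "\<And>j. j \<in> J \<Longrightarrow> continuous_on T (f j)"
  shows "continuous_on T (\<lambda>z. Max ((\<lambda>j. f j z) ` J))"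
  using assms
proof (induction J rule: finite_ne_induct)
  case (insert j J)
  then have "continuous_on T (\<lambda>z. max (f j z) (Max ((\<lambda>j. f j z) ` J)))"
    by (intro continuous_on_max) auto
  then show ?case using insert.hyps by simp
qed simp

section \<open>Cone coordinates on the flat part of the chamber\<close>

context spanning_complex
begin

definition simplex_points :: "nat set \<Rightarrow> (nat \<Rightarrow> real) set" where
  "simplex_points J = realization_set (full_subcomplex K J)"

text \<open>The part of the chamber that is flat outside \<open>J\<close> is the cone over the realization of the full
  subcomplex on \<open>J\<close>: the cone point is \<open>one\<close>, and \<open>h\<close> is the largest value of \<open>1 - x j\<close>.\<close>

definition ray :: "nat set \<Rightarrow> (nat \<Rightarrow> real) \<times> real \<Rightarrow> nat \<Rightarrow> real" where
  "ray J = (\<lambda>(\<theta>, h). \<lambda>j\<in>{1..m}. if j \<in> J then 1 - h * (\<theta> j / Max (\<theta> ` J)) else 1)"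

definition flat :: "nat set \<Rightarrow> (nat \<Rightarrow> real) set" where
  "flat J = {x \<in> chamber m. \<forall>j\<in>{1..m} - J. x j = 1}"

lemma realization_eq: "realization (full_subcomplex K J) = top_of_set (simplex_points J)"
  by (simp add: realization_def simplex_points_def euclidean_product_topology)

context
  fixes J :: "nat set"
  assumes J: "J \<subseteq> {1..m}" and J0: "J \<noteq> {}"
begin

lemma finite_J: "finite J"
  using finite_subset[OF J] by simp

lemma mem_simplex_points:
  "\<theta> \<in> simplex_points J \<longleftrightarrow>
     (\<forall>v. 0 \<le> \<theta> v) \<and> {v. \<theta> v \<noteq> 0} \<in> K \<and> {v. \<theta> v \<noteq> 0} \<subseteq> J \<and> (\<Sum>v\<in>J. \<theta> v) = 1"
proof -
  have "full_subcomplex K J = {\<sigma> \<in> K. \<sigma> \<subseteq> J}"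
    unfolding full_subcomplex_def using face_down by (auto intro!: image_eqI)
  moreover have "(\<Sum>v | \<theta> v \<noteq> 0. \<theta> v) = (\<Sum>v\<in>J. \<theta> v)" if "{v. \<theta> v \<noteq> 0} \<subseteq> J"
    by (rule sum_support[OF finite_J that])
  ultimately show ?thesis
    by (auto simp: simplex_points_def realization_set_def)
qed

text \<open>Having its support in K is not visibly a closed condition, but having it inside a given
  face is, and there are finitely many faces; the union then lies in a compact cube. Compactness
  makes \<open>ray\<close> a quotient map.\<close>

lemma compact_simplex_points: "compact (simplex_points J)"
proof -
  define A where "A = (\<lambda>\<sigma>. {\<theta> :: nat \<Rightarrow> real. (\<forall>v. 0 \<le> \<theta> v) \<and> (\<forall>v\<in>- \<sigma>. \<theta> v = 0) \<and> (\<Sum>v\<in>J. \<theta> v) = 1})"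
  have cont: "continuous_on UNIV (\<lambda>\<theta>. \<theta> v)" for v :: nat
    by (rule continuous_on_product_coordinates)
  have cont_sum: "continuous_on UNIV (\<lambda>\<theta> :: nat \<Rightarrow> real. \<Sum>v\<in>J. \<theta> v)"
    by (intro continuous_on_sum cont)
  have "closed (A \<sigma>)" for \<sigma>
    unfolding A_def Ball_def
    by (intro closed_Collect_conj closed_Collect_all closed_Collect_imp closed_Collect_le closed_Collect_eq
        open_Collect_const continuous_on_const cont cont_sum)
  moreover have "simplex_points J = (\<Union>\<sigma>\<in>{\<sigma> \<in> K. \<sigma> \<subseteq> J}. A \<sigma>)"
  proof (intro equalityI subsetI)
    fix \<theta> assume "\<theta> \<in> simplex_points J"
    then show "\<theta> \<in> (\<Union>\<sigma>\<in>{\<sigma> \<in> K. \<sigma> \<subseteq> J}. A \<sigma>)"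
      unfolding mem_simplex_points by (intro UN_I[of "{v. \<theta> v \<noteq> 0}"]) (auto simp: A_def)
  next
    fix \<theta> assume "\<theta> \<in> (\<Union>\<sigma>\<in>{\<sigma> \<in> K. \<sigma> \<subseteq> J}. A \<sigma>)"
    then obtain \<sigma> where \<sigma>: "\<sigma> \<in> K" "\<sigma> \<subseteq> J" "\<theta> \<in> A \<sigma>" by blast
    then have "{v. \<theta> v \<noteq> 0} \<subseteq> \<sigma>" by (auto simp: A_def)
    then show "\<theta> \<in> simplex_points J"
      unfolding mem_simplex_points using \<sigma> face_down[OF \<sigma>(1)] by (auto simp: A_def)
  qed
  ultimately have "closed (simplex_points J)"
    using finite_complex by (simp add: closed_UN)
  moreover have "compact (PiE UNIV (\<lambda>_ :: nat. {0..1 :: real}))"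
    using compactin_PiE[of "\<lambda>_. euclideanreal" UNIV "\<lambda>_ :: nat. {0..1}"]
    by (simp add: euclidean_product_topology)
  moreover have "simplex_points J \<subseteq> PiE UNIV (\<lambda>_ :: nat. {0..1 :: real})"
  proof
    fix \<theta> assume \<theta>: "\<theta> \<in> simplex_points J"
    have "\<theta> v \<le> 1" for v
    proof (cases "v \<in> J")
      case True
      then have "\<theta> v \<le> (\<Sum>v\<in>J. \<theta> v)"
        using \<theta> finite_J by (intro member_le_sum) (auto simp: mem_simplex_points)
      then show ?thesis using \<theta> by (simp add: mem_simplex_points)
    next
      case False
      then have "\<theta> v = 0" using \<theta> by (auto simp: mem_simplex_points)
      then show ?thesis by simp
    qed
    then show "\<theta> \<in> PiE UNIV (\<lambda>_ :: nat. {0..1 :: real})"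
      using \<theta> by (auto simp: mem_simplex_points)
  qed
  ultimately show ?thesis
    using compact_Int_closed[of "PiE UNIV (\<lambda>_ :: nat. {0..1 :: real})" "simplex_points J"]
    by (simp add: Int_absorb1)
qed

lemma Max_simplex:
  assumes "\<theta> \<in> simplex_points J"
  shows "0 < Max (\<theta> ` J)" "j \<in> J \<Longrightarrow> \<theta> j \<le> Max (\<theta> ` J)" "\<exists>j\<in>J. \<theta> j = Max (\<theta> ` J)"
proof -
  show le: "\<theta> j \<le> Max (\<theta> ` J)" if "j \<in> J" for j using that finite_J by simp
  have "Max (\<theta> ` J) \<in> \<theta> ` J" using finite_J J0 by (intro Max_in) auto
  then show "\<exists>j\<in>J. \<theta> j = Max (\<theta> ` J)" by auto
  show "0 < Max (\<theta> ` J)"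
  proof (rule ccontr)
    assume "\<not> ?thesis"
    then have "(\<Sum>v\<in>J. \<theta> v) \<le> 0" using le by (intro sum_nonpos) force
    then show False using assms by (simp add: mem_simplex_points)
  qed
qed

lemma ray_coord:
  assumes "\<theta> \<in> simplex_points J" "h \<in> {0..1}"
  shows "j \<in> J \<Longrightarrow> 1 - ray J (\<theta>, h) j = h * (\<theta> j / Max (\<theta> ` J))"
    and "j \<in> J \<Longrightarrow> 1 - ray J (\<theta>, h) j \<in> {0..h}" and "\<exists>j\<in>J. 1 - ray J (\<theta>, h) j = h"
proof -
  note M = Max_simplex[OF assms(1)]
  show e: "1 - ray J (\<theta>, h) j = h * (\<theta> j / Max (\<theta> ` J))" if "j \<in> J" for j
    using that J by (auto simp: ray_def)
  show "1 - ray J (\<theta>, h) j \<in> {0..h}" if "j \<in> J" for j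
  proof -
    have "0 \<le> \<theta> j" using assms(1) by (simp add: mem_simplex_points)
    then have q: "0 \<le> \<theta> j / Max (\<theta> ` J)" "\<theta> j / Max (\<theta> ` J) \<le> 1" using M(1,2) that by auto
    have h: "0 \<le> h" using assms(2) by simp
    show ?thesis
      using mult_nonneg_nonneg[OF h q(1)] mult_left_le[OF q(2) h] unfolding e[OF that] atLeastAtMost_iff by blast
  qed
  obtain j where "j \<in> J" "\<theta> j = Max (\<theta> ` J)" using M(3) by blast
  then show "\<exists>j\<in>J. 1 - ray J (\<theta>, h) j = h" using e[of j] M(1) by (intro bexI[of _ j]) auto
qed

lemma ray_in_flat:
  assumes "\<theta> \<in> simplex_points J" "h \<in> {0..1}"
  shows "ray J (\<theta>, h) \<in> flat J"
proof -
  let ?x = "ray J (\<theta>, h)"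
  have off: "?x j = 1" if "j \<in> {1..m} - J" for j using that by (auto simp: ray_def)
  have on: "0 \<le> ?x j \<and> ?x j \<le> 1" if "j \<in> {1..m}" for j
    using ray_coord(2)[OF assms, of j] off[of j] that assms(2) by (cases "j \<in> J") auto
  have "{j\<in>{1..m}. \<bar>?x j\<bar> \<noteq> 1} \<subseteq> {v. \<theta> v \<noteq> 0}"
  proof
    fix j assume j: "j \<in> {j\<in>{1..m}. \<bar>?x j\<bar> \<noteq> 1}"
    have "j \<in> J"
    proof (rule ccontr)
      assume "j \<notin> J"
      then have "?x j = 1" using off j by blast
      then show False using j by simp
    qed
    then show "j \<in> {v. \<theta> v \<noteq> 0}" using j ray_coord(1)[OF assms, of j] by auto
  qed
  moreover have "{v. \<theta> v \<noteq> 0} \<in> K" using assms(1) by (simp add: mem_simplex_points)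
  ultimately have "{j\<in>{1..m}. \<bar>?x j\<bar> \<noteq> 1} \<in> K" by (rule face_down[rotated])
  moreover have "?x \<in> extensional {1..m}" by (simp add: ray_def)
  ultimately show ?thesis
    using on off by (simp add: flat_def chamber_def moment_angle_set_def)
qed

text \<open>Dividing by the maximum gives every ray some coordinate equal to 1 - h, so in each
  direction the walls are met exactly at h = 1.\<close>

lemma ray_walls:
  assumes "\<theta> \<in> simplex_points J" "h \<in> {0..1}"
  shows "ray J (\<theta>, h) \<in> walls J \<longleftrightarrow> h = 1"
proof
  assume "ray J (\<theta>, h) \<in> walls J"
  then obtain j where "j \<in> J" "ray J (\<theta>, h) j = 0" by (auto simp: walls_def)
  then show "h = 1" using ray_coord(2)[OF assms, of j] assms(2) by auto
next
  assume "h = 1"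
  then show "ray J (\<theta>, h) \<in> walls J" using ray_coord(3)[OF assms] by (auto simp: walls_def)
qed

text \<open>The height is recovered as the largest value of 1 - x j. If it is nonzero, these values
  are proportional to the barycentric coordinates, and the sum 1 fixes the factor.\<close>

lemma ray_eq:
  assumes \<theta>: "\<theta> \<in> simplex_points J" "h \<in> {0..1}" and \<theta>': "\<theta>' \<in> simplex_points J" "h' \<in> {0..1}"
    and eq: "ray J (\<theta>, h) = ray J (\<theta>', h')"
  shows "h = h' \<and> (h = 0 \<or> \<theta> = \<theta>')"
proof -
  obtain j j' where "j \<in> J" "1 - ray J (\<theta>, h) j = h" "j' \<in> J" "1 - ray J (\<theta>', h') j' = h'"
    using ray_coord(3)[OF \<theta>] ray_coord(3)[OF \<theta>'] by blast
  then have hh: "h = h'"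
    using ray_coord(2)[OF \<theta>, of j'] ray_coord(2)[OF \<theta>', of j] eq by auto
  moreover have "\<theta> = \<theta>'" if "h \<noteq> 0"
  proof -
    define M M' where "M = Max (\<theta> ` J)" and "M' = Max (\<theta>' ` J)"
    have M: "0 < M" "0 < M'" using Max_simplex(1)[OF \<theta>(1)] Max_simplex(1)[OF \<theta>'(1)] by (simp_all add: M_def M'_def)
    have *: "\<theta> j / M = \<theta>' j / M'" if "j \<in> J" for j
    proof -
      have "h * (\<theta> j / M) = h' * (\<theta>' j / M')"
        unfolding M_def M'_def ray_coord(1)[OF \<theta> that, symmetric] ray_coord(1)[OF \<theta>' that, symmetric] eq ..
      then show ?thesis unfolding hh[symmetric] mult_left_cancel[OF \<open>h \<noteq> 0\<close>] .
    qed
    then have "(\<Sum>j\<in>J. \<theta> j / M) = (\<Sum>j\<in>J. \<theta>' j / M')" by simp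
    then have "M = M'"
      using \<theta>(1) \<theta>'(1) by (simp add: sum_divide_distrib[symmetric] mem_simplex_points)
    show ?thesis
    proof
      fix v show "\<theta> v = \<theta>' v"
      proof (cases "v \<in> J")
        case True
        then show ?thesis using *[OF True] M \<open>M = M'\<close> by simp
      next
        case False
        then have "\<theta> v = 0" "\<theta>' v = 0" using \<theta>(1) \<theta>'(1) by (auto simp: mem_simplex_points)
        then show ?thesis by simp
      qed
    qed
  qed
  ultimately show ?thesis by blast
qed

text \<open>Every element of J is a vertex of K. The resulting point of the realization provides a
  ray through the cone point, and poles for the suspension.\<close>

lemma simplex_points_nonempty: "simplex_points J \<noteq> {}"
proof -
  obtain j where j: "j \<in> J" using J0 by blast
  define \<theta> where "\<theta> = (\<lambda>v. if v = j then 1 else 0 :: real)"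
  have "{v. \<theta> v \<noteq> 0} = {j}" by (auto simp: \<theta>_def)
  moreover have "(\<Sum>v\<in>J. \<theta> v) = 1" using j finite_J by (simp add: \<theta>_def)
  ultimately have "\<theta> \<in> simplex_points J"
    using j J vertex[of j] by (auto simp: mem_simplex_points) (auto simp: \<theta>_def)
  then show ?thesis by blast
qed

lemma ray_surj:
  assumes x: "x \<in> flat J"
  obtains \<theta> h where "\<theta> \<in> simplex_points J" "h \<in> {0..1}" "x = ray J (\<theta>, h)"
proof (cases "\<forall>j\<in>J. x j = 1")
  case True
  obtain \<theta> where \<theta>: "\<theta> \<in> simplex_points J" using simplex_points_nonempty by blast
  have "x j = ray J (\<theta>, 0) j" for j
    using True x chamber_moment_angle(2)[of x m]
    by (cases "j \<in> {1..m}"; cases "j \<in> J") (auto simp: ray_def flat_def extensional_def)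
  then have "x = ray J (\<theta>, 0)" by blast
  then show ?thesis using that[OF \<theta>, of 0] by simp
next
  case False
  have xC: "x \<in> chamber m" using x by (simp add: flat_def)
  have b: "0 \<le> 1 - x j" "1 - x j \<le> 1" if "j \<in> J" for j
    using chamber_m_bounds[OF xC, of j] that J by auto
  define S where "S = (\<Sum>j\<in>J. 1 - x j)"
  define h where "h = Max ((\<lambda>j. 1 - x j) ` J)"
  define \<theta> where "\<theta> = (\<lambda>v. if v \<in> J then (1 - x v) / S else 0)"
  have "S \<noteq> 0"
    using False b finite_J by (auto simp: S_def sum_nonneg_eq_0_iff)
  moreover have "0 \<le> S" unfolding S_def using b by (intro sum_nonneg) auto
  ultimately have S: "0 < S" by simp
  have "{v. \<theta> v \<noteq> 0} \<subseteq> {j\<in>{1..m}. \<bar>x j\<bar> \<noteq> 1}"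
  proof
    fix v assume "v \<in> {v. \<theta> v \<noteq> 0}"
    then have v: "v \<in> J" "x v \<noteq> 1" by (auto simp: \<theta>_def split: if_splits)
    then show "v \<in> {j\<in>{1..m}. \<bar>x j\<bar> \<noteq> 1}" using b[OF v(1)] J by auto
  qed
  moreover have "{j\<in>{1..m}. \<bar>x j\<bar> \<noteq> 1} \<in> K"
    using chamber_moment_angle(1)[OF xC] by (simp add: moment_angle_set_def)
  ultimately have "{v. \<theta> v \<noteq> 0} \<in> K" using face_down by blast
  moreover have "{v. \<theta> v \<noteq> 0} \<subseteq> J" by (auto simp: \<theta>_def)
  moreover have "0 \<le> \<theta> v" for v using b[of v] S by (auto simp: \<theta>_def)
  moreover have "(\<Sum>v\<in>J. \<theta> v) = 1"
    using S by (simp add: \<theta>_def sum_divide_distrib[symmetric] S_def[symmetric])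
  ultimately have \<theta>: "\<theta> \<in> simplex_points J" by (simp add: mem_simplex_points)
  have "h \<in> (\<lambda>j. 1 - x j) ` J" unfolding h_def using finite_J J0 by (intro Max_in) auto
  then have h1: "h \<in> {0..1}" using b by auto
  have hj: "1 - x j \<le> h" if "j \<in> J" for j unfolding h_def using finite_J that by simp
  have "h \<noteq> 0"
  proof
    assume "h = 0"
    then have "\<forall>j\<in>J. x j = 1" using hj b by fastforce
    then show False using False by blast
  qed
  have "Max (\<theta> ` J) = h / S"
  proof (rule Max_eqI)
    show "finite (\<theta> ` J)" using finite_J by simp
    show "y \<le> h / S" if "y \<in> \<theta> ` J" for y
      using that hj S by (auto simp: \<theta>_def divide_right_mono)
    show "h / S \<in> \<theta> ` J"
      using \<open>h \<in> (\<lambda>j. 1 - x j) ` J\<close> by (auto simp: \<theta>_def image_iff)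
  qed
  then have "x j = ray J (\<theta>, h) j" for j
    using x S \<open>h \<noteq> 0\<close> J chamber_moment_angle(2)[OF xC]
    by (cases "j \<in> {1..m}") (auto simp: ray_def flat_def \<theta>_def extensional_def)
  then show ?thesis using that[OF \<theta> h1] by blast
qed

lemma continuous_on_ray: "continuous_on (simplex_points J \<times> {0..1::real}) (ray J)"
proof (rule continuous_on_coordinatewise_then_product)
  fix j
  have c: "continuous_on T (\<lambda>z. fst z v)" for T :: "((nat \<Rightarrow> real) \<times> real) set" and v
    by (intro continuous_on_coordinate continuous_intros)
  have "continuous_on (simplex_points J \<times> {0..1::real}) (\<lambda>z. Max ((\<lambda>v. fst z v) ` J))"
    by (intro continuous_on_Max finite_J J0 c)
  moreover have "Max (fst z ` J) \<noteq> 0" if "z \<in> simplex_points J \<times> {0..1 :: real}" for z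
    using Max_simplex(1)[of "fst z"] that by auto
  ultimately have c1: "continuous_on (simplex_points J \<times> {0..1::real}) (\<lambda>z. 1 - snd z * (fst z j / Max (fst z ` J)))"
    by (intro continuous_on_diff continuous_on_mult continuous_on_divide continuous_on_snd continuous_on_id
        continuous_on_const c) auto
  show "continuous_on (simplex_points J \<times> {0..1::real}) (\<lambda>z. ray J z j)"
  proof (cases "j \<in> J")
    case True
    then have "(\<lambda>z. ray J z j) = (\<lambda>z. 1 - snd z * (fst z j / Max (fst z ` J)))"
      using J by (auto simp: ray_def fun_eq_iff)
    then show ?thesis using c1 by (simp only:)
  next
    case False
    then have "(\<lambda>z. ray J z j) = (\<lambda>_. if j \<in> {1..m} then 1 else undefined)"
      by (auto simp: ray_def fun_eq_iff)
    then show ?thesis by (simp only: continuous_on_const)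
  qed
qed

lemma quotient_map_ray: "quotient_map (top_of_set (simplex_points J \<times> {0..1})) (top_of_set (flat J)) (ray J)"
proof (rule continuous_imp_quotient_map)
  show "continuous_map (top_of_set (simplex_points J \<times> {0..1})) (top_of_set (flat J)) (ray J)"
    using continuous_on_ray ray_in_flat by auto
  show "compact_space (top_of_set (simplex_points J \<times> {0..1 :: real}))"
    by (intro compact_space_subtopology) (simp add: compact_Times compact_simplex_points)
  have "Hausdorff_space (product_topology (\<lambda>_ :: nat. euclideanreal) UNIV)"
    by (simp add: Hausdorff_space_product_topology)
  then show "Hausdorff_space (top_of_set (flat J))"
    unfolding euclidean_product_topology by (rule Hausdorff_space_subtopology)
  show "ray J ` topspace (top_of_set (simplex_points J \<times> {0..1})) = topspace (top_of_set (flat J))"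
    using ray_in_flat by (auto elim: ray_surj)
qed

text \<open>The suspension makes all identifications of \<open>ray\<close>, namely those at h = 0,
  and in addition collapses h = 1, the part of \<open>flat J\<close> on the walls. Going back, in
  \<open>double_suspension_to_stage\<close>, is possible because the stage collapses those
  walls.\<close>

lemma flat_to_suspension:
  obtains \<sigma> where "continuous_map (top_of_set (flat J)) (suspension (top_of_set (simplex_points J))) \<sigma>"
    "\<And>\<theta> h. \<theta> \<in> simplex_points J \<Longrightarrow> h \<in> {0..1} \<Longrightarrow>
       \<sigma> (ray J (\<theta>, h)) = suspension_rel (top_of_set (simplex_points J)) `` {(\<theta>, h)}"
proof -
  let ?P = "top_of_set (simplex_points J)"
  have c: "continuous_map (top_of_set (simplex_points J \<times> {0..1})) (suspension ?P) (\<lambda>z. suspension_rel ?P `` {z})"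
    using quotient_imp_continuous_map[OF quotient_map_suspension[of ?P]] by simp
  have fib: "suspension_rel ?P `` {z} = suspension_rel ?P `` {z'}"
    if "z \<in> topspace (top_of_set (simplex_points J \<times> {0..1}))" "z' \<in> topspace (top_of_set (simplex_points J \<times> {0..1}))"
      "ray J z = ray J z'" for z z'
  proof -
    obtain \<theta> h \<theta>' h' where zz: "z = (\<theta>, h)" "z' = (\<theta>', h')" by (cases z; cases z') blast
    then have in_P: "\<theta> \<in> simplex_points J" "h \<in> {0..1}" "\<theta>' \<in> simplex_points J" "h' \<in> {0..1}"
      using that by auto
    have "h = h' \<and> (h = 0 \<or> \<theta> = \<theta>')" by (rule ray_eq[OF in_P that(3)[unfolded zz]])
    then show ?thesis
      unfolding zz by (subst suspension_class_eq_iff) (use in_P in auto)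
  qed
  obtain \<sigma> where \<sigma>: "continuous_map (top_of_set (flat J)) (suspension ?P) \<sigma>"
    "\<And>z. z \<in> topspace (top_of_set (simplex_points J \<times> {0..1})) \<Longrightarrow> \<sigma> (ray J z) = suspension_rel ?P `` {z}"
    by (rule quotient_map_lift_exists[OF quotient_map_ray c fib]) (assumption+, rule that)
  show ?thesis
    by (rule that[OF \<sigma>(1)]) (simp add: \<sigma>(2))
qed

lemma double_suspension_to_stage:
  obtains k where "continuous_map (suspension (suspension (top_of_set (simplex_points J)))) (stage m) k"
    "\<And>\<theta> h s. \<theta> \<in> simplex_points J \<Longrightarrow> h \<in> {0..1} \<Longrightarrow> s \<in> {0..1} \<Longrightarrow>
       k (suspension_rel (suspension (top_of_set (simplex_points J))) ``
           {(suspension_rel (top_of_set (simplex_points J)) `` {(\<theta>, h)}, s)}) = cls m J (ray J (\<theta>, h)) s"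
proof -
  let ?P = "top_of_set (simplex_points J)"
  let ?T = "top_of_set ((simplex_points J \<times> {0..1 :: real}) \<times> {0..1 :: real})"
  let ?q = "\<lambda>z. suspension_rel (suspension ?P) `` {(suspension_rel ?P `` {fst z}, snd z)}"
  have q: "quotient_map ?T (suspension (suspension ?P)) ?q"
    using quotient_map_double_suspension[of ?P] by simp
  have ch: "ray J z \<in> chamber m" if "z \<in> simplex_points J \<times> {0..1}" for z
    using ray_in_flat[of "fst z" "snd z"] that by (auto simp: flat_def)
  have c: "continuous_map ?T (stage m) (\<lambda>z. cls m J (ray J (fst z)) (snd z))"
    by (intro cls_cont J continuous_on_compose2[OF continuous_on_ray] continuous_intros) (auto intro: ch)
  have fib: "cls m J (ray J (fst z)) (snd z) = cls m J (ray J (fst z')) (snd z')"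
    if "z \<in> topspace ?T" "z' \<in> topspace ?T" "?q z = ?q z'" for z z'
  proof -
    obtain \<theta> h s \<theta>' h' s' where zz: "z = ((\<theta>, h), s)" "z' = ((\<theta>', h'), s')"
      by (metis surj_pair)
    have in_P: "(\<theta>, h) \<in> topspace ?P \<times> {0..1}" "(\<theta>', h') \<in> topspace ?P \<times> {0..1}" "s \<in> {0..1}" "s' \<in> {0..1}"
      using that(1,2) zz by auto
    have "(suspension_rel ?P `` {(\<theta>, h)}, s) \<in> topspace (suspension ?P) \<times> {0..1}"
      "(suspension_rel ?P `` {(\<theta>', h')}, s') \<in> topspace (suspension ?P) \<times> {0..1}"
      unfolding topspace_suspension using in_P by auto
    from suspension_class_eq_iff[OF this] that(3)
    have s: "s = s'" "suspension_rel ?P `` {(\<theta>, h)} = suspension_rel ?P `` {(\<theta>', h')} \<or> s = 0 \<or> s = 1"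
      by (auto simp: zz)
    have in_C: "ray J (\<theta>, h) \<in> chamber m" "ray J (\<theta>', h') \<in> chamber m" using ch in_P by auto
    have "cls m J (ray J (\<theta>, h)) s = cls m J (ray J (\<theta>', h')) s"
      using s(2)
    proof (elim disjE)
      assume "s = 0"
      then show ?thesis using cls_bot[OF J in_C] by simp
    next
      assume "s = 1"
      then show ?thesis using cls_top[OF J in_C(1)] cls_top[OF J in_C(2)] by simp
    next
      assume "suspension_rel ?P `` {(\<theta>, h)} = suspension_rel ?P `` {(\<theta>', h')}"
      then have "h = h' \<and> (\<theta> = \<theta>' \<or> h = 0 \<or> h = 1)"
        unfolding suspension_class_eq_iff[OF in_P(1,2)] .
      then consider "h = h'" "\<theta> = \<theta>'" | "h = 0" "h' = 0" | "h = 1" "h' = 1" by blast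
      then show ?thesis
      proof cases
        case 2
        have "ray J (\<theta>, 0) = ray J (\<theta>', 0)" by (auto simp: ray_def fun_eq_iff)
        then show ?thesis using 2 by simp
      next
        case 3
        then show ?thesis
          using in_P by (intro cls_wall J in_C) (auto simp: ray_walls)
      qed simp
    qed
    then show ?thesis by (simp add: zz s(1))
  qed
  obtain k where k: "continuous_map (suspension (suspension ?P)) (stage m) k"
    "\<And>z. z \<in> topspace ?T \<Longrightarrow> k (?q z) = cls m J (ray J (fst z)) (snd z)"
    by (rule quotient_map_lift_exists[OF q c fib]) (assumption+, rule that)
  have "k (?q ((\<theta>, h), s)) = cls m J (ray J (\<theta>, h)) s"
    if "\<theta> \<in> simplex_points J" "h \<in> {0..1}" "s \<in> {0..1}" for \<theta> h s
    using k(2)[of "((\<theta>, h), s)"] that by simp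
  then show ?thesis
    by (intro that[OF k(1)]) simp
qed

end

end

section \<open>Assembling the second equivalence\<close>

context spanning_complex
begin

lemma stage_0: "suspension (real_moment_angle m K) homotopy_equivalent_space stage 0"
proof -
  have "chamber 0 = Z" by (auto simp: chamber_def)
  then show ?thesis
    unfolding real_moment_angle_eq[OF complex] stage_def
    using suspension_homeomorphic_suspension_wedge[of walls "{}" Z]
    by (auto simp: walls_def intro!: homeomorphic_imp_homotopy_equivalent_space)
qed

lemma stage_le:
  assumes "k \<le> m"
  shows "stage 0 homotopy_equivalent_space stage k"
  using assms
proof (induction k)
  case 0
  show ?case by (rule homotopy_equivalent_space_refl)
next
  case (Suc k)
  then show ?case
    using homotopy_eqv_trans[OF Suc.IH stage_step] by simp
qed

abbreviation "summand J \<equiv> suspension (suspension (realization (full_subcomplex K J)))"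

abbreviation "summand_pole J \<equiv> suspension_pole (suspension (realization (full_subcomplex K J)))"

definition "missing = {J. J \<subseteq> {1..m} \<and> J \<notin> K}"

lemma missingD: "J \<in> missing \<Longrightarrow> J \<subseteq> {1..m}" "J \<in> missing \<Longrightarrow> J \<noteq> {}"
  using empty_in by (auto simp: missing_def)

text \<open>Cylinders of faces go to the wedge point; on the others, x is flattened and read in cone
  coordinates as a point of the inner suspension, while s becomes the outer coordinate. In the
  reverse direction rays are included in the chamber. Flattening fixes rays, so one composite is
  strictly the identity.\<close>

lemma stage_to_wedge:
  assumes I: "missing \<noteq> {}"
  shows "stage m homotopy_equivalent_space wedge summand summand_pole missing"
proof -
  define P where "P = (\<lambda>J. top_of_set (simplex_points J))"
  define sc where "sc = (\<lambda>J z. suspension_rel (P J) `` {z})"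
  define dc where "dc = (\<lambda>J z. suspension_rel (suspension (P J)) `` {z})"
  define wc where "wc = (\<lambda>J p. wedge_rel summand summand_pole missing `` {(J, p)})"
  have summand: "summand J = suspension (suspension (P J))" "summand_pole J = suspension_pole (suspension (P J))" for J
    by (simp_all add: realization_eq P_def)
  have "\<forall>J\<in>missing. \<exists>\<sigma>. continuous_map (top_of_set (flat J)) (suspension (P J)) \<sigma> \<and>
      (\<forall>\<theta>\<in>simplex_points J. \<forall>h\<in>{0..1}. \<sigma> (ray J (\<theta>, h)) = sc J (\<theta>, h))"
  proof
    fix J assume "J \<in> missing"
    from flat_to_suspension[OF missingD[OF this]]
    show "\<exists>\<sigma>. continuous_map (top_of_set (flat J)) (suspension (P J)) \<sigma> \<and>
      (\<forall>\<theta>\<in>simplex_points J. \<forall>h\<in>{0..1}. \<sigma> (ray J (\<theta>, h)) = sc J (\<theta>, h))"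
      unfolding P_def sc_def by metis
  qed
  from bchoice[OF this] obtain \<sigma> where
    \<sigma>c: "\<And>J. J \<in> missing \<Longrightarrow> continuous_map (top_of_set (flat J)) (suspension (P J)) (\<sigma> J)"
    and \<sigma>: "\<And>J \<theta> h. J \<in> missing \<Longrightarrow> \<theta> \<in> simplex_points J \<Longrightarrow> h \<in> {0..1} \<Longrightarrow> \<sigma> J (ray J (\<theta>, h)) = sc J (\<theta>, h)"
    by blast
  have "\<forall>J\<in>missing. \<exists>k. continuous_map (summand J) (stage m) k \<and>
      (\<forall>\<theta>\<in>simplex_points J. \<forall>h\<in>{0..1}. \<forall>s\<in>{0..1}. k (dc J (sc J (\<theta>, h), s)) = cls m J (ray J (\<theta>, h)) s)"
  proof
    fix J assume "J \<in> missing"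
    from double_suspension_to_stage[OF missingD[OF this]]
    show "\<exists>k. continuous_map (summand J) (stage m) k \<and>
      (\<forall>\<theta>\<in>simplex_points J. \<forall>h\<in>{0..1}. \<forall>s\<in>{0..1}. k (dc J (sc J (\<theta>, h), s)) = cls m J (ray J (\<theta>, h)) s)"
      unfolding summand P_def sc_def dc_def by metis
  qed
  from bchoice[OF this] obtain k where
    kc: "\<And>J. J \<in> missing \<Longrightarrow> continuous_map (summand J) (stage m) (k J)"
    and k: "\<And>J \<theta> h s. J \<in> missing \<Longrightarrow> \<theta> \<in> simplex_points J \<Longrightarrow> h \<in> {0..1} \<Longrightarrow> s \<in> {0..1} \<Longrightarrow>
      k J (dc J (sc J (\<theta>, h), s)) = cls m J (ray J (\<theta>, h)) s"
    by blast
  have top_S: "topspace (suspension (P J)) = sc J ` (simplex_points J \<times> {0..1})" for J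
    unfolding topspace_suspension by (simp add: P_def sc_def)
  have top_SS: "topspace (summand J) = dc J ` (topspace (suspension (P J)) \<times> {0..1})" for J
    unfolding summand topspace_suspension[of "suspension (P J)"] by (simp add: dc_def)
  have pole: "summand_pole J = dc J (p, 1)" if "p \<in> topspace (suspension (P J))" for J p
    unfolding summand dc_def by (rule suspension_pole_eq[OF that])
  have point: "\<exists>\<theta>. \<theta> \<in> simplex_points J" if "J \<in> missing" for J
    using simplex_points_nonempty[OF missingD[OF that]] by blast
  have pole_in: "summand_pole J \<in> topspace (summand J)" and k_pole: "k J (summand_pole J) = base m" if J: "J \<in> missing" for J
  proof -
    obtain \<theta> where \<theta>: "\<theta> \<in> simplex_points J" using point[OF J] by blast
    then have S: "sc J (\<theta>, 0) \<in> topspace (suspension (P J))" unfolding top_S by auto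
    show "summand_pole J \<in> topspace (summand J)" unfolding pole[OF S] top_SS using S by auto
    have "ray J (\<theta>, 0) \<in> chamber m"
      using ray_in_flat[OF missingD[OF J] \<theta>, of 0] by (simp add: flat_def)
    then show "k J (summand_pole J) = base m"
      unfolding pole[OF S] using k[OF J \<theta>, of 0 1] cls_top[OF missingD(1)[OF J]] by simp
  qed
  obtain J0 where J0: "J0 \<in> missing" using I by blast
  define c where "c = wc J0 (summand_pole J0)"
  have c: "wc J (summand_pole J) = c" if "J \<in> missing" for J
    unfolding c_def wc_def by (rule wedge_base_eq[OF that J0 pole_in[OF that] pole_in[OF J0]])
  obtain g where gc: "continuous_map (wedge summand summand_pole missing) (stage m) g"
    and g0: "\<And>J p. J \<in> missing \<Longrightarrow> p \<in> topspace (summand J) \<Longrightarrow>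
      g (wedge_rel summand summand_pole missing `` {(J, p)}) = k J p"
    by (rule wedge_lift[OF I kc k_pole]) (assumption+, rule that)
  have g: "g (wc J p) = k J p" if "J \<in> missing" "p \<in> topspace (summand J)" for J p
    unfolding wc_def by (rule g0[OF that])
  define fs where "fs = (\<lambda>(J, x, s). if J \<in> K then c else wc J (dc J (\<sigma> J (flatten J 0 x), s)))"
  have flat: "flatten J 0 x \<in> flat J" if "x \<in> chamber m" for J x
    using flatten_in[OF that, of 0] by (auto simp: flat_def flatten_def)
  have fl_ray: "\<exists>\<theta> h. \<theta> \<in> simplex_points J \<and> h \<in> {0..1} \<and> flatten J 0 x = ray J (\<theta>, h)"
    if "J \<in> missing" "x \<in> chamber m" for J x
    by (rule ray_surj[OF missingD[OF that(1)] flat[OF that(2)]]) blast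
  have \<sigma>_in: "\<sigma> J (flatten J 0 x) \<in> topspace (suspension (P J))" if "J \<in> missing" "x \<in> chamber m" for J x
    using fl_ray[OF that] \<sigma>[OF that(1)] unfolding top_S by force
  have top_c: "c \<in> topspace (wedge summand summand_pole missing)"
    unfolding c_def wc_def using continuous_map_into_wedge[OF J0, of summand summand_pole] pole_in[OF J0]
    by (auto simp: continuous_map_def)
  have fs_cont: "continuous_map (top_of_set (chamber m \<times> {0..1})) (wedge summand summand_pole missing) (\<lambda>z. fs (J, z))"
    if "J \<in> Pow {1..m}" for J
  proof (cases "J \<in> K")
    case True
    then show ?thesis using top_c by (simp add: fs_def case_prod_unfold)
  next
    case False
    then have J: "J \<in> missing" using that by (simp add: missing_def)
    have "continuous_map (top_of_set (chamber m \<times> {0..1})) (top_of_set (flat J)) (\<lambda>z. flatten J 0 (fst z))"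
      using flat by (auto intro!: continuous_on_flatten continuous_on_fst continuous_on_id continuous_on_const)
    from continuous_map_compose[OF this \<sigma>c[OF J]]
    have "continuous_map (top_of_set (chamber m \<times> {0..1})) (suspension (P J)) (\<lambda>z. \<sigma> J (flatten J 0 (fst z)))"
      by (simp add: o_def)
    moreover have "continuous_map (top_of_set (chamber m \<times> {0..1})) (top_of_set {0..1 :: real}) snd"
      by (auto intro!: continuous_on_snd continuous_on_id)
    ultimately have "continuous_map (top_of_set (chamber m \<times> {0..1})) (summand J) (\<lambda>z. dc J (\<sigma> J (flatten J 0 (fst z)), snd z))"
      unfolding summand dc_def by (rule continuous_map_suspension_class)
    from continuous_map_compose[OF this continuous_map_into_wedge[OF J, of summand summand_pole]]
    show ?thesis using False by (simp add: o_def fs_def case_prod_unfold wc_def)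
  qed
  have fs_compat: "slice_compatible (chamber m) (walls J) c (\<lambda>z. fs (J, z))" if "J \<in> Pow {1..m}" for J
  proof (cases "J \<in> K")
    case True
    then show ?thesis by (simp add: fs_def slice_compatible_def)
  next
    case False
    then have J: "J \<in> missing" using that by (simp add: missing_def)
    have fs: "fs (J, x, s) = wc J (dc J (\<sigma> J (flatten J 0 x), s))" for x s using False by (simp add: fs_def)
    show ?thesis
    proof (rule slice_compatibleI)
      show "fs (J, x, 1) = c" if "x \<in> chamber m" for x
        unfolding fs pole[OF \<sigma>_in[OF J that], symmetric] by (rule c[OF J])
      show "fs (J, x, 0) = fs (J, x', 0)" if "x \<in> chamber m" "x' \<in> chamber m" for x x'
      proof -
        have "dc J (\<sigma> J (flatten J 0 x), 0) = dc J (\<sigma> J (flatten J 0 x'), 0)"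
          unfolding dc_def using \<sigma>_in[OF J that(1)] \<sigma>_in[OF J that(2)] by (subst suspension_class_eq_iff) auto
        then show ?thesis by (simp add: fs)
      qed
      show "fs (J, x, s) = fs (J, x', s)"
        if x: "x \<in> chamber m" "x \<in> walls J" "x' \<in> chamber m" "x' \<in> walls J" "s \<in> {0..1}" for x x' s
      proof -
        \<comment> \<open>A point on a wall flattens to a ray with h = 1, that is, to the upper pole
          of the inner suspension. Hence all walls of J have the same image at each level.\<close>
        have one: "\<exists>\<theta>\<in>simplex_points J. \<sigma> J (flatten J 0 y) = sc J (\<theta>, 1)" if y: "y \<in> chamber m" "y \<in> walls J" for y
        proof -
          obtain \<theta> h where \<theta>: "\<theta> \<in> simplex_points J" "h \<in> {0..1}" "flatten J 0 y = ray J (\<theta>, h)"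
            using fl_ray[OF J y(1)] by blast
          have "h = 1"
            using ray_walls[OF missingD[OF J] \<theta>(1,2)] flatten_walls[OF missingD(1)[OF J] y(2), of 0] \<theta>(3) by simp
          then show ?thesis using \<sigma>[OF J \<theta>(1,2)] \<theta>(1,3) by auto
        qed
        obtain \<theta> \<theta>' where \<theta>: "\<theta> \<in> simplex_points J" "\<theta>' \<in> simplex_points J"
          "\<sigma> J (flatten J 0 x) = sc J (\<theta>, 1)" "\<sigma> J (flatten J 0 x') = sc J (\<theta>', 1)"
          using one[OF x(1,2)] one[OF x(3,4)] by blast
        have "sc J (\<theta>, 1) = sc J (\<theta>', 1)"
          unfolding sc_def using \<theta>(1,2) by (subst suspension_class_eq_iff) (auto simp: P_def)
        then show ?thesis by (simp add: fs \<theta>(3,4))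
      qed
    qed
  qed
  obtain f where fc: "continuous_map (stage m) (wedge summand summand_pole missing) f"
    and f: "\<And>J x s. J \<in> Pow {1..m} \<Longrightarrow> x \<in> chamber m \<Longrightarrow> s \<in> {0..1} \<Longrightarrow> f (cls m J x s) = fs (J, x, s)"
    unfolding stage_def cls_def by (rule suspension_wedge_lift[OF fs_cont fs_compat])
      (assumption+, rule that[unfolded stage_def cls_def])
  show ?thesis
  proof (rule stage_homotopy_equivalent[OF fc gc])
    fix J x s assume J: "J \<subseteq> {1..m}" and x: "x \<in> chamber m" and s: "s \<in> {0..1 :: real}"
    show "g (f (cls m J x s)) = (if J \<in> K then base m else cls m J (flatten J 0 x) s)"
    proof (cases "J \<in> K")
      case True
      have "g c = base m" unfolding c_def using g[OF J0 pole_in[OF J0]] k_pole[OF J0] by simp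
      then show ?thesis using True f[of J x s] J x s by (simp add: fs_def)
    next
      case False
      then have JI: "J \<in> missing" using J by (simp add: missing_def)
      obtain \<theta> h where \<theta>: "\<theta> \<in> simplex_points J" "h \<in> {0..1}" "flatten J 0 x = ray J (\<theta>, h)"
        using fl_ray[OF JI x] by blast
      have "dc J (\<sigma> J (flatten J 0 x), s) \<in> topspace (summand J)"
        unfolding top_SS using \<sigma>_in[OF JI x] s by blast
      then have "g (fs (J, x, s)) = k J (dc J (\<sigma> J (flatten J 0 x), s))"
        using g[OF JI] False by (simp add: fs_def)
      also have "\<dots> = cls m J (ray J (\<theta>, h)) s"
        unfolding \<theta>(3) \<sigma>[OF JI \<theta>(1,2)] by (rule k[OF JI \<theta>(1,2) s])
      finally show ?thesis using False f[of J x s] J x s by (simp add: \<theta>(3))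
    qed
  next
    fix w assume "w \<in> topspace (wedge summand summand_pole missing)"
    then obtain z where z: "z \<in> topspace (sum_topology summand missing)"
      "w = wedge_rel summand summand_pole missing `` {z}"
      unfolding quotient_imp_surjective_map[OF quotient_map_wedge[OF I, of summand summand_pole], symmetric] by blast
    obtain J p where zJ: "z = (J, p)" by (cases z)
    have J: "J \<in> missing" "p \<in> topspace (summand J)" "w = wc J p"
      using z unfolding zJ wc_def by simp_all
    have "p \<in> dc J ` (topspace (suspension (P J)) \<times> {0..1})" using J(2) unfolding top_SS .
    then obtain y s where y: "y \<in> topspace (suspension (P J))" and s: "s \<in> {0..1}" and p': "p = dc J (y, s)"
      by blast
    obtain \<theta> h where \<theta>: "\<theta> \<in> simplex_points J" "h \<in> {0..1}" and "y = sc J (\<theta>, h)"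
      using y unfolding top_S by blast
    then have p: "p = dc J (sc J (\<theta>, h), s)" by (simp add: p')
    have ray: "ray J (\<theta>, h) \<in> flat J" by (rule ray_in_flat[OF missingD[OF J(1)] \<theta>])
    then have ray_C: "ray J (\<theta>, h) \<in> chamber m" by (simp add: flat_def)
    have "flatten J 0 (ray J (\<theta>, h)) j = ray J (\<theta>, h) j" for j
      using ray chamber_moment_angle(2)[OF ray_C] by (auto simp: flatten_def flat_def extensional_def)
    then have fr: "flatten J 0 (ray J (\<theta>, h)) = ray J (\<theta>, h)" by blast
    have "g w = cls m J (ray J (\<theta>, h)) s"
      unfolding J(3) g[OF J(1,2)] unfolding p by (rule k[OF J(1) \<theta> s])
    then have "f (g w) = fs (J, ray J (\<theta>, h), s)"
      using f[OF _ ray_C s, of J] missingD(1)[OF J(1)] by simp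
    also have "\<dots> = w"
      using J(1) \<sigma>[OF J(1) \<theta>] by (simp add: fs_def missing_def fr J(3) p)
    finally show "f (g w) = w" .
  qed
qed

text \<open>If every subset is a face, all cylinders contract to the common pole. The empty wedge is
  encoded as the one-point space with point \<open>{}\<close>, so constant maps suffice in both
  directions.\<close>

lemma stage_to_empty_wedge:
  assumes "missing = {}"
  shows "stage m homotopy_equivalent_space wedge summand summand_pole missing"
proof -
  have W: "wedge summand summand_pole missing = discrete_topology {{}}"
    using assms by (simp add: wedge_def)
  have "base m \<in> topspace (stage m)"
    using quotient_imp_surjective_map[OF quotient_map_suspension_wedge[of "Pow {1..m}" "chamber m" walls]] one_in[of m]
    unfolding stage_def cls_def by force
  then show ?thesis
    unfolding W
    by (intro stage_homotopy_equivalent[where f = "\<lambda>_. {}" and g = "\<lambda>_. base m"])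
      (use assms in \<open>auto simp: missing_def\<close>)
qed

lemma suspension_splitting:
  "suspension (real_moment_angle m K) homotopy_equivalent_space wedge summand summand_pole missing"
proof -
  have "stage m homotopy_equivalent_space wedge summand summand_pole missing"
    using stage_to_wedge stage_to_empty_wedge by (cases "missing = {}") auto
  from homotopy_eqv_trans[OF homotopy_eqv_trans[OF stage_0 stage_le[OF le_refl]] this]
  show ?thesis .
qed

end

theorem proposition3p2:
  fixes m :: nat and K :: "nat set set"
  assumes "simplicial_complex_on {1..m} K"
    and "\<forall>j\<in>{1..m}. \<exists>\<sigma>\<in>K. j \<in> \<sigma>"
  shows "suspension (real_moment_angle m K) homotopy_equivalent_space
           suspension (real_moment_angle_faces m (cone_space K) (cone_facet K))
       \<and> suspension (real_moment_angle_faces m (cone_space K) (cone_facet K)) homotopy_equivalent_space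
           wedge (\<lambda>J. suspension (suspension (realization (full_subcomplex K J))))
                 (\<lambda>J. suspension_pole (suspension (realization (full_subcomplex K J))))
                 {J. J \<subseteq> {1..m} \<and> J \<notin> K}"
proof -
  interpret vertex_complex m K
    by unfold_locales (rule assms(1))
  have "{j} \<in> K" if j: "j \<in> {1..m}" for j
  proof -
    obtain \<sigma> where "\<sigma> \<in> K" "j \<in> \<sigma>" using assms(2) j by blast
    then show ?thesis using face_down[of \<sigma> "{j}"] by simp
  qed
  then interpret spanning_complex m K
    by unfold_locales
  have 1: "suspension (real_moment_angle m K) homotopy_equivalent_space
      suspension (real_moment_angle_faces m (cone_space K) (cone_facet K))"
    by (rule homotopy_equivalent_suspension[OF moment_angle_homotopy_equivalent_faces])
  then have "suspension (real_moment_angle_faces m (cone_space K) (cone_facet K)) homotopy_equivalent_space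
      suspension (real_moment_angle m K)"
    unfolding homotopy_equivalent_space_sym[of "suspension (real_moment_angle m K)"] .
  from 1 homotopy_eqv_trans[OF this suspension_splitting] show ?thesis
    unfolding missing_def by blast
qed

end
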